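(* Let $\mathbb{K}$ be a field of characteristic $0$, let $\mathfrak{L}$ and $\mathfrak{K}$ be Lie-Yamaguti algebras over $\mathbb{K}$ with $\mathfrak{L}$ finite-dimensional, with fixed bases $\{e_1,\dots,e_n\}$ of $\mathfrak{L}$ and $\{f_i:i\in I\}$ of $\mathfrak{K}$, and let $\mathcal{A}(\mathfrak{L},\mathfrak{K})$ be their universal algebra with generators $x_{si}$ ($s=1,\dots,n$, $i\in I$). Let $(U,\rho,D,\theta)$ be an $\mathfrak{L}$-module and $(W,\cdot)$ a left $\mathcal{A}(\mathfrak{L},\mathfrak{K})$-module. Then $U\otimes W$ becomes a $\mathfrak{K}$-module with the following module maps (extended linearly, respectively bilinearly, in the $\mathfrak{K}$-arguments, and linearly in $U\otimes W$), for $u\in U$, $w\in W$: $$\rho_{U\otimes W}(f_p)(u\otimes w):=\sum_{i=1}^n\rho(e_i)(u)\otimes x_{ip}\cdot w,\qquad\forall\,p\in I,$$ $$D_{U\otimes W}(f_p,f_q)(u\otimes w):=\sum_{i,j=1}^n D(e_i,e_j)(u)\otimes(x_{ip}x_{jq})\cdot w,\qquad\forall\,p,q\in I,$$ $$\theta_{U\otimes W}(f_p,f_q)(u\otimes w):=\sum_{i,j=1}^n\theta(e_i,e_j)(u)\otimes(x_{ip}x_{jq})\cdot w,\qquad\forall\,p,q\in I.$$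
   Context: All vector spaces and (multi)linear maps are over a fixed field $\mathbb{K}$ of characteristic $0$; algebras are unital and associative. A Lie-Yamaguti algebra is a triple $(\mathfrak{L},[\cdot,\cdot],\{\cdot,\cdot,\cdot\})$ with $\mathfrak{L}$ a $\mathbb{K}$-vector space, $[\cdot,\cdot]$ bilinear and $\{\cdot,\cdot,\cdot\}$ trilinear (both with values in $\mathfrak{L}$) such that for all $a,b,c,d,e\in\mathfrak{L}$: (LY1) $[a,b]=-[b,a]$; (LY2) $\{a,b,c\}=-\{b,a,c\}$; (LY3) $[[a,b],c]+\{a,b,c\}+[[b,c],a]+\{b,c,a\}+[[c,a],b]+\{c,a,b\}=0$; (LY4) $\{[a,b],c,d\}+\{[b,c],a,d\}+\{[c,a],b,d\}=0$; (LY5) $\{a,b,[c,d]\}=[\{a,b,c\},d]+[c,\{a,b,d\}]$; (LY6) $\{a,b,\{c,d,e\}\}=\{\{a,b,c\},d,e\}+\{c,\{a,b,d\},e\}+\{c,d,\{a,b,e\}\}$. A module of a Lie-Yamaguti algebra $\mathfrak{L}$ (an $\mathfrak{L}$-module) is a vector space $V$ with a linear map $\rho:\mathfrak{L}\to\operatorname{End}(V)$ and bilinear maps $D,\theta:\mathfrak{L}\times\mathfrak{L}\to\operatorname{End}(V)$ such that for all $a,b,c,d\in\mathfrak{L}$ (brackets of endomorphisms are commutators): (R1) $D(a,b)+\theta(a,b)-\theta(b,a)=[\rho(a),\rho(b)]-\rho([a,b])$; (R2) $\theta(a,[b,c])-\rho(b)\theta(a,c)+\rho(c)\theta(a,b)=0$;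 (R3) $\theta([a,b],c)-\theta(a,c)\rho(b)+\theta(b,c)\rho(a)=0$; (R4) $\theta(c,d)\theta(a,b)-\theta(b,d)\theta(a,c)-\theta(a,\{b,c,d\})+D(b,c)\theta(a,d)=0$; (R5) $[D(a,b),\rho(c)]=\rho(\{a,b,c\})$; (R6) $[D(a,b),\theta(c,d)]=\theta(\{a,b,c\},d)+\theta(c,\{a,b,d\})$. Universal algebra of $\mathfrak{L}$ and $\mathfrak{K}$: write $[e_i,e_j]=\sum_{s=1}^n\tau_{ij}^s e_s$, $\{e_i,e_j,e_k\}=\sum_{s=1}^n\omega_{ijk}^s e_s$ in $\mathfrak{L}$, and $[f_i,f_j]=\sum_{u\in B_{ij}}\alpha_{ij}^u f_u$, $\{f_i,f_j,f_k\}=\sum_{u\in C_{ijk}}\beta_{ijk}^u f_u$ in $\mathfrak{K}$, with $B_{ij},C_{ijk}\subset I$ finite. Then $\mathcal{A}(\mathfrak{L},\mathfrak{K}):=\mathbb{K}[X_{si}:s=1,\dots,n,\ i\in I]/J$ (a commutative algebra), where $J$ is the ideal generated by all polynomials $\sum_{u\in B_{ij}}\alpha_{ij}^u X_{au}-\sum_{s,t=1}^n\tau_{st}^a X_{si}X_{tj}$ and $\sum_{u\in C_{ijk}}\beta_{ijk}^u X_{au}-\sum_{r,s,t=1}^n\omega_{rst}^a X_{ri}X_{sj}X_{tk}$, for $a=1,\dots,n$ and $i,j,k\in I$; $x_{si}$ denotes the class of $X_{si}$. *)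

theory Defs
  imports "Jordan_Normal_Form.Missing_VectorSpace" "HOL-Algebra.Indexed_Polynomials"
begin

section \<open>Multilinear maps and bases\<close>

definition bilinear_map ::
  "('k, 'm) ring_scheme \<Rightarrow> ('k, 'a, 'p) module_scheme \<Rightarrow> ('k, 'b, 'q) module_scheme \<Rightarrow>
   ('k, 'c, 'r) module_scheme \<Rightarrow> ('a \<Rightarrow> 'b \<Rightarrow> 'c) \<Rightarrow> bool" where
  "bilinear_map K V1 V2 V f \<longleftrightarrow>
     (\<forall>x \<in> carrier V1. f x \<in> LinearCombinations.module_hom K V2 V) \<and>
     (\<forall>y \<in> carrier V2. (\<lambda>x. f x y) \<in> LinearCombinations.module_hom K V1 V)"

definition trilinear_map ::
  "('k, 'm) ring_scheme \<Rightarrow> ('k, 'a, 'p) module_scheme \<Rightarrow> ('k, 'b, 'q) module_scheme \<Rightarrow>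
   ('k, 'c, 'r) module_scheme \<Rightarrow> ('k, 'd, 's) module_scheme \<Rightarrow> ('a \<Rightarrow> 'b \<Rightarrow> 'c \<Rightarrow> 'd) \<Rightarrow> bool" where
  "trilinear_map K V1 V2 V3 V f \<longleftrightarrow>
     (\<forall>x \<in> carrier V1. \<forall>y \<in> carrier V2. f x y \<in> LinearCombinations.module_hom K V3 V) \<and>
     (\<forall>x \<in> carrier V1. \<forall>z \<in> carrier V3. (\<lambda>y. f x y z) \<in> LinearCombinations.module_hom K V2 V) \<and>
     (\<forall>y \<in> carrier V2. \<forall>z \<in> carrier V3. (\<lambda>x. f x y z) \<in> LinearCombinations.module_hom K V1 V)"

definition indexed_basis ::
  "('k, 'm) ring_scheme \<Rightarrow> ('k, 'a, 'p) module_scheme \<Rightarrow> 'i set \<Rightarrow> ('i \<Rightarrow> 'a) \<Rightarrow> bool" where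
  "indexed_basis K V I b \<longleftrightarrow> inj_on b I \<and> vectorspace.basis K V (b ` I)"

definition field_of_char_0 :: "('k, 'm) ring_scheme \<Rightarrow> bool" where
  "field_of_char_0 K \<longleftrightarrow> field K \<and> (\<forall>m::nat. m > 0 \<longrightarrow> [m] \<cdot>\<^bsub>K\<^esub> \<one>\<^bsub>K\<^esub> \<noteq> \<zero>\<^bsub>K\<^esub>)"


section \<open>Lie-Yamaguti algebras and their modules\<close>

record ('a, 'b) ly_algebra = "('a, 'b) module" +
  bracket :: "'b \<Rightarrow> 'b \<Rightarrow> 'b" (\<open>\<langle>_, _\<rangle>\<index>\<close>)
  triple :: "'b \<Rightarrow> 'b \<Rightarrow> 'b \<Rightarrow> 'b" (\<open>\<lbrace>_, _, _\<rbrace>\<index>\<close>)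

locale lie_yamaguti = vectorspace K L
  for K :: "('k, 'm) ring_scheme" and L :: "('k, 'l, 'p) ly_algebra_scheme" (structure) +
  assumes bracket_bilinear: "bilinear_map K L L L (bracket L)"
    and triple_trilinear: "trilinear_map K L L L L (triple L)"
    and LY1: "\<lbrakk>a \<in> carrier L; b \<in> carrier L\<rbrakk> \<Longrightarrow> \<langle>a, b\<rangle> = \<ominus> \<langle>b, a\<rangle>"
    and LY2: "\<lbrakk>a \<in> carrier L; b \<in> carrier L; c \<in> carrier L\<rbrakk> \<Longrightarrow> \<lbrace>a, b, c\<rbrace> = \<ominus> \<lbrace>b, a, c\<rbrace>"
    and LY3: "\<lbrakk>a \<in> carrier L; b \<in> carrier L; c \<in> carrier L\<rbrakk> \<Longrightarrow>
      \<langle>\<langle>a, b\<rangle>, c\<rangle> \<oplus> \<lbrace>a, b, c\<rbrace> \<oplus> \<langle>\<langle>b, c\<rangle>, a\<rangle> \<oplus> \<lbrace>b, c, a\<rbrace> \<oplus> \<langle>\<langle>c, a\<rangle>, b\<rangle> \<oplus> \<lbrace>c, a, b\<rbrace> = \<zero>"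
    and LY4: "\<lbrakk>a \<in> carrier L; b \<in> carrier L; c \<in> carrier L; d \<in> carrier L\<rbrakk> \<Longrightarrow>
      \<lbrace>\<langle>a, b\<rangle>, c, d\<rbrace> \<oplus> \<lbrace>\<langle>b, c\<rangle>, a, d\<rbrace> \<oplus> \<lbrace>\<langle>c, a\<rangle>, b, d\<rbrace> = \<zero>"
    and LY5: "\<lbrakk>a \<in> carrier L; b \<in> carrier L; c \<in> carrier L; d \<in> carrier L\<rbrakk> \<Longrightarrow>
      \<lbrace>a, b, \<langle>c, d\<rangle>\<rbrace> = \<langle>\<lbrace>a, b, c\<rbrace>, d\<rangle> \<oplus> \<langle>c, \<lbrace>a, b, d\<rbrace>\<rangle>"
    and LY6: "\<lbrakk>a \<in> carrier L; b \<in> carrier L; c \<in> carrier L; d \<in> carrier L; x \<in> carrier L\<rbrakk> \<Longrightarrow>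
      \<lbrace>a, b, \<lbrace>c, d, x\<rbrace>\<rbrace> = \<lbrace>\<lbrace>a, b, c\<rbrace>, d, x\<rbrace> \<oplus> \<lbrace>c, \<lbrace>a, b, d\<rbrace>, x\<rbrace> \<oplus> \<lbrace>c, d, \<lbrace>a, b, x\<rbrace>\<rbrace>"

text \<open>
  A linear map from \<open>L\<close> to the endomorphisms of \<open>V\<close> is given in curried form, as a bilinear map
  from \<open>L\<close> and \<open>V\<close> to \<open>V\<close>; likewise a bilinear map from \<open>L\<close> and \<open>L\<close> to the endomorphisms is a
  trilinear map. Identities between endomorphisms are stated at every vector \<open>v\<close>.
\<close>

definition ly_module_maps ::
  "('k, 'm) ring_scheme \<Rightarrow> ('k, 'l, 'p) ly_algebra_scheme \<Rightarrow> ('k, 'v, 'q) module_scheme \<Rightarrow>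
   ('l \<Rightarrow> 'v \<Rightarrow> 'v) \<Rightarrow> ('l \<Rightarrow> 'l \<Rightarrow> 'v \<Rightarrow> 'v) \<Rightarrow> ('l \<Rightarrow> 'l \<Rightarrow> 'v \<Rightarrow> 'v) \<Rightarrow> bool" where
  "ly_module_maps K L V \<rho> D \<theta> \<longleftrightarrow>
     bilinear_map K L V V \<rho> \<and> trilinear_map K L L V V D \<and> trilinear_map K L L V V \<theta>"

locale ly_module =
  L: lie_yamaguti K L + V: vectorspace K V
  for K :: "('k, 'm) ring_scheme" and L :: "('k, 'l, 'p) ly_algebra_scheme" (structure)
    and V :: "('k, 'v, 'q) module_scheme" +
  fixes \<rho> :: "'l \<Rightarrow> 'v \<Rightarrow> 'v"
    and D \<theta> :: "'l \<Rightarrow> 'l \<Rightarrow> 'v \<Rightarrow> 'v"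
  assumes maps: "ly_module_maps K L V \<rho> D \<theta>"
    and R1: "\<lbrakk>a \<in> carrier L; b \<in> carrier L; v \<in> carrier V\<rbrakk> \<Longrightarrow>
      D a b v \<oplus>\<^bsub>V\<^esub> \<theta> a b v \<ominus>\<^bsub>V\<^esub> \<theta> b a v
        = (\<rho> a (\<rho> b v) \<ominus>\<^bsub>V\<^esub> \<rho> b (\<rho> a v)) \<ominus>\<^bsub>V\<^esub> \<rho> \<langle>a, b\<rangle> v"
    and R2: "\<lbrakk>a \<in> carrier L; b \<in> carrier L; c \<in> carrier L; v \<in> carrier V\<rbrakk> \<Longrightarrow>
      \<theta> a \<langle>b, c\<rangle> v \<ominus>\<^bsub>V\<^esub> \<rho> b (\<theta> a c v) \<oplus>\<^bsub>V\<^esub> \<rho> c (\<theta> a b v) = \<zero>\<^bsub>V\<^esub>"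
    and R3: "\<lbrakk>a \<in> carrier L; b \<in> carrier L; c \<in> carrier L; v \<in> carrier V\<rbrakk> \<Longrightarrow>
      \<theta> \<langle>a, b\<rangle> c v \<ominus>\<^bsub>V\<^esub> \<theta> a c (\<rho> b v) \<oplus>\<^bsub>V\<^esub> \<theta> b c (\<rho> a v) = \<zero>\<^bsub>V\<^esub>"
    and R4: "\<lbrakk>a \<in> carrier L; b \<in> carrier L; c \<in> carrier L; d \<in> carrier L; v \<in> carrier V\<rbrakk> \<Longrightarrow>
      \<theta> c d (\<theta> a b v) \<ominus>\<^bsub>V\<^esub> \<theta> b d (\<theta> a c v) \<ominus>\<^bsub>V\<^esub> \<theta> a \<lbrace>b, c, d\<rbrace> v \<oplus>\<^bsub>V\<^esub> D b c (\<theta> a d v) = \<zero>\<^bsub>V\<^esub>"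
    and R5: "\<lbrakk>a \<in> carrier L; b \<in> carrier L; c \<in> carrier L; v \<in> carrier V\<rbrakk> \<Longrightarrow>
      D a b (\<rho> c v) \<ominus>\<^bsub>V\<^esub> \<rho> c (D a b v) = \<rho> \<lbrace>a, b, c\<rbrace> v"
    and R6: "\<lbrakk>a \<in> carrier L; b \<in> carrier L; c \<in> carrier L; d \<in> carrier L; v \<in> carrier V\<rbrakk> \<Longrightarrow>
      D a b (\<theta> c d v) \<ominus>\<^bsub>V\<^esub> \<theta> c d (D a b v) = \<theta> \<lbrace>a, b, c\<rbrace> d v \<oplus>\<^bsub>V\<^esub> \<theta> c \<lbrace>a, b, d\<rbrace> v"


section \<open>Tensor products\<close>

text \<open>
  The fields \<open>mult\<close> and \<open>one\<close> of a module record play no role and are left undefined in the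
  constructions of this section.
\<close>

definition free_module :: "('k, 'm) ring_scheme \<Rightarrow> 's set \<Rightarrow> ('k, 's \<Rightarrow> 'k) module" where
  "free_module K S =
    \<lparr>carrier = {f. (\<forall>s. f s \<in> carrier K) \<and> {s. f s \<noteq> \<zero>\<^bsub>K\<^esub>} \<subseteq> S \<and> finite {s. f s \<noteq> \<zero>\<^bsub>K\<^esub>}},
     monoid.mult = undefined,
     monoid.one = undefined,
     ring.zero = (\<lambda>s. \<zero>\<^bsub>K\<^esub>),
     ring.add = (\<lambda>f g s. f s \<oplus>\<^bsub>K\<^esub> g s),
     module.smult = (\<lambda>c f s. c \<otimes>\<^bsub>K\<^esub> f s)\<rparr>"

definition free_gen :: "('k, 'm) ring_scheme \<Rightarrow> 's \<Rightarrow> 's \<Rightarrow> 'k" where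
  "free_gen K s = (\<lambda>t. if t = s then \<one>\<^bsub>K\<^esub> else \<zero>\<^bsub>K\<^esub>)"

definition quotient_module :: "('k, 'v, 'm) module_scheme \<Rightarrow> 'v set \<Rightarrow> ('k, 'v set) module" where
  "quotient_module V N =
    \<lparr>carrier = a_rcosets\<^bsub>V\<^esub> N,
     monoid.mult = undefined,
     monoid.one = undefined,
     ring.zero = N,
     ring.add = set_add V,
     module.smult = (\<lambda>c S. \<Union>v\<in>S. N +>\<^bsub>V\<^esub> (c \<odot>\<^bsub>V\<^esub> v))\<rparr>"

definition tensor_relations ::
  "('k, 'm) ring_scheme \<Rightarrow> ('k, 'u, 'p) module_scheme \<Rightarrow> ('k, 'w, 'q) module_scheme \<Rightarrow>
   ('u \<times> 'w \<Rightarrow> 'k) set" where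
  "tensor_relations K U W =
    (let F = free_module K (carrier U \<times> carrier W); \<delta> = (\<lambda>u w. free_gen K (u, w)) in
      {\<delta> (u \<oplus>\<^bsub>U\<^esub> u') w \<ominus>\<^bsub>F\<^esub> (\<delta> u w \<oplus>\<^bsub>F\<^esub> \<delta> u' w)
        | u u' w. u \<in> carrier U \<and> u' \<in> carrier U \<and> w \<in> carrier W} \<union>
      {\<delta> u (w \<oplus>\<^bsub>W\<^esub> w') \<ominus>\<^bsub>F\<^esub> (\<delta> u w \<oplus>\<^bsub>F\<^esub> \<delta> u w')
        | u w w'. u \<in> carrier U \<and> w \<in> carrier W \<and> w' \<in> carrier W} \<union>
      {\<delta> (c \<odot>\<^bsub>U\<^esub> u) w \<ominus>\<^bsub>F\<^esub> c \<odot>\<^bsub>F\<^esub> \<delta> u w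
        | c u w. c \<in> carrier K \<and> u \<in> carrier U \<and> w \<in> carrier W} \<union>
      {\<delta> u (c \<odot>\<^bsub>W\<^esub> w) \<ominus>\<^bsub>F\<^esub> c \<odot>\<^bsub>F\<^esub> \<delta> u w
        | c u w. c \<in> carrier K \<and> u \<in> carrier U \<and> w \<in> carrier W})"

definition tensor_kernel ::
  "('k, 'm) ring_scheme \<Rightarrow> ('k, 'u, 'p) module_scheme \<Rightarrow> ('k, 'w, 'q) module_scheme \<Rightarrow>
   ('u \<times> 'w \<Rightarrow> 'k) set" where
  "tensor_kernel K U W =
     LinearCombinations.module.span K (free_module K (carrier U \<times> carrier W)) (tensor_relations K U W)"

definition tensor_product ::
  "('k, 'm) ring_scheme \<Rightarrow> ('k, 'u, 'p) module_scheme \<Rightarrow> ('k, 'w, 'q) module_scheme \<Rightarrow>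
   ('k, ('u \<times> 'w \<Rightarrow> 'k) set) module" where
  "tensor_product K U W =
     quotient_module (free_module K (carrier U \<times> carrier W)) (tensor_kernel K U W)"

definition pure_tensor ::
  "('k, 'm) ring_scheme \<Rightarrow> ('k, 'u, 'p) module_scheme \<Rightarrow> ('k, 'w, 'q) module_scheme \<Rightarrow>
   'u \<Rightarrow> 'w \<Rightarrow> ('u \<times> 'w \<Rightarrow> 'k) set" where
  "pure_tensor K U W u w =
     tensor_kernel K U W +>\<^bsub>free_module K (carrier U \<times> carrier W)\<^esub> free_gen K (u, w)"

definition restrict_scalars :: "('k \<Rightarrow> 'a) \<Rightarrow> ('a, 'w, 'm) module_scheme \<Rightarrow> ('k, 'w) module" where
  "restrict_scalars h W =
    \<lparr>carrier = carrier W,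
     monoid.mult = undefined,
     monoid.one = undefined,
     ring.zero = \<zero>\<^bsub>W\<^esub>,
     ring.add = ring.add W,
     module.smult = (\<lambda>c w. h c \<odot>\<^bsub>W\<^esub> w)\<rparr>"


section \<open>The universal algebra\<close>

text \<open>
  The polynomial ring over \<open>K\<close> in the variables from \<open>V\<close>. Polynomials are the coefficient
  functions on monomials (multisets of variables) of \<^theory>\<open>HOL-Algebra.Indexed_Polynomials\<close>,
  which provides the carrier and the addition but no product.
\<close>

definition poly_ring :: "('k, 'm) ring_scheme \<Rightarrow> 'v set \<Rightarrow> ('v multiset \<Rightarrow> 'k) ring" where
  "poly_ring K V =
    \<lparr>carrier = ring.indexed_pset K V (carrier K),
     monoid.mult = (\<lambda>p q m. \<Oplus>\<^bsub>K\<^esub>m' \<in> {m'. m' \<subseteq># m}. p m' \<otimes>\<^bsub>K\<^esub> q (m - m')),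
     monoid.one = ring.indexed_const K \<one>\<^bsub>K\<^esub>,
     ring.zero = ring.indexed_const K \<zero>\<^bsub>K\<^esub>,
     ring.add = ring.indexed_padd K\<rparr>"

text \<open>
  The variable \<open>X\<^sub>s\<^sub>i\<close> is the one with index \<open>(s, i)\<close>. The structure constants are
  \<open>\<tau> i j s\<close> and \<open>\<omega> i j k s\<close> for the finite-dimensional algebra, \<open>\<alpha> i j u\<close> and \<open>\<beta> i j k u\<close>
  for the other one, the last index being the one of the expanded basis vector;
  \<open>B i j\<close> and \<open>C i j k\<close> are finite index sets outside which \<open>\<alpha> i j\<close> and \<open>\<beta> i j k\<close> are ignored.
\<close>

definition binary_relation_poly ::
  "('k, 'm) ring_scheme \<Rightarrow> nat \<Rightarrow> 'i set \<Rightarrow> (nat \<Rightarrow> nat \<Rightarrow> nat \<Rightarrow> 'k) \<Rightarrow>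
   ('i \<Rightarrow> 'i \<Rightarrow> 'i set) \<Rightarrow> ('i \<Rightarrow> 'i \<Rightarrow> 'i \<Rightarrow> 'k) \<Rightarrow> nat \<Rightarrow> 'i \<Rightarrow> 'i \<Rightarrow> (nat \<times> 'i) multiset \<Rightarrow> 'k" where
  "binary_relation_poly K n I \<tau> B \<alpha> a i j =
    (let P = poly_ring K ({1..n} \<times> I); \<xi> = (\<lambda>s i. ring.indexed_var K (s, i));
         const = ring.indexed_const K in
      (\<Oplus>\<^bsub>P\<^esub>u \<in> B i j. const (\<alpha> i j u) \<otimes>\<^bsub>P\<^esub> \<xi> a u) \<ominus>\<^bsub>P\<^esub>
      (\<Oplus>\<^bsub>P\<^esub>s \<in> {1..n}. \<Oplus>\<^bsub>P\<^esub>t \<in> {1..n}. const (\<tau> s t a) \<otimes>\<^bsub>P\<^esub> \<xi> s i \<otimes>\<^bsub>P\<^esub> \<xi> t j))"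

definition ternary_relation_poly ::
  "('k, 'm) ring_scheme \<Rightarrow> nat \<Rightarrow> 'i set \<Rightarrow> (nat \<Rightarrow> nat \<Rightarrow> nat \<Rightarrow> nat \<Rightarrow> 'k) \<Rightarrow>
   ('i \<Rightarrow> 'i \<Rightarrow> 'i \<Rightarrow> 'i set) \<Rightarrow> ('i \<Rightarrow> 'i \<Rightarrow> 'i \<Rightarrow> 'i \<Rightarrow> 'k) \<Rightarrow>
   nat \<Rightarrow> 'i \<Rightarrow> 'i \<Rightarrow> 'i \<Rightarrow> (nat \<times> 'i) multiset \<Rightarrow> 'k" where
  "ternary_relation_poly K n I \<omega> C \<beta> a i j k =
    (let P = poly_ring K ({1..n} \<times> I); \<xi> = (\<lambda>s i. ring.indexed_var K (s, i));
         const = ring.indexed_const K in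
      (\<Oplus>\<^bsub>P\<^esub>u \<in> C i j k. const (\<beta> i j k u) \<otimes>\<^bsub>P\<^esub> \<xi> a u) \<ominus>\<^bsub>P\<^esub>
      (\<Oplus>\<^bsub>P\<^esub>r \<in> {1..n}. \<Oplus>\<^bsub>P\<^esub>s \<in> {1..n}. \<Oplus>\<^bsub>P\<^esub>t \<in> {1..n}.
         const (\<omega> r s t a) \<otimes>\<^bsub>P\<^esub> \<xi> r i \<otimes>\<^bsub>P\<^esub> \<xi> s j \<otimes>\<^bsub>P\<^esub> \<xi> t k))"

definition universal_ideal ::
  "('k, 'm) ring_scheme \<Rightarrow> nat \<Rightarrow> 'i set \<Rightarrow>
   (nat \<Rightarrow> nat \<Rightarrow> nat \<Rightarrow> 'k) \<Rightarrow> (nat \<Rightarrow> nat \<Rightarrow> nat \<Rightarrow> nat \<Rightarrow> 'k) \<Rightarrow>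
   ('i \<Rightarrow> 'i \<Rightarrow> 'i set) \<Rightarrow> ('i \<Rightarrow> 'i \<Rightarrow> 'i \<Rightarrow> 'k) \<Rightarrow>
   ('i \<Rightarrow> 'i \<Rightarrow> 'i \<Rightarrow> 'i set) \<Rightarrow> ('i \<Rightarrow> 'i \<Rightarrow> 'i \<Rightarrow> 'i \<Rightarrow> 'k) \<Rightarrow>
   ((nat \<times> 'i) multiset \<Rightarrow> 'k) set" where
  "universal_ideal K n I \<tau> \<omega> B \<alpha> C \<beta> = Idl\<^bsub>poly_ring K ({1..n} \<times> I)\<^esub>
     ({binary_relation_poly K n I \<tau> B \<alpha> a i j | a i j. a \<in> {1..n} \<and> i \<in> I \<and> j \<in> I} \<union>
      {ternary_relation_poly K n I \<omega> C \<beta> a i j k | a i j k.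
         a \<in> {1..n} \<and> i \<in> I \<and> j \<in> I \<and> k \<in> I})"

definition universal_algebra ::
  "('k, 'm) ring_scheme \<Rightarrow> nat \<Rightarrow> 'i set \<Rightarrow>
   (nat \<Rightarrow> nat \<Rightarrow> nat \<Rightarrow> 'k) \<Rightarrow> (nat \<Rightarrow> nat \<Rightarrow> nat \<Rightarrow> nat \<Rightarrow> 'k) \<Rightarrow>
   ('i \<Rightarrow> 'i \<Rightarrow> 'i set) \<Rightarrow> ('i \<Rightarrow> 'i \<Rightarrow> 'i \<Rightarrow> 'k) \<Rightarrow>
   ('i \<Rightarrow> 'i \<Rightarrow> 'i \<Rightarrow> 'i set) \<Rightarrow> ('i \<Rightarrow> 'i \<Rightarrow> 'i \<Rightarrow> 'i \<Rightarrow> 'k) \<Rightarrow>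
   ((nat \<times> 'i) multiset \<Rightarrow> 'k) set ring" where
  "universal_algebra K n I \<tau> \<omega> B \<alpha> C \<beta> =
     poly_ring K ({1..n} \<times> I) Quot universal_ideal K n I \<tau> \<omega> B \<alpha> C \<beta>"

definition universal_gen ::
  "('k, 'm) ring_scheme \<Rightarrow> nat \<Rightarrow> 'i set \<Rightarrow>
   (nat \<Rightarrow> nat \<Rightarrow> nat \<Rightarrow> 'k) \<Rightarrow> (nat \<Rightarrow> nat \<Rightarrow> nat \<Rightarrow> nat \<Rightarrow> 'k) \<Rightarrow>
   ('i \<Rightarrow> 'i \<Rightarrow> 'i set) \<Rightarrow> ('i \<Rightarrow> 'i \<Rightarrow> 'i \<Rightarrow> 'k) \<Rightarrow>
   ('i \<Rightarrow> 'i \<Rightarrow> 'i \<Rightarrow> 'i set) \<Rightarrow> ('i \<Rightarrow> 'i \<Rightarrow> 'i \<Rightarrow> 'i \<Rightarrow> 'k) \<Rightarrow>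
   nat \<Rightarrow> 'i \<Rightarrow> ((nat \<times> 'i) multiset \<Rightarrow> 'k) set" where
  "universal_gen K n I \<tau> \<omega> B \<alpha> C \<beta> s i =
     universal_ideal K n I \<tau> \<omega> B \<alpha> C \<beta> +>\<^bsub>poly_ring K ({1..n} \<times> I)\<^esub> ring.indexed_var K (s, i)"

text \<open>The structure map from \<open>K\<close> that makes the quotient ring a unital \<open>K\<close>-algebra.\<close>

definition universal_scalar ::
  "('k, 'm) ring_scheme \<Rightarrow> nat \<Rightarrow> 'i set \<Rightarrow>
   (nat \<Rightarrow> nat \<Rightarrow> nat \<Rightarrow> 'k) \<Rightarrow> (nat \<Rightarrow> nat \<Rightarrow> nat \<Rightarrow> nat \<Rightarrow> 'k) \<Rightarrow>
   ('i \<Rightarrow> 'i \<Rightarrow> 'i set) \<Rightarrow> ('i \<Rightarrow> 'i \<Rightarrow> 'i \<Rightarrow> 'k) \<Rightarrow>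
   ('i \<Rightarrow> 'i \<Rightarrow> 'i \<Rightarrow> 'i set) \<Rightarrow> ('i \<Rightarrow> 'i \<Rightarrow> 'i \<Rightarrow> 'i \<Rightarrow> 'k) \<Rightarrow>
   'k \<Rightarrow> ((nat \<times> 'i) multiset \<Rightarrow> 'k) set" where
  "universal_scalar K n I \<tau> \<omega> B \<alpha> C \<beta> c =
     universal_ideal K n I \<tau> \<omega> B \<alpha> C \<beta> +>\<^bsub>poly_ring K ({1..n} \<times> I)\<^esub> ring.indexed_const K c"

end

theory Submission
  imports Defs
begin

text \<open>
  The generators of the universal algebra \<open>A\<close> define a linear map from \<open>G\<close> to \<open>L \<otimes> A\<close> that sends \<open>f i\<close> to
  \<open>\<Sum>\<^sub>s e s \<otimes> x s i\<close>. The defining relations of \<open>A\<close> say precisely that it respects the bracket and the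
  ternary operation, when those of \<open>L\<close> are extended \<open>A\<close>-multilinearly. On the other hand \<open>L \<otimes> A\<close> acts on
  \<open>U \<otimes> W\<close>: the action of \<open>L\<close> on the first factor is combined with the action of \<open>A\<close> on the second, and as
  \<open>A\<close> is commutative every identity of an \<open>L\<close>-module persists. Pulling this action back to \<open>G\<close> gives the
  maps of the theorem.

  In coordinates, let \<open>c s\<close> be the linear map from \<open>G\<close> to \<open>A\<close> with \<open>c s (f i) = x s i\<close>
  (\<open>coefficient_maps_exist\<close>). The operator of \<open>a\<close> is the sum over \<open>s\<close> of \<open>\<rho> (e s) \<otimes> c s a\<close>, and similarly for
  \<open>D\<close> and \<open>\<theta>\<close> with two indices. Evaluated at a pure tensor, every term of an identity is a sum over
  tuples of indices whose coefficients are products of the \<open>c s a\<close>. Composites are handled by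
  \<open>compose_reindex\<close>, and arguments that are brackets or triples by \<open>contract_bracket\<close> and
  \<open>contract_triple\<close>, which move the structure constants from the coefficients to the vectors. The
  terms then differ only in the vectors, and the identity for \<open>U\<close> at the basis vectors \<open>e s\<close> settles
  each summand.

  The formulas at basis vectors determine the operators at all elements of \<open>G\<close> by multilinearity
  (\<open>linear_represents_of_basis\<close>, \<open>bilinear_represents_of_basis\<close>), so every triple of maps that satisfies
  them is the one just described (\<open>ly_module_of_representing\<close>); that there is one follows from the
  universal property of the tensor product (\<open>representing_maps_exist\<close>).

  The explicit constructions require some groundwork: free modules, quotients and tensor products
  with their universal properties, linear extension from a basis, and the fact that the given
  convolution product makes the polynomials a commutative ring.
\<close>

section \<open>Linear maps\<close>

text \<open>
  The unqualified name \<open>module_hom\<close> may refer to the type-class notion of linear map, hence this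
  abbreviation for the linear maps between two module records.
\<close>

abbreviation "linear_maps \<equiv> LinearCombinations.module_hom"

lemma module_homI:
  assumes "\<And>v. v \<in> carrier M \<Longrightarrow> f v \<in> carrier N"
    and "\<And>v w. v \<in> carrier M \<Longrightarrow> w \<in> carrier M \<Longrightarrow> f (v \<oplus>\<^bsub>M\<^esub> w) = f v \<oplus>\<^bsub>N\<^esub> f w"
    and "\<And>c v. c \<in> carrier R \<Longrightarrow> v \<in> carrier M \<Longrightarrow> f (c \<odot>\<^bsub>M\<^esub> v) = c \<odot>\<^bsub>N\<^esub> f v"
  shows "f \<in> linear_maps R M N"
  using assms by (simp add: LinearCombinations.module_hom_def)

lemma module_hom_in_carrier:
  "f \<in> linear_maps R M N \<Longrightarrow> v \<in> carrier M \<Longrightarrow> f v \<in> carrier N"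
  by (auto simp: LinearCombinations.module_hom_def)

lemma module_hom_comp:
  "f \<in> linear_maps R M N \<Longrightarrow> g \<in> linear_maps R N P \<Longrightarrow>
    (\<lambda>v. g (f v)) \<in> linear_maps R M P"
  by (auto simp: LinearCombinations.module_hom_def Pi_iff)

lemma module_hom_zero:
  assumes "Module.module R N" shows "(\<lambda>v. \<zero>\<^bsub>N\<^esub>) \<in> linear_maps R M N"
proof -
  interpret N: Module.module R N by fact
  show ?thesis by (auto simp: LinearCombinations.module_hom_def)
qed

lemma module_hom_plus:
  assumes "Module.module R N" "f \<in> linear_maps R M N"
    "g \<in> linear_maps R M N"
  shows "(\<lambda>v. f v \<oplus>\<^bsub>N\<^esub> g v) \<in> linear_maps R M N"
proof -
  interpret N: Module.module R N by fact
  note [simp] = assms(2,3)[THEN module_hom_in_carrier] assms(2,3)[THEN LinearCombinations.module_hom_add]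
    assms(2,3)[THEN LinearCombinations.module_hom_smult]
  show ?thesis by (rule module_homI) (auto simp: N.smult_r_distr N.a_ac)
qed

lemma module_hom_smult_const:
  assumes "Module.module R N" "f \<in> linear_maps R M N" "c \<in> carrier R"
  shows "(\<lambda>v. c \<odot>\<^bsub>N\<^esub> f v) \<in> linear_maps R M N"
proof -
  interpret N: Module.module R N by fact
  note [simp] = assms(2)[THEN module_hom_in_carrier] assms(2)[THEN LinearCombinations.module_hom_add]
    assms(2)[THEN LinearCombinations.module_hom_smult] assms(3)
  show ?thesis
    by (rule module_homI) (auto simp: N.smult_r_distr N.smult_assoc1[symmetric] N.R.m_comm)
qed

lemma module_hom_diff:
  assumes "Module.module R N" "f \<in> linear_maps R M N"
    "g \<in> linear_maps R M N"
  shows "(\<lambda>v. f v \<ominus>\<^bsub>N\<^esub> g v) \<in> linear_maps R M N"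
proof -
  interpret N: Module.module R N by fact
  note [simp] = assms(2,3)[THEN module_hom_in_carrier] assms(2,3)[THEN LinearCombinations.module_hom_add]
    assms(2,3)[THEN LinearCombinations.module_hom_smult]
  show ?thesis 
    by (rule module_homI) (auto simp: N.smult_r_distr N.a_ac N.minus_eq N.minus_add N.smult_r_minus)
qed

lemma module_hom_finsum_fun:
  assumes N: "Module.module R N" and f: "\<And>q. q \<in> Q \<Longrightarrow> f q \<in> linear_maps R M N"
  shows "(\<lambda>v. \<Oplus>\<^bsub>N\<^esub>q\<in>Q. f q v) \<in> linear_maps R M N"
proof -
  interpret N: Module.module R N by fact
  note [simp] = f[THEN module_hom_in_carrier] f[THEN LinearCombinations.module_hom_add]
    f[THEN LinearCombinations.module_hom_smult]
  show ?thesis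
  proof (rule module_homI)
    fix v w assume [simp]: "v \<in> carrier M" "w \<in> carrier M"
    have "(\<Oplus>\<^bsub>N\<^esub>q\<in>Q. f q (v \<oplus>\<^bsub>M\<^esub> w)) = (\<Oplus>\<^bsub>N\<^esub>q\<in>Q. f q v \<oplus>\<^bsub>N\<^esub> f q w)"
      by (rule N.finsum_cong') auto
    then show "(\<Oplus>\<^bsub>N\<^esub>q\<in>Q. f q (v \<oplus>\<^bsub>M\<^esub> w)) = (\<Oplus>\<^bsub>N\<^esub>q\<in>Q. f q v) \<oplus>\<^bsub>N\<^esub> (\<Oplus>\<^bsub>N\<^esub>q\<in>Q. f q w)"
      by (simp add: N.finsum_addf Pi_iff)
  next
    fix c v assume [simp]: "c \<in> carrier R" "v \<in> carrier M"
    have "(\<Oplus>\<^bsub>N\<^esub>q\<in>Q. f q (c \<odot>\<^bsub>M\<^esub> v)) = (\<Oplus>\<^bsub>N\<^esub>q\<in>Q. c \<odot>\<^bsub>N\<^esub> f q v)"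
      by (rule N.finsum_cong') auto
    then show "(\<Oplus>\<^bsub>N\<^esub>q\<in>Q. f q (c \<odot>\<^bsub>M\<^esub> v)) = c \<odot>\<^bsub>N\<^esub> (\<Oplus>\<^bsub>N\<^esub>q\<in>Q. f q v)"
      by (simp add: N.finsum_smult Pi_iff)
  qed auto
qed

lemma module_hom_zero_eq:
  assumes "Module.module R M" "Module.module R N" "f \<in> linear_maps R M N"
  shows "f \<zero>\<^bsub>M\<^esub> = \<zero>\<^bsub>N\<^esub>"
proof -
  interpret mod_hom R M N f using assms by (simp add: mod_hom_def mod_hom_axioms_def)
  show ?thesis by simp
qed

lemma module_hom_minus_eq:
  assumes "Module.module R M" "Module.module R N" "f \<in> linear_maps R M N"
    "v \<in> carrier M" "w \<in> carrier M"
  shows "f (v \<ominus>\<^bsub>M\<^esub> w) = f v \<ominus>\<^bsub>N\<^esub> f w"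
proof -
  interpret mod_hom R M N f using assms by (simp add: mod_hom_def mod_hom_axioms_def)
  show ?thesis using assms by simp
qed

lemma module_hom_finsum_eq:
  assumes "Module.module R M" "Module.module R N" "f \<in> linear_maps R M N"
    and "g \<in> A \<rightarrow> carrier M"
  shows "f (\<Oplus>\<^bsub>M\<^esub>a\<in>A. g a) = (\<Oplus>\<^bsub>N\<^esub>a\<in>A. f (g a))"
proof -
  interpret M: Module.module R M by fact
  interpret N: Module.module R N by fact
  note f = assms(3)
  show ?thesis using assms(4)
  proof (induct A rule: infinite_finite_induct)
    case (insert a A)
    then have A: "g a \<in> carrier M" "(\<Oplus>\<^bsub>M\<^esub>a\<in>A. g a) \<in> carrier M" "(\<lambda>a. f (g a)) \<in> A \<rightarrow> carrier N"
      using module_hom_in_carrier[OF f] by (auto simp: Pi_iff)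
    then show ?case
      using insert module_hom_in_carrier[OF f] by (simp add: LinearCombinations.module_hom_add[OF f])
  qed (simp_all add: module_hom_zero_eq[OF assms(1-3)])
qed

section \<open>Free modules\<close>

lemma free_module_simps [simp]:
  "\<zero>\<^bsub>free_module K S\<^esub> = (\<lambda>s. \<zero>\<^bsub>K\<^esub>)"
  "\<phi> \<oplus>\<^bsub>free_module K S\<^esub> \<psi> = (\<lambda>s. \<phi> s \<oplus>\<^bsub>K\<^esub> \<psi> s)"
  "c \<odot>\<^bsub>free_module K S\<^esub> \<phi> = (\<lambda>s. c \<otimes>\<^bsub>K\<^esub> \<phi> s)"
  by (simp_all add: free_module_def)

lemma free_module_carrier:
  "\<phi> \<in> carrier (free_module K S) \<longleftrightarrow>
    (\<forall>s. \<phi> s \<in> carrier K) \<and> {s. \<phi> s \<noteq> \<zero>\<^bsub>K\<^esub>} \<subseteq> S \<and> finite {s. \<phi> s \<noteq> \<zero>\<^bsub>K\<^esub>}"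
  by (simp add: free_module_def)

lemma free_module_add_closed:
  assumes "cring K" "\<phi> \<in> carrier (free_module K S)" "\<psi> \<in> carrier (free_module K S)"
  shows "(\<lambda>s. \<phi> s \<oplus>\<^bsub>K\<^esub> \<psi> s) \<in> carrier (free_module K S)"
proof -
  interpret K: cring K by fact
  have *: "{s. \<phi> s \<oplus>\<^bsub>K\<^esub> \<psi> s \<noteq> \<zero>\<^bsub>K\<^esub>} \<subseteq> {s. \<phi> s \<noteq> \<zero>\<^bsub>K\<^esub>} \<union> {s. \<psi> s \<noteq> \<zero>\<^bsub>K\<^esub>}"
    using assms by (auto simp: free_module_carrier)
  from finite_subset[OF this] * show ?thesis 
    using assms(2,3) unfolding free_module_carrier by blast
qed

lemma free_module_smult_closed:
  assumes "cring K" "\<phi> \<in> carrier (free_module K S)" "c \<in> carrier K"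
  shows "(\<lambda>s. c \<otimes>\<^bsub>K\<^esub> \<phi> s) \<in> carrier (free_module K S)"
proof -
  interpret K: cring K by fact
  have *: "{s. c \<otimes>\<^bsub>K\<^esub> \<phi> s \<noteq> \<zero>\<^bsub>K\<^esub>} \<subseteq> {s. \<phi> s \<noteq> \<zero>\<^bsub>K\<^esub>}"
    using assms by (auto simp: free_module_carrier)
  from finite_subset[OF this] * show ?thesis 
    using assms(2,3) unfolding free_module_carrier by blast
qed

lemma free_module_module:
  assumes "cring K"
  shows "Module.module K (free_module K S)"
proof -
  interpret K: cring K by fact
  let ?F = "free_module K S"
  have neg: "\<exists>\<psi>\<in>carrier ?F. \<phi> \<oplus>\<^bsub>?F\<^esub> \<psi> = \<zero>\<^bsub>?F\<^esub>" if "\<phi> \<in> carrier ?F" for \<phi>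
  proof (rule bexI[where x = "\<lambda>s. (\<ominus>\<^bsub>K\<^esub> \<one>\<^bsub>K\<^esub>) \<otimes>\<^bsub>K\<^esub> \<phi> s"])
    show "\<phi> \<oplus>\<^bsub>?F\<^esub> (\<lambda>s. (\<ominus>\<^bsub>K\<^esub> \<one>\<^bsub>K\<^esub>) \<otimes>\<^bsub>K\<^esub> \<phi> s) = \<zero>\<^bsub>?F\<^esub>"
      using that by (auto simp: free_module_carrier K.l_minus K.r_neg)
  qed (simp add: free_module_smult_closed assms that)
  show ?thesis
  proof (rule module_criteria, goal_cases)
    case 2 show ?case by (simp add: free_module_carrier)
  qed (use assms neg in \<open>simp_all add: free_module_add_closed free_module_smult_closed,
      auto simp: free_module_carrier K.a_ac K.m_assoc K.l_distr K.r_distr\<close>)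
qed

lemma free_gen_carrier:
  assumes "cring K" "s \<in> S"
  shows "free_gen K s \<in> carrier (free_module K S)"
proof -
  interpret K: cring K by fact
  have "{t. free_gen K s t \<noteq> \<zero>\<^bsub>K\<^esub>} \<subseteq> {s}" by (auto simp: free_gen_def)
  from finite_subset[OF this] this show ?thesis using assms(2)
    by (auto simp: free_module_carrier free_gen_def)
qed

text \<open>
  Induction over the support: every element of the free module arises from zero by successively
  adding multiples of generators.
\<close>

lemma free_module_induct [consumes 2, case_names zero add]:
  assumes "cring K" and \<phi>: "\<phi> \<in> carrier (free_module K S)"
    and zero: "P \<zero>\<^bsub>free_module K S\<^esub>"
    and add: "\<And>\<phi> c s. \<lbrakk>\<phi> \<in> carrier (free_module K S); c \<in> carrier K; s \<in> S; P \<phi>\<rbrakk> \<Longrightarrow>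
      P (\<phi> \<oplus>\<^bsub>free_module K S\<^esub> (c \<odot>\<^bsub>free_module K S\<^esub> free_gen K s))"
  shows "P \<phi>"
proof -
  interpret K: cring K by fact
  let ?F = "free_module K S"
  have "\<forall>\<phi>\<in>carrier ?F. {s. \<phi> s \<noteq> \<zero>\<^bsub>K\<^esub>} \<subseteq> A \<longrightarrow> P \<phi>" if "finite A" "A \<subseteq> S" for A
    using that
  proof (induct A)
    case empty
    have "\<phi> = \<zero>\<^bsub>?F\<^esub>" if "{s. \<phi> s \<noteq> \<zero>\<^bsub>K\<^esub>} \<subseteq> {}" for \<phi> using that by auto
    then show ?case using zero by metis
  next
    case (insert a A)
    show ?case
    proof (intro ballI impI)
      fix \<phi> assume \<phi>: "\<phi> \<in> carrier ?F" "{s. \<phi> s \<noteq> \<zero>\<^bsub>K\<^esub>} \<subseteq> insert a A"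
      let ?\<psi> = "\<phi>(a := \<zero>\<^bsub>K\<^esub>)"
      have supp: "{s. ?\<psi> s \<noteq> \<zero>\<^bsub>K\<^esub>} \<subseteq> {s. \<phi> s \<noteq> \<zero>\<^bsub>K\<^esub>}" by auto
      from finite_subset[OF this] this have \<psi>: "?\<psi> \<in> carrier ?F" 
        using \<phi>(1) unfolding free_module_carrier by auto
      have "{s. ?\<psi> s \<noteq> \<zero>\<^bsub>K\<^esub>} \<subseteq> A" using \<phi>(2) by auto
      then have P: "P ?\<psi>" using insert \<psi> by blast
      have eq: "\<phi> = ?\<psi> \<oplus>\<^bsub>?F\<^esub> (\<phi> a \<odot>\<^bsub>?F\<^esub> free_gen K a)"
        using \<phi>(1) by (auto simp: free_gen_def free_module_carrier)
      have "P (?\<psi> \<oplus>\<^bsub>?F\<^esub> (\<phi> a \<odot>\<^bsub>?F\<^esub> free_gen K a))"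
        by (rule add) (use \<psi> P insert \<phi> in \<open>auto simp: free_module_carrier\<close>)
      then show "P \<phi>" using eq by metis
    qed
  qed
  from this[of "{s. \<phi> s \<noteq> \<zero>\<^bsub>K\<^esub>}"] \<phi> show ?thesis by (auto simp: free_module_carrier)
qed

text \<open>
  The linear extension to the free module of a map \<open>y\<close> given on the generators.
\<close>

definition free_lift ::
  "('k, 'm) ring_scheme \<Rightarrow> ('k, 'z, 'p) module_scheme \<Rightarrow> ('s \<Rightarrow> 'z) \<Rightarrow> ('s \<Rightarrow> 'k) \<Rightarrow> 'z" where
  "free_lift K Z y \<phi> = (\<Oplus>\<^bsub>Z\<^esub>s \<in> {s. \<phi> s \<noteq> \<zero>\<^bsub>K\<^esub>}. \<phi> s \<odot>\<^bsub>Z\<^esub> y s)"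

text \<open>
  The defining sum runs over the exact support, which varies under addition; it may be taken over
  any larger finite set instead.
\<close>

lemma free_lift_eq:
  assumes "Module.module K Z" "y \<in> S \<rightarrow> carrier Z" "\<phi> \<in> carrier (free_module K S)"
    and "finite A" "{s. \<phi> s \<noteq> \<zero>\<^bsub>K\<^esub>} \<subseteq> A" "A \<subseteq> S"
  shows "free_lift K Z y \<phi> = (\<Oplus>\<^bsub>Z\<^esub>s \<in> A. \<phi> s \<odot>\<^bsub>Z\<^esub> y s)"
proof -
  interpret Z: Module.module K Z by fact
  show ?thesis unfolding free_lift_def
    by (rule Z.add.finprod_mono_neutral_cong_left)
      (use assms in \<open>auto simp: free_module_carrier Pi_iff subset_iff\<close>)
qed

lemma free_lift_hom:
  assumes Z: "Module.module K Z" and y: "y \<in> S \<rightarrow> carrier Z"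
  shows "free_lift K Z y \<in> linear_maps K (free_module K S) Z"
proof -
  interpret Z: Module.module K Z by fact
  have K: "cring K" by (rule Z.R.is_cring)
  show ?thesis
  proof (rule module_homI)
    fix \<phi> assume \<phi>: "\<phi> \<in> carrier (free_module K S)"
    show "free_lift K Z y \<phi> \<in> carrier Z"
      unfolding free_lift_def by (rule Z.finsum_closed)
        (use y \<phi> in \<open>auto simp: free_module_carrier subset_iff\<close>)
  next
    fix \<phi> \<psi> assume *: "\<phi> \<in> carrier (free_module K S)" "\<psi> \<in> carrier (free_module K S)"
    let ?A = "{s. \<phi> s \<noteq> \<zero>\<^bsub>K\<^esub>} \<union> {s. \<psi> s \<noteq> \<zero>\<^bsub>K\<^esub>}"
    have A: "finite ?A" "?A \<subseteq> S" using * by (auto simp: free_module_carrier)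
    have c: "\<phi> s \<in> carrier K" "\<psi> s \<in> carrier K" for s using * by (auto simp: free_module_carrier)
    have yA: "y s \<in> carrier Z" if "s \<in> ?A" for s using that A(2) y by blast
    have "free_lift K Z y (\<phi> \<oplus>\<^bsub>free_module K S\<^esub> \<psi>) =
        (\<Oplus>\<^bsub>Z\<^esub>s \<in> ?A. (\<phi> \<oplus>\<^bsub>free_module K S\<^esub> \<psi>) s \<odot>\<^bsub>Z\<^esub> y s)"
      by (rule free_lift_eq[OF Z y _ A(1) _ A(2)])
        (use free_module_add_closed[OF K *] c in auto)
    also have "\<dots> = (\<Oplus>\<^bsub>Z\<^esub>s \<in> ?A. \<phi> s \<odot>\<^bsub>Z\<^esub> y s \<oplus>\<^bsub>Z\<^esub> \<psi> s \<odot>\<^bsub>Z\<^esub> y s)"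
      by (rule Z.finsum_cong') (use c yA in \<open>auto simp: Z.smult_l_distr\<close>)
    also have "\<dots> = (\<Oplus>\<^bsub>Z\<^esub>s \<in> ?A. \<phi> s \<odot>\<^bsub>Z\<^esub> y s) \<oplus>\<^bsub>Z\<^esub> (\<Oplus>\<^bsub>Z\<^esub>s \<in> ?A. \<psi> s \<odot>\<^bsub>Z\<^esub> y s)"
      by (rule Z.finsum_addf) (use c yA in auto)
    also have "(\<Oplus>\<^bsub>Z\<^esub>s \<in> ?A. \<phi> s \<odot>\<^bsub>Z\<^esub> y s) = free_lift K Z y \<phi>"
      by (rule free_lift_eq[OF Z y *(1) A(1) _ A(2), symmetric]) auto
    also have "(\<Oplus>\<^bsub>Z\<^esub>s \<in> ?A. \<psi> s \<odot>\<^bsub>Z\<^esub> y s) = free_lift K Z y \<psi>"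
      by (rule free_lift_eq[OF Z y *(2) A(1) _ A(2), symmetric]) auto
    finally show "free_lift K Z y (\<phi> \<oplus>\<^bsub>free_module K S\<^esub> \<psi>) = free_lift K Z y \<phi> \<oplus>\<^bsub>Z\<^esub> free_lift K Z y \<psi>" .
  next
    fix k \<phi> assume *: "k \<in> carrier K" "\<phi> \<in> carrier (free_module K S)"
    let ?A = "{s. \<phi> s \<noteq> \<zero>\<^bsub>K\<^esub>}"
    have A: "finite ?A" "?A \<subseteq> S" using * by (auto simp: free_module_carrier)
    have c: "\<phi> s \<in> carrier K" for s using * by (auto simp: free_module_carrier)
    have yA: "y s \<in> carrier Z" if "s \<in> ?A" for s using that A(2) y by blast
    have "free_lift K Z y (k \<odot>\<^bsub>free_module K S\<^esub> \<phi>) =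
        (\<Oplus>\<^bsub>Z\<^esub>s \<in> ?A. (k \<odot>\<^bsub>free_module K S\<^esub> \<phi>) s \<odot>\<^bsub>Z\<^esub> y s)"
      by (rule free_lift_eq[OF Z y _ A(1) _ A(2)])
        (use free_module_smult_closed[OF K *(2,1)] c * in auto)
    also have "\<dots> = (\<Oplus>\<^bsub>Z\<^esub>s \<in> ?A. k \<odot>\<^bsub>Z\<^esub> (\<phi> s \<odot>\<^bsub>Z\<^esub> y s))"
      by (rule Z.finsum_cong') (use c yA * in \<open>auto simp: Z.smult_assoc1\<close>)
    also have "\<dots> = k \<odot>\<^bsub>Z\<^esub> (\<Oplus>\<^bsub>Z\<^esub>s \<in> ?A. \<phi> s \<odot>\<^bsub>Z\<^esub> y s)"
      by (rule Z.finsum_smult[symmetric]) (use c yA * in auto)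
    finally show "free_lift K Z y (k \<odot>\<^bsub>free_module K S\<^esub> \<phi>) = k \<odot>\<^bsub>Z\<^esub> free_lift K Z y \<phi>"
      by (simp add: free_lift_def)
  qed
qed

lemma free_lift_gen:
  assumes Z: "Module.module K Z" and y: "y \<in> S \<rightarrow> carrier Z" and s: "s \<in> S"
  shows "free_lift K Z y (free_gen K s) = y s"
proof -
  interpret Z: Module.module K Z by fact
  have ys: "y s \<in> carrier Z" using y s by auto
  have "free_lift K Z y (free_gen K s) = (\<Oplus>\<^bsub>Z\<^esub>t \<in> {s}. free_gen K s t \<odot>\<^bsub>Z\<^esub> y t)"
    by (rule free_lift_eq[OF Z y free_gen_carrier[OF Z.R.is_cring s]])
      (use s in \<open>auto simp: free_gen_def\<close>)
  also have "\<dots> = y s" using ys by (simp add: free_gen_def Z.finsum_insert)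
  finally show ?thesis .
qed

lemma free_module_hom_eqI:
  assumes Z: "Module.module K Z" 
    and f: "f \<in> linear_maps K (free_module K S) Z"
    and g: "g \<in> linear_maps K (free_module K S) Z"
    and eq: "\<And>s. s \<in> S \<Longrightarrow> f (free_gen K s) = g (free_gen K s)"
    and \<phi>: "\<phi> \<in> carrier (free_module K S)"
  shows "f \<phi> = g \<phi>"
proof -
  interpret Z: Module.module K Z by fact
  have K: "cring K" by (rule Z.R.is_cring)
  interpret F: Module.module K "free_module K S" by (rule free_module_module[OF K])
  from K \<phi> show ?thesis
  proof (induct rule: free_module_induct)
    case zero
    show ?case using module_hom_zero_eq[OF F.module_axioms Z] f g by metis
  next
    case (add \<phi> c s)
    have gen: "free_gen K s \<in> carrier (free_module K S)" by (rule free_gen_carrier[OF K add(3)])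
    have cg: "c \<odot>\<^bsub>free_module K S\<^esub> free_gen K s \<in> carrier (free_module K S)"
      by (rule F.smult_closed[OF add(2) gen])
    show ?case
      unfolding LinearCombinations.module_hom_add[OF f add(1) cg] LinearCombinations.module_hom_add[OF g add(1) cg]
        LinearCombinations.module_hom_smult[OF f add(2) gen] LinearCombinations.module_hom_smult[OF g add(2) gen] add(4) eq[OF add(3)] ..
  qed
qed

section \<open>Quotient modules\<close>

lemma submodule_abelian_subgroup:
  assumes "submodule R N M"
  shows "abelian_subgroup N M"
proof -
  interpret submodule R N M by fact
  interpret M: Module.module R M by (rule module)
  have "subgroup N (add_monoid M)"
  proof (rule M.add.subgroupI)
    fix a assume a: "a \<in> N"
    have "\<ominus>\<^bsub>R\<^esub> \<one>\<^bsub>R\<^esub> \<odot>\<^bsub>M\<^esub> a \<in> N" using a by (intro smult_closed) auto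
    moreover have "a \<in> carrier M" using a subset by auto
    ultimately show "\<ominus>\<^bsub>M\<^esub> a \<in> N" by (simp only: M.smult_minus_1)
  next
    show "N \<noteq> {}" using zero_closed by blast
  qed (use subset in \<open>auto intro: m_closed\<close>)
  then show ?thesis
    by (intro abelian_subgroupI3 additive_subgroupI M.abelian_group_axioms)
qed

lemma quotient_module_simps [simp]:
  "\<zero>\<^bsub>quotient_module M N\<^esub> = N"
  "S \<oplus>\<^bsub>quotient_module M N\<^esub> S' = S <+>\<^bsub>M\<^esub> S'"
  by (simp_all add: quotient_module_def)

lemma quotient_module_carrier:
  "carrier (quotient_module M N) = (\<lambda>v. N +>\<^bsub>M\<^esub> v) ` carrier M"
  by (auto simp: quotient_module_def A_RCOSETS_def' a_r_coset_def')

lemma quotient_module_smult: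
  assumes "submodule R N M" "c \<in> carrier R" "v \<in> carrier M"
  shows "c \<odot>\<^bsub>quotient_module M N\<^esub> (N +>\<^bsub>M\<^esub> v) = N +>\<^bsub>M\<^esub> (c \<odot>\<^bsub>M\<^esub> v)"
proof -
  interpret submodule R N M by fact
  interpret M: Module.module R M by (rule module)
  interpret abelian_subgroup N M by (rule submodule_abelian_subgroup[OF assms(1)])
  have "N +>\<^bsub>M\<^esub> (c \<odot>\<^bsub>M\<^esub> w) = N +>\<^bsub>M\<^esub> (c \<odot>\<^bsub>M\<^esub> v)" if w: "w \<in> N +>\<^bsub>M\<^esub> v" for w
  proof -
    from w obtain h where h: "h \<in> N" "w = h \<oplus>\<^bsub>M\<^esub> v" by (auto simp: a_r_coset_def')
    have "c \<odot>\<^bsub>M\<^esub> w = c \<odot>\<^bsub>M\<^esub> h \<oplus>\<^bsub>M\<^esub> c \<odot>\<^bsub>M\<^esub> v"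
      using h assms by (simp add: M.smult_r_distr)
    then have "c \<odot>\<^bsub>M\<^esub> w \<in> N +>\<^bsub>M\<^esub> (c \<odot>\<^bsub>M\<^esub> v)"
      using h assms(2) by (auto simp: a_r_coset_def')
    then show ?thesis using a_repr_independence' assms by (metis M.smult_closed)
  qed
  moreover have "v \<in> N +>\<^bsub>M\<^esub> v" using assms by (simp add: a_rcos_self)
  ultimately have "(\<Union>w\<in>N +>\<^bsub>M\<^esub> v. N +>\<^bsub>M\<^esub> (c \<odot>\<^bsub>M\<^esub> w)) = N +>\<^bsub>M\<^esub> (c \<odot>\<^bsub>M\<^esub> v)"
    by (intro SUP_eq_const) blast+
  then show ?thesis unfolding quotient_module_def by simp
qed

lemma quotient_module_module:
  assumes N: "submodule R N M"
  shows "Module.module R (quotient_module M N)"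
proof -
  interpret submodule R N M by fact
  interpret M: Module.module R M by (rule module)
  interpret S: abelian_subgroup N M by (rule submodule_abelian_subgroup[OF assms(1)])
  have zero: "N +>\<^bsub>M\<^esub> \<zero>\<^bsub>M\<^esub> = N" by (simp add: subset)
  have neg: "\<exists>w\<in>carrier M. N +>\<^bsub>M\<^esub> (v \<oplus>\<^bsub>M\<^esub> w) = N" if "v \<in> carrier M" for v
    using that by (intro bexI[of _ "\<ominus>\<^bsub>M\<^esub> v"]) (auto simp: M.r_neg zero)
  have r0: "(N +>\<^bsub>M\<^esub> v) <+>\<^bsub>M\<^esub> N = N +>\<^bsub>M\<^esub> v" if "v \<in> carrier M" for v
    using S.a_rcos_sum[OF that, of "\<zero>\<^bsub>M\<^esub>"] that by (simp add: zero)
  note [simp] = quotient_module_smult[OF N] S.a_rcos_sum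
  show ?thesis
  proof (rule module_criteria, goal_cases)
    case 1 show ?case by (rule M.R.is_cring)
  next
    case 2 show ?case
      by (auto simp: quotient_module_carrier zero intro!: rev_image_eqI[of "\<zero>\<^bsub>M\<^esub>"])
  next
    case 4 show ?case using neg by (auto simp: quotient_module_carrier)
  next
    case 8 show ?case using r0 by (auto simp: quotient_module_carrier)
  next
    case 6 show ?case by (auto simp: quotient_module_carrier M.a_comm)
  next
    case 7 show ?case by (auto simp: quotient_module_carrier M.a_assoc)
  qed (auto simp: quotient_module_carrier M.smult_assoc1 M.smult_l_distr M.smult_r_distr)
qed

lemma quotient_hom:
  assumes "submodule R N M"
  shows "(\<lambda>v. N +>\<^bsub>M\<^esub> v) \<in> linear_maps R M (quotient_module M N)"
proof -
  interpret S: abelian_subgroup N M by (rule submodule_abelian_subgroup[OF assms(1)])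
  show ?thesis
    by (rule module_homI) (auto simp: quotient_module_carrier quotient_module_smult[OF assms] S.a_rcos_sum)
qed

text \<open>
  The universal property of the quotient, with a linear map that factors through it.
\<close>

lemma quotient_lift:
  assumes N: "submodule R N M" and Z: "Module.module R Z"
    and f: "f \<in> linear_maps R M Z" and f0: "\<And>v. v \<in> N \<Longrightarrow> f v = \<zero>\<^bsub>Z\<^esub>"
  obtains g where "g \<in> linear_maps R (quotient_module M N) Z"
    and "\<And>v. v \<in> carrier M \<Longrightarrow> g (N +>\<^bsub>M\<^esub> v) = f v"
proof
  interpret submodule R N M by fact
  interpret M: Module.module R M by (rule module)
  interpret Z: Module.module R Z by fact
  interpret S: abelian_subgroup N M by (rule submodule_abelian_subgroup[OF assms(1)])
  \<comment> \<open>A coset is sent to the value of \<open>f\<close> at an arbitrary representative.\<close>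
  let ?g = "\<lambda>S. f (SOME v. v \<in> S)"
  show g: "?g (N +>\<^bsub>M\<^esub> v) = f v" if v: "v \<in> carrier M" for v
  proof -
    have "(SOME w. w \<in> N +>\<^bsub>M\<^esub> v) \<in> N +>\<^bsub>M\<^esub> v" using S.a_rcos_self[OF v] by (rule someI)
    then obtain h where h: "h \<in> N" "(SOME w. w \<in> N +>\<^bsub>M\<^esub> v) = h \<oplus>\<^bsub>M\<^esub> v"
      by (auto simp: a_r_coset_def')
    then show ?thesis using v subset f0[of h] module_hom_in_carrier[OF f v]
      by (auto simp: LinearCombinations.module_hom_add[OF f])
  qed
  show "?g \<in> linear_maps R (quotient_module M N) Z"
  proof (rule module_homI)
    fix S assume "S \<in> carrier (quotient_module M N)"
    then show "?g S \<in> carrier Z" 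
      using g module_hom_in_carrier[OF f] by (auto simp: quotient_module_carrier)
  next
    fix S S' assume "S \<in> carrier (quotient_module M N)" "S' \<in> carrier (quotient_module M N)"
    then obtain v v' where v: "v \<in> carrier M" "v' \<in> carrier M" "S = N +>\<^bsub>M\<^esub> v" "S' = N +>\<^bsub>M\<^esub> v'"
      by (auto simp: quotient_module_carrier)
    then have "?g (S \<oplus>\<^bsub>quotient_module M N\<^esub> S') = f (v \<oplus>\<^bsub>M\<^esub> v')"
      using g[of "v \<oplus>\<^bsub>M\<^esub> v'"] by (simp add: S.a_rcos_sum)
    then show "?g (S \<oplus>\<^bsub>quotient_module M N\<^esub> S') = ?g S \<oplus>\<^bsub>Z\<^esub> ?g S'"
      using g v by (simp add: LinearCombinations.module_hom_add[OF f])
  next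
    fix c S assume c: "c \<in> carrier R" and "S \<in> carrier (quotient_module M N)"
    then obtain v where v: "v \<in> carrier M" "S = N +>\<^bsub>M\<^esub> v" by (auto simp: quotient_module_carrier)
    then have "?g (c \<odot>\<^bsub>quotient_module M N\<^esub> S) = f (c \<odot>\<^bsub>M\<^esub> v)"
      using g[of "c \<odot>\<^bsub>M\<^esub> v"] c by (simp add: quotient_module_smult[OF N])
    then show "?g (c \<odot>\<^bsub>quotient_module M N\<^esub> S) = c \<odot>\<^bsub>Z\<^esub> ?g S"
      using g v c by (simp add: LinearCombinations.module_hom_smult[OF f])
  qed
qed

section \<open>Tensor products\<close>

lemma bilinear_mapI:
  assumes "\<And>x. x \<in> carrier V1 \<Longrightarrow> f x \<in> linear_maps K V2 V"
    "\<And>y. y \<in> carrier V2 \<Longrightarrow> (\<lambda>x. f x y) \<in> linear_maps K V1 V"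
  shows "bilinear_map K V1 V2 V f"
  using assms by (simp add: bilinear_map_def)

lemma bilinear_mapD:
  assumes "bilinear_map K V1 V2 V f"
  shows "x \<in> carrier V1 \<Longrightarrow> f x \<in> linear_maps K V2 V"
    "y \<in> carrier V2 \<Longrightarrow> (\<lambda>x. f x y) \<in> linear_maps K V1 V"
  using assms by (simp_all add: bilinear_map_def)

text \<open>
  The tensor product \<open>T\<close> of two modules over \<open>K\<close>, a quotient of the free module \<open>F\<close> on pairs, with
  the pure tensors \<open>t u w\<close>.
\<close>

locale tensor =
  U: Module.module K U + W: Module.module K W
  for K :: "('k, 'm) ring_scheme" and U :: "('k, 'u, 'p) module_scheme"
    and W :: "('k, 'w, 'q) module_scheme"
begin

abbreviation "F \<equiv> free_module K (carrier U \<times> carrier W)"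
abbreviation "T \<equiv> tensor_product K U W"
abbreviation "t \<equiv> pure_tensor K U W"

sublocale F: Module.module K F by (rule free_module_module[OF U.R.is_cring])

lemma gen: "u \<in> carrier U \<Longrightarrow> w \<in> carrier W \<Longrightarrow> free_gen K (u, w) \<in> carrier F"
  by (rule free_gen_carrier[OF U.R.is_cring]) simp

abbreviation "\<delta> u w \<equiv> free_gen K (u, w)"

lemma tensor_relationsE:
  assumes "r \<in> tensor_relations K U W"
  obtains (add_left) u u' w where "u \<in> carrier U" "u' \<in> carrier U" "w \<in> carrier W"
      "r = \<delta> (u \<oplus>\<^bsub>U\<^esub> u') w \<ominus>\<^bsub>F\<^esub> (\<delta> u w \<oplus>\<^bsub>F\<^esub> \<delta> u' w)"
    | (add_right) u w w' where "u \<in> carrier U" "w \<in> carrier W" "w' \<in> carrier W"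
      "r = \<delta> u (w \<oplus>\<^bsub>W\<^esub> w') \<ominus>\<^bsub>F\<^esub> (\<delta> u w \<oplus>\<^bsub>F\<^esub> \<delta> u w')"
    | (smult_left) c u w where "c \<in> carrier K" "u \<in> carrier U" "w \<in> carrier W"
      "r = \<delta> (c \<odot>\<^bsub>U\<^esub> u) w \<ominus>\<^bsub>F\<^esub> c \<odot>\<^bsub>F\<^esub> \<delta> u w"
    | (smult_right) c u w where "c \<in> carrier K" "u \<in> carrier U" "w \<in> carrier W"
      "r = \<delta> u (c \<odot>\<^bsub>W\<^esub> w) \<ominus>\<^bsub>F\<^esub> c \<odot>\<^bsub>F\<^esub> \<delta> u w"
  using assms unfolding tensor_relations_def Let_def Un_iff mem_Collect_eq
  by (elim disjE exE conjE) (erule (3) that)+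

lemma tensor_relations_carrier: "tensor_relations K U W \<subseteq> carrier F"
proof
  fix r assume "r \<in> tensor_relations K U W"
  then show "r \<in> carrier F"
    by (cases rule: tensor_relationsE)
      (simp_all only: F.minus_closed F.a_closed F.smult_closed gen U.a_closed W.a_closed
        U.smult_closed W.smult_closed)
qed

lemma kernel_submodule: "submodule K (tensor_kernel K U W) F"
  unfolding tensor_kernel_def by (rule F.span_is_submodule[OF tensor_relations_carrier])

sublocale T: Module.module K T
  unfolding tensor_product_def by (rule quotient_module_module[OF kernel_submodule])

lemma proj_hom: "(\<lambda>\<phi>. tensor_kernel K U W +>\<^bsub>F\<^esub> \<phi>) \<in> linear_maps K F T"
  unfolding tensor_product_def by (rule quotient_hom[OF kernel_submodule])

lemma tensor_relation_eq:
  assumes "\<phi> \<ominus>\<^bsub>F\<^esub> \<psi> \<in> tensor_relations K U W" "\<phi> \<in> carrier F" "\<psi> \<in> carrier F"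
  shows "tensor_kernel K U W +>\<^bsub>F\<^esub> \<phi> = tensor_kernel K U W +>\<^bsub>F\<^esub> \<psi>"
proof -
  interpret S: abelian_subgroup "tensor_kernel K U W" F
    by (rule submodule_abelian_subgroup[OF kernel_submodule])
  have "\<phi> \<ominus>\<^bsub>F\<^esub> \<psi> \<in> tensor_kernel K U W"
    using F.in_own_span[OF tensor_relations_carrier] assms(1) by (auto simp: tensor_kernel_def)
  then show ?thesis
    using S.a_rcos_module_rev[OF assms(3,2)] S.a_repr_independence' assms(3)
    unfolding F.minus_eq by metis
qed

lemma pure_closed: "u \<in> carrier U \<Longrightarrow> w \<in> carrier W \<Longrightarrow> t u w \<in> carrier T"
  unfolding pure_tensor_def by (rule module_hom_in_carrier[OF proj_hom gen])

lemma pure_bilinear: "bilinear_map K U W T t"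
proof (rule bilinear_mapI; rule module_homI)
  fix u w w' assume *: "u \<in> carrier U" "w \<in> carrier W" "w' \<in> carrier W"
  have "\<delta> u (w \<oplus>\<^bsub>W\<^esub> w') \<ominus>\<^bsub>F\<^esub> (\<delta> u w \<oplus>\<^bsub>F\<^esub> \<delta> u w') \<in> tensor_relations K U W"
    using * unfolding tensor_relations_def Let_def by blast
  then have "tensor_kernel K U W +>\<^bsub>F\<^esub> \<delta> u (w \<oplus>\<^bsub>W\<^esub> w') = tensor_kernel K U W +>\<^bsub>F\<^esub> (\<delta> u w \<oplus>\<^bsub>F\<^esub> \<delta> u w')"
    by (rule tensor_relation_eq) (simp_all only: * F.a_closed F.smult_closed gen U.a_closed W.a_closed
        U.smult_closed W.smult_closed)
  then show "t u (w \<oplus>\<^bsub>W\<^esub> w') = t u w \<oplus>\<^bsub>T\<^esub> t u w'"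
    by (simp only: LinearCombinations.module_hom_add[OF proj_hom] gen * pure_tensor_def)
next
  fix u c w assume *: "u \<in> carrier U" "c \<in> carrier K" "w \<in> carrier W"
  have "\<delta> u (c \<odot>\<^bsub>W\<^esub> w) \<ominus>\<^bsub>F\<^esub> (c \<odot>\<^bsub>F\<^esub> \<delta> u w) \<in> tensor_relations K U W"
    using * unfolding tensor_relations_def Let_def by blast
  then have "tensor_kernel K U W +>\<^bsub>F\<^esub> \<delta> u (c \<odot>\<^bsub>W\<^esub> w) = tensor_kernel K U W +>\<^bsub>F\<^esub> (c \<odot>\<^bsub>F\<^esub> \<delta> u w)"
    by (rule tensor_relation_eq) (simp_all only: * F.a_closed F.smult_closed gen U.a_closed W.a_closed
        U.smult_closed W.smult_closed)
  then show "t u (c \<odot>\<^bsub>W\<^esub> w) = c \<odot>\<^bsub>T\<^esub> t u w"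
    by (simp only: LinearCombinations.module_hom_smult[OF proj_hom] gen * pure_tensor_def)
next
  fix w u u' assume *: "w \<in> carrier W" "u \<in> carrier U" "u' \<in> carrier U"
  have "\<delta> (u \<oplus>\<^bsub>U\<^esub> u') w \<ominus>\<^bsub>F\<^esub> (\<delta> u w \<oplus>\<^bsub>F\<^esub> \<delta> u' w) \<in> tensor_relations K U W"
    using * unfolding tensor_relations_def Let_def by blast
  then have "tensor_kernel K U W +>\<^bsub>F\<^esub> \<delta> (u \<oplus>\<^bsub>U\<^esub> u') w = tensor_kernel K U W +>\<^bsub>F\<^esub> (\<delta> u w \<oplus>\<^bsub>F\<^esub> \<delta> u' w)"
    by (rule tensor_relation_eq) (simp_all only: * F.a_closed F.smult_closed gen U.a_closed W.a_closed
        U.smult_closed W.smult_closed)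
  then show "t (u \<oplus>\<^bsub>U\<^esub> u') w = t u w \<oplus>\<^bsub>T\<^esub> t u' w"
    by (simp only: LinearCombinations.module_hom_add[OF proj_hom] gen * pure_tensor_def)
next
  fix w c u assume *: "w \<in> carrier W" "c \<in> carrier K" "u \<in> carrier U"
  have "\<delta> (c \<odot>\<^bsub>U\<^esub> u) w \<ominus>\<^bsub>F\<^esub> (c \<odot>\<^bsub>F\<^esub> \<delta> u w) \<in> tensor_relations K U W"
    using * unfolding tensor_relations_def Let_def by blast
  then have "tensor_kernel K U W +>\<^bsub>F\<^esub> \<delta> (c \<odot>\<^bsub>U\<^esub> u) w = tensor_kernel K U W +>\<^bsub>F\<^esub> (c \<odot>\<^bsub>F\<^esub> \<delta> u w)"
    by (rule tensor_relation_eq) (simp_all only: * F.a_closed F.smult_closed gen U.a_closed W.a_closed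
        U.smult_closed W.smult_closed)
  then show "t (c \<odot>\<^bsub>U\<^esub> u) w = c \<odot>\<^bsub>T\<^esub> t u w"
    by (simp only: LinearCombinations.module_hom_smult[OF proj_hom] gen * pure_tensor_def)
qed (rule pure_closed; assumption)+

text \<open>
  The pure tensors generate the tensor product, so a linear map is determined by its values there.
  Every identity between operators on the tensor product is reduced to pure tensors by this lemma.
\<close>

lemma tensor_hom_eqI:
  assumes Z: "Module.module K Z" 
    and f: "f \<in> linear_maps K T Z" and g: "g \<in> linear_maps K T Z"
    and eq: "\<And>u w. u \<in> carrier U \<Longrightarrow> w \<in> carrier W \<Longrightarrow> f (t u w) = g (t u w)"
    and v: "v \<in> carrier T"
  shows "f v = g v"
proof -
  obtain \<phi> where \<phi>: "\<phi> \<in> carrier F" "v = tensor_kernel K U W +>\<^bsub>F\<^esub> \<phi>"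
    using v by (auto simp: tensor_product_def quotient_module_carrier)
  have "f (tensor_kernel K U W +>\<^bsub>F\<^esub> \<phi>) = g (tensor_kernel K U W +>\<^bsub>F\<^esub> \<phi>)"
    by (rule free_module_hom_eqI[OF Z module_hom_comp[OF proj_hom f] module_hom_comp[OF proj_hom g] _ \<phi>(1)])
      (use eq in \<open>auto simp: pure_tensor_def\<close>)
  then show ?thesis using \<phi>(2) by simp
qed

text \<open>
  The universal property of the tensor product.
\<close>

lemma tensor_lift:
  assumes Z: "Module.module K Z" and b: "bilinear_map K U W Z b"
  obtains g where "g \<in> linear_maps K T Z"
    and "\<And>u w. u \<in> carrier U \<Longrightarrow> w \<in> carrier W \<Longrightarrow> g (t u w) = b u w"
proof -
  interpret Z: Module.module K Z by fact
  let ?f = "free_lift K Z (\<lambda>(u, w). b u w)"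
  note b1 = bilinear_mapD(1)[OF b] and b2 = bilinear_mapD(2)[OF b]
  have bc: "b u w \<in> carrier Z" if "u \<in> carrier U" "w \<in> carrier W" for u w
    using module_hom_in_carrier[OF b1] that .
  have y: "(\<lambda>(u, w). b u w) \<in> carrier U \<times> carrier W \<rightarrow> carrier Z"
    using bc by auto
  have f: "?f \<in> linear_maps K F Z" by (rule free_lift_hom[OF Z y])
  have fg: "?f (free_gen K (u, w)) = b u w" if "u \<in> carrier U" "w \<in> carrier W" for u w
    using free_lift_gen[OF Z y] that by simp
  interpret mh: mod_hom K F Z ?f
    using f Z F.module_axioms by (simp add: mod_hom_def mod_hom_axioms_def)
  have rel: "tensor_relations K U W \<subseteq> mh.ker"
  proof
    fix r assume r: "r \<in> tensor_relations K U W"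
    then have "?f r = \<zero>\<^bsub>Z\<^esub>"
      by (cases rule: tensor_relationsE)
        (simp_all only: mh.f_minus mh.f_add mh.f_smult F.a_closed F.smult_closed gen U.a_closed W.a_closed
          U.smult_closed W.smult_closed fg bc LinearCombinations.module_hom_add[OF b1]
          LinearCombinations.module_hom_smult[OF b1] LinearCombinations.module_hom_add[OF b2]
          LinearCombinations.module_hom_smult[OF b2] Z.minus_eq Z.r_neg Z.a_closed Z.smult_closed)
    then show "r \<in> mh.ker" using r tensor_relations_carrier by (auto simp: mh.ker_def)
  qed
  have "tensor_kernel K U W \<subseteq> mh.ker"
    unfolding tensor_kernel_def by (rule F.span_is_subset[OF rel mh.ker_is_submodule])
  then have f0: "?f v = \<zero>\<^bsub>Z\<^esub>" if "v \<in> tensor_kernel K U W" for v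
    using that by (auto simp: mh.ker_def)
  obtain g where "g \<in> linear_maps K (quotient_module F (tensor_kernel K U W)) Z"
    "\<And>v. v \<in> carrier F \<Longrightarrow> g (tensor_kernel K U W +>\<^bsub>F\<^esub> v) = ?f v"
    using quotient_lift[OF kernel_submodule Z f f0] by metis
  then show thesis 
    by (intro that[of g]) (auto simp: tensor_product_def pure_tensor_def gen fg)
qed

end

section \<open>Bases\<close>

lemma indexed_basisE:
  assumes "vectorspace K V" "indexed_basis K V I b"
  shows "inj_on b I" "b \<in> I \<rightarrow> carrier V" "\<not> LinearCombinations.module.lin_dep K V (b ` I)"
    "LinearCombinations.module.span K V (b ` I) = carrier V"
proof -
  interpret vectorspace K V by fact
  show "inj_on b I" "b \<in> I \<rightarrow> carrier V" "\<not> LinearCombinations.module.lin_dep K V (b ` I)"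
    "LinearCombinations.module.span K V (b ` I) = carrier V"
    using assms(2) by (auto simp: indexed_basis_def basis_def)
qed

text \<open>
  An indexed basis identifies the space with the free module on the index set; the two halves of
  the definition of a basis give surjectivity and injectivity.
\<close>

lemma free_lift_basis_bij:
  assumes V: "vectorspace K V" and b: "indexed_basis K V I b"
  shows "bij_betw (free_lift K V b) (carrier (free_module K I)) (carrier V)"
proof -
  interpret V: vectorspace K V by fact
  note b = indexed_basisE[OF V b]
  have M: "Module.module K V" by (rule V.module_axioms)
  have K: "cring K" by (rule V.R.is_cring)
  interpret F: Module.module K "free_module K I" by (rule free_module_module[OF K])
  have hom: "free_lift K V b \<in> linear_maps K (free_module K I) V" by (rule free_lift_hom[OF M b(2)])
  interpret mh: mod_hom K "free_module K I" V "free_lift K V b"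
    using hom M F.module_axioms by (simp add: mod_hom_def mod_hom_axioms_def)
  have "b ` I \<subseteq> mh.im"
  proof
    fix x assume "x \<in> b ` I"
    then obtain i where i: "i \<in> I" "x = b i" by auto
    then have "x = free_lift K V b (free_gen K i)" using free_lift_gen[OF M b(2)] by simp
    then show "x \<in> mh.im" unfolding mh.im_def using free_gen_carrier[OF K i(1)] by blast
  qed
  then have "carrier V \<subseteq> mh.im" using V.span_is_subset[OF _ mh.im_is_submodule] b(4) by metis
  then have surj: "free_lift K V b ` carrier (free_module K I) = carrier V"
    using module_hom_in_carrier[OF hom] unfolding mh.im_def by blast
  have ker: "\<phi> = \<zero>\<^bsub>free_module K I\<^esub>"
    if \<phi>: "\<phi> \<in> carrier (free_module K I)" and 0: "free_lift K V b \<phi> = \<zero>\<^bsub>V\<^esub>" for \<phi>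
  proof (rule ccontr)
    assume "\<phi> \<noteq> \<zero>\<^bsub>free_module K I\<^esub>"
    then obtain i where i: "\<phi> i \<noteq> \<zero>\<^bsub>K\<^esub>" by auto
    let ?A = "{s. \<phi> s \<noteq> \<zero>\<^bsub>K\<^esub>}"
    \<comment> \<open>The coefficients of a linear combination are indexed by the vectors themselves, not by \<open>I\<close>.\<close>
    let ?a = "\<lambda>v. \<phi> (the_inv_into I b v)"
    have A: "finite ?A" "?A \<subseteq> I" "\<And>s. \<phi> s \<in> carrier K" using \<phi> by (auto simp: free_module_carrier)
    have inj: "inj_on b ?A" using b(1) A(2) by (rule inj_on_subset)
    have a: "?a (b s) = \<phi> s" if "s \<in> ?A" for s
      using the_inv_into_f_f[OF b(1)] that A(2) by auto
    have "V.lincomb ?a (b ` ?A) = (\<Oplus>\<^bsub>V\<^esub>s\<in>?A. ?a (b s) \<odot>\<^bsub>V\<^esub> b s)"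
      unfolding V.lincomb_def by (rule V.finsum_reindex[OF _ inj]) (use A b(2) in auto)
    also have "\<dots> = free_lift K V b \<phi>"
      unfolding free_lift_def by (rule V.finsum_cong') (use A b(2) a in auto)
    finally have "V.lincomb ?a (b ` ?A) = \<zero>\<^bsub>V\<^esub>" using 0 by simp
    then have "V.lin_dep (b ` I)"
      by (intro V.lin_dep_crit[where A = "b ` ?A" and a = ?a and v = "b i"]) (use A i a in auto)
    then show False using b(3) by simp
  qed
  have "inj_on (free_lift K V b) (carrier (free_module K I))"
  proof (rule inj_onI)
    fix \<phi> \<psi> assume *: "\<phi> \<in> carrier (free_module K I)" "\<psi> \<in> carrier (free_module K I)"
      "free_lift K V b \<phi> = free_lift K V b \<psi>"
    have "\<phi> \<ominus>\<^bsub>free_module K I\<^esub> \<psi> = \<zero>\<^bsub>free_module K I\<^esub>"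
      by (rule ker) (use * in \<open>auto simp: module_hom_minus_eq[OF F.module_axioms M hom] 
        module_hom_in_carrier[OF hom] V.minus_eq V.r_neg simp del: free_module_simps\<close>)
    moreover have "\<phi> = (\<phi> \<ominus>\<^bsub>free_module K I\<^esub> \<psi>) \<oplus>\<^bsub>free_module K I\<^esub> \<psi>"
      using *(1,2) by (simp add: F.minus_eq F.a_assoc F.l_neg F.r_zero del: free_module_simps)
    ultimately show "\<phi> = \<psi>" using F.l_zero[OF *(2)] by metis
  qed
  then show ?thesis using surj by (simp add: bij_betw_def)
qed

text \<open>
  A linear map may be prescribed arbitrarily on a basis.
\<close>

lemma basis_hom_exists:
  assumes V: "vectorspace K V" and b: "indexed_basis K V I b"
    and Z: "Module.module K Z" and y: "y \<in> I \<rightarrow> carrier Z"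
  obtains g where "g \<in> linear_maps K V Z" "\<And>i. i \<in> I \<Longrightarrow> g (b i) = y i"
proof -
  interpret V: vectorspace K V by fact
  interpret Z: Module.module K Z by fact
  let ?F = "free_module K I" and ?l = "free_lift K V b"
  interpret F: Module.module K ?F by (rule free_module_module[OF V.R.is_cring])
  have M: "Module.module K V" by (rule V.module_axioms)
  have bc: "b \<in> I \<rightarrow> carrier V" by (rule indexed_basisE(2)[OF V b])
  have l: "?l \<in> linear_maps K ?F V" by (rule free_lift_hom[OF M bc])
  have bij: "bij_betw ?l (carrier ?F) (carrier V)" by (rule free_lift_basis_bij[OF V b])
  let ?r = "the_inv_into (carrier ?F) ?l"
  have inj: "inj_on ?l (carrier ?F)" using bij by (simp add: bij_betw_def)
  have rc: "?r v \<in> carrier ?F" if "v \<in> carrier V" for v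
    using bij that bij_betwE bij_betw_the_inv_into by blast
  have lr: "?l (?r v) = v" if "v \<in> carrier V" for v
    using bij that by (simp add: f_the_inv_into_f bij_betw_def)
  have rl: "?r (?l \<phi>) = \<phi>" if "\<phi> \<in> carrier ?F" for \<phi> using inj that by (rule the_inv_into_f_f)
  have r: "?r \<in> linear_maps K V ?F"
  proof (rule module_homI)
    fix v w assume *: "v \<in> carrier V" "w \<in> carrier V"
    have "?r v \<oplus>\<^bsub>?F\<^esub> ?r w = ?r (?l (?r v \<oplus>\<^bsub>?F\<^esub> ?r w))"
      by (rule rl[symmetric]) (rule F.a_closed[OF rc rc, OF *])
    then show "?r (v \<oplus>\<^bsub>V\<^esub> w) = ?r v \<oplus>\<^bsub>?F\<^esub> ?r w"
      unfolding LinearCombinations.module_hom_add[OF l rc rc, OF *] lr[OF *(1)] lr[OF *(2)] ..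
  next
    fix c v assume *: "c \<in> carrier K" "v \<in> carrier V"
    have "c \<odot>\<^bsub>?F\<^esub> ?r v = ?r (?l (c \<odot>\<^bsub>?F\<^esub> ?r v))"
      by (rule rl[symmetric]) (rule F.smult_closed[OF *(1) rc[OF *(2)]])
    then show "?r (c \<odot>\<^bsub>V\<^esub> v) = c \<odot>\<^bsub>?F\<^esub> ?r v"
      unfolding LinearCombinations.module_hom_smult[OF l *(1) rc[OF *(2)]] lr[OF *(2)] ..
  qed (rule rc)
  show thesis
  proof (rule that[of "\<lambda>v. free_lift K Z y (?r v)"])
    show "(\<lambda>v. free_lift K Z y (?r v)) \<in> linear_maps K V Z"
      by (rule module_hom_comp[OF r free_lift_hom[OF Z y]])
  next
    fix i assume i: "i \<in> I"
    have "?r (b i) = free_gen K i"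
      using rl[OF free_gen_carrier[OF V.R.is_cring i]] free_lift_gen[OF M bc i] by simp
    then show "free_lift K Z y (?r (b i)) = y i" using free_lift_gen[OF Z y i] by simp
  qed
qed

lemma basis_hom_eqI:
  assumes V: "vectorspace K V" and b: "indexed_basis K V I b"
    and Z: "Module.module K Z"
    and f: "f \<in> linear_maps K V Z" and g: "g \<in> linear_maps K V Z"
    and eq: "\<And>i. i \<in> I \<Longrightarrow> f (b i) = g (b i)" and v: "v \<in> carrier V"
  shows "f v = g v"
proof -
  interpret V: vectorspace K V by fact
  let ?F = "free_module K I" and ?l = "free_lift K V b"
  have bc: "b \<in> I \<rightarrow> carrier V" by (rule indexed_basisE(2)[OF V b])
  have l: "?l \<in> linear_maps K ?F V" by (rule free_lift_hom[OF V.module_axioms bc])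
  obtain \<phi> where \<phi>: "\<phi> \<in> carrier ?F" "v = ?l \<phi>"
    using free_lift_basis_bij[OF V b] v by (auto simp: bij_betw_def)
  have "f (?l \<phi>) = g (?l \<phi>)"
    by (rule free_module_hom_eqI[OF Z module_hom_comp[OF l f] module_hom_comp[OF l g] _ \<phi>(1)])
      (simp add: free_lift_gen[OF V.module_axioms bc] eq)
  then show ?thesis using \<phi>(2) by simp
qed

section \<open>The polynomial ring\<close>

lemma finite_subset_mset: "finite {m'. m' \<subseteq># m}"
proof (rule finite_subset)
  show "{m'. m' \<subseteq># m} \<subseteq> mset ` {xs. set xs \<subseteq> set_mset m \<and> length xs \<le> size m}"
  proof
    fix m' assume "m' \<in> {m'. m' \<subseteq># m}"
    moreover obtain xs where "mset xs = m'" using ex_mset by blast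
    ultimately show "m' \<in> mset ` {xs. set xs \<subseteq> set_mset m \<and> length xs \<le> size m}"
      using set_mset_mono size_mset_mono by (intro rev_image_eqI[of xs]) (auto, fastforce+)
  qed
  show "finite (mset ` {xs. set xs \<subseteq> set_mset m \<and> length xs \<le> size m})"
    by (intro finite_imageI finite_lists_length_le) simp
qed

context cring begin

text \<open>
  The product of polynomials, which are coefficient functions on multisets of variables. Its ring
  laws are proved along the inductive construction of polynomials from constants by addition and
  by multiplication with a variable; the next lemmas say how the product behaves under each step.
\<close>

definition poly_conv :: "('c multiset \<Rightarrow> 'a) \<Rightarrow> ('c multiset \<Rightarrow> 'a) \<Rightarrow> 'c multiset \<Rightarrow> 'a" (infixl \<open>\<star>\<close> 70)
  where "p \<star> q = (\<lambda>m. \<Oplus>m' \<in> {m'. m' \<subseteq># m}. p m' \<otimes> q (m - m'))"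

lemma poly_conv_apply: "(p \<star> q) m = (\<Oplus>m' \<in> {m'. m' \<subseteq># m}. p m' \<otimes> q (m - m'))"
  by (simp add: poly_conv_def)

lemma carrier_coeff_mult:
  "carrier_coeff p \<Longrightarrow> carrier_coeff q \<Longrightarrow> carrier_coeff (p \<star> q)"
  unfolding carrier_coeff_def poly_conv_def by (auto intro!: finsum_closed)

lemma poly_mult_comm:
  fixes p q :: "'v multiset \<Rightarrow> 'a"
  assumes "carrier_coeff p" "carrier_coeff q"
  shows "p \<star> q = q \<star> p"
proof
  fix m :: "'v multiset"
  note [simp] = assms[THEN carrier_coeffE]
  let ?S = "{m'. m' \<subseteq># m}"
  have inj: "inj_on (\<lambda>m'. m - m') ?S"
    by (rule inj_on_inverseI[of _ "\<lambda>m'. m - m'"]) (auto simp: subset_mset.add_diff_inverse multiset_eq_iff mset_subset_eq_count subseteq_mset_def)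
  have img: "(\<lambda>m'. m - m') ` ?S = ?S"
  proof
    show "?S \<subseteq> (\<lambda>m'. m - m') ` ?S"
    proof
      fix x assume x: "x \<in> ?S"
      then have "x = m - (m - x)" by (auto simp: multiset_eq_iff subseteq_mset_def)
      then show "x \<in> (\<lambda>m'. m - m') ` ?S" by (rule image_eqI) auto
    qed
  qed auto
  have "(p \<star> q) m = (\<Oplus>m' \<in> (\<lambda>m'. m - m') ` ?S. p m' \<otimes> q (m - m'))" unfolding img poly_conv_apply ..
  also have "\<dots> = (\<Oplus>m' \<in> ?S. p (m - m') \<otimes> q (m - (m - m')))"
    by (rule finsum_reindex[OF _ inj]) auto
  also have "\<dots> = (\<Oplus>m' \<in> ?S. q m' \<otimes> p (m - m'))"
  proof (rule finsum_cong')
    fix m' assume "m' \<in> ?S"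
    then have "m - (m - m') = m'" by (auto simp: multiset_eq_iff subseteq_mset_def)
    then show "p (m - m') \<otimes> q (m - (m - m')) = q m' \<otimes> p (m - m')"
      by (simp add: m_comm)
  qed auto
  finally show "(p \<star> q) m = (q \<star> p) m" unfolding poly_conv_apply .
qed

lemma poly_mult_add:
  fixes p q r :: "'v multiset \<Rightarrow> 'a"
  assumes "carrier_coeff p" "carrier_coeff q" "carrier_coeff r"
  shows "p \<star> indexed_padd q r = indexed_padd (p \<star> q) (p \<star> r)"
proof
  fix m :: "'v multiset"
  note [simp] = assms[THEN carrier_coeffE]
  have "(p \<star> indexed_padd q r) m = (\<Oplus>m'\<in>{m'. m' \<subseteq># m}. p m' \<otimes> q (m - m') \<oplus> p m' \<otimes> r (m - m'))"
    unfolding poly_conv_apply by (rule finsum_cong') (auto simp: indexed_padd_def r_distr)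
  also have "\<dots> = indexed_padd (p \<star> q) (p \<star> r) m" unfolding indexed_padd_def poly_conv_apply
    by (rule finsum_addf) auto
  finally show "(p \<star> indexed_padd q r) m = indexed_padd (p \<star> q) (p \<star> r) m" .
qed

lemma poly_mult_const:
  fixes p :: "'v multiset \<Rightarrow> 'a"
  assumes "carrier_coeff p" "k \<in> carrier R"
  shows "p \<star> indexed_const k = (\<lambda>m. p m \<otimes> k)"
proof
  fix m :: "'v multiset"
  note [simp] = assms(1)[THEN carrier_coeffE] assms(2)
  have "(p \<star> indexed_const k) m = (\<Oplus>m'\<in>{m}. p m' \<otimes> k)"
    unfolding poly_conv_apply by (rule add.finprod_mono_neutral_cong_right[OF finite_subset_mset])
      (auto simp: indexed_const_def Diff_eq_empty_iff_mset dest!: subset_mset.antisym)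
  then show "(p \<star> indexed_const k) m = p m \<otimes> k"
    by (simp add: finsum_insert)
qed

lemma poly_mult_pmult:
  fixes p q :: "'v multiset \<Rightarrow> 'a"
  assumes "carrier_coeff p" "carrier_coeff q"
  shows "p \<star> indexed_pmult q i = indexed_pmult (p \<star> q) i"
proof
  fix m :: "'v multiset"
  note [simp] = assms[THEN carrier_coeffE]
  show "(p \<star> indexed_pmult q i) m = indexed_pmult (p \<star> q) i m"
  proof (cases "i \<in># m")
    case False
    then have "i \<notin># m - m'" for m' using in_diffD by metis
    with False show ?thesis
      by (simp add: indexed_pmult_def poly_conv_apply)
  next
    case True
    have eq: "i \<in># m - m' \<longleftrightarrow> m' \<subseteq># m - {#i#}" if "m' \<subseteq># m" for m'
    proof
      assume "i \<in># m - m'"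
      then show "m' \<subseteq># m - {#i#}" using that
        by (auto simp: subseteq_mset_def in_diff_count)
    next
      assume *: "m' \<subseteq># m - {#i#}"
      have "count m' i \<le> count (m - {#i#}) i" using * by (rule mset_subset_eq_count)
      also have "\<dots> < count m i" using True count_greater_zero_iff[of m i]
        by (simp del: count_greater_zero_iff)
      finally show "i \<in># m - m'" by (simp add: in_diff_count)
    qed
    have "(p \<star> indexed_pmult q i) m = (\<Oplus>m'\<in>{m'. m' \<subseteq># m - {#i#}}. p m' \<otimes> q (m - {#i#} - m'))"
      unfolding poly_conv_apply
    proof (rule add.finprod_mono_neutral_cong_right[OF finite_subset_mset])
      show "{m'. m' \<subseteq># m - {#i#}} \<subseteq> {m'. m' \<subseteq># m}"
        using diff_subset_eq_self subset_mset.trans by blast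
    next
      fix m' assume "m' \<in> {m'. m' \<subseteq># m} - {m'. m' \<subseteq># m - {#i#}}"
      then show "p m' \<otimes> indexed_pmult q i (m - m') = \<zero>" 
        using eq by (auto simp: indexed_pmult_def)
    next
      fix m' assume m': "m' \<in> {m'. m' \<subseteq># m - {#i#}}"
      then have "m' \<subseteq># m" using diff_subset_eq_self subset_mset.trans by blast
      with m' have "i \<in># m - m'" using eq by blast
      then show "p m' \<otimes> indexed_pmult q i (m - m') = p m' \<otimes> q (m - {#i#} - m')"
        by (simp add: indexed_pmult_def diff_right_commute[of m m'])
    qed (use indexed_pmult_in_carrier[OF assms(2), THEN carrier_coeffE] in auto)
    then show ?thesis using True by (simp add: indexed_pmult_def poly_conv_apply)
  qed
qed

context
  fixes V :: "'v set"
begin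

abbreviation "PS \<equiv> indexed_pset V (carrier R)"

lemmas pset_intros = indexed_pset.intros[where I = V and K = "carrier R"]

lemma pset_coeff: "p \<in> PS \<Longrightarrow> carrier_coeff p"
  using indexed_pset_in_carrier[of "carrier R"] by blast

lemma pset_smult:
  assumes "p \<in> PS" "k \<in> carrier R" shows "(\<lambda>m. p m \<otimes> k) \<in> PS"
  using assms(1)
proof induct
  case (indexed_const a)
  have eq: "(\<lambda>m. indexed_const a m \<otimes> k) = indexed_const (a \<otimes> k)"
    using assms(2) by (auto simp: indexed_const_def)
  show ?case unfolding eq by (rule pset_intros(1)) (simp add: indexed_const assms(2))
next
  case (indexed_padd P Q)
  have eq: "(\<lambda>m. indexed_padd P Q m \<otimes> k) = indexed_padd (\<lambda>m. P m \<otimes> k) (\<lambda>m. Q m \<otimes> k)"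
    using assms(2) indexed_padd(1,3)[THEN pset_coeff, THEN carrier_coeffE]
    by (auto simp: indexed_padd_def l_distr)
  show ?case unfolding eq by (rule pset_intros(2)[OF indexed_padd(2,4)])
next
  case (indexed_pmult P i)
  have eq: "(\<lambda>m. indexed_pmult P i m \<otimes> k) = indexed_pmult (\<lambda>m. P m \<otimes> k) i"
    using assms(2) by (auto simp: indexed_pmult_def)
  show ?case unfolding eq by (rule pset_intros(3)[OF indexed_pmult(2,3)])
qed

lemma pset_mult:
  assumes p: "p \<in> PS" and "q \<in> PS" shows "p \<star> q \<in> PS"
  using assms(2)
proof induct
  case (indexed_const a)
  show ?case unfolding poly_mult_const[OF pset_coeff[OF p] indexed_const]
    by (rule pset_smult[OF p indexed_const])
next
  case (indexed_padd P Q)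
  show ?case
    unfolding poly_mult_add[OF pset_coeff[OF p] pset_coeff[OF indexed_padd(1)] pset_coeff[OF indexed_padd(3)]]
    by (rule pset_intros(2)[OF indexed_padd(2,4)])
next
  case (indexed_pmult P i)
  show ?case
    unfolding poly_mult_pmult[OF pset_coeff[OF p] pset_coeff[OF indexed_pmult(1)]]
    by (rule pset_intros(3)[OF indexed_pmult(2,3)])
qed

text \<open>
  Associativity, by induction on the construction of the last factor. This avoids rearranging
  double sums over submultisets.
\<close>

lemma pset_mult_assoc:
  assumes p: "p \<in> PS" and q: "q \<in> PS" and "r \<in> PS" shows "(p \<star> q) \<star> r = p \<star> (q \<star> r)"
  using assms(3)
proof induct
  note [simp] = pset_coeff[OF p, THEN carrier_coeffE] pset_coeff[OF q, THEN carrier_coeffE]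
  case (indexed_const a)
  have "(\<lambda>m. (p \<star> q) m \<otimes> a) = p \<star> (\<lambda>m. q m \<otimes> a)"
    using indexed_const unfolding poly_conv_def
    by (simp add: finsum_ldistr finite_subset_mset m_assoc Pi_iff)
  then show ?case
    unfolding poly_mult_const[OF pset_coeff[OF pset_mult[OF p q]] indexed_const]
      poly_mult_const[OF pset_coeff[OF q] indexed_const] .
next
  case (indexed_padd P Q)
  note P = pset_coeff[OF indexed_padd(1)] and Q = pset_coeff[OF indexed_padd(3)]
  note p' = pset_coeff[OF p] and q' = pset_coeff[OF q] and pq = pset_coeff[OF pset_mult[OF p q]]
  show ?case
    unfolding poly_mult_add[OF pq P Q] poly_mult_add[OF q' P Q]
      poly_mult_add[OF p' carrier_coeff_mult[OF q' P] carrier_coeff_mult[OF q' Q]] indexed_padd(2,4) ..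
next
  case (indexed_pmult P i)
  note P = pset_coeff[OF indexed_pmult(1)]
  note p' = pset_coeff[OF p] and q' = pset_coeff[OF q] and pq = pset_coeff[OF pset_mult[OF p q]]
  show ?case
    unfolding poly_mult_pmult[OF pq P] poly_mult_pmult[OF q' P]
      poly_mult_pmult[OF p' carrier_coeff_mult[OF q' P]] indexed_pmult(2) ..
qed

lemma poly_ring_simps [simp]:
  "carrier (poly_ring R V) = PS"
  "p \<otimes>\<^bsub>poly_ring R V\<^esub> q = p \<star> q"
  "\<one>\<^bsub>poly_ring R V\<^esub> = indexed_const \<one>"
  "\<zero>\<^bsub>poly_ring R V\<^esub> = indexed_const \<zero>"
  "p \<oplus>\<^bsub>poly_ring R V\<^esub> q = indexed_padd p q"
  by (simp_all add: Defs.poly_ring_def poly_conv_def)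

lemma poly_ring_cring: "cring (poly_ring R V)"
proof (rule cringI)
  show "abelian_group (poly_ring R V)"
  proof (rule abelian_groupI)
    fix p assume "p \<in> carrier (poly_ring R V)"
    then have p: "p \<in> PS" by simp
    \<comment> \<open>The inverse of \<open>p\<close> is its multiple by \<open>\<ominus> \<one>\<close>, which is again a polynomial by \<open>pset_smult\<close>.\<close>
    have "indexed_padd (\<lambda>m. p m \<otimes> \<ominus> \<one>) p = indexed_const \<zero>"
      using carrier_coeffE[OF pset_coeff[OF p]] by (auto simp: indexed_padd_def indexed_zero_def r_minus l_neg)
    then show "\<exists>q\<in>carrier (poly_ring R V). q \<oplus>\<^bsub>poly_ring R V\<^esub> p = \<zero>\<^bsub>poly_ring R V\<^esub>"
      using pset_smult[OF p, of "\<ominus> \<one>"] by auto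
  next
    fix p q r assume "p \<in> carrier (poly_ring R V)" "q \<in> carrier (poly_ring R V)" "r \<in> carrier (poly_ring R V)"
    then have [simp]: "p m \<in> carrier R" "q m \<in> carrier R" "r m \<in> carrier R" for m
      using pset_coeff carrier_coeffE by auto
    show "p \<oplus>\<^bsub>poly_ring R V\<^esub> q \<oplus>\<^bsub>poly_ring R V\<^esub> r = p \<oplus>\<^bsub>poly_ring R V\<^esub> (q \<oplus>\<^bsub>poly_ring R V\<^esub> r)"
      by (simp add: indexed_padd_def a_assoc)
  next
    fix p q assume "p \<in> carrier (poly_ring R V)" "q \<in> carrier (poly_ring R V)"
    then have [simp]: "p m \<in> carrier R" "q m \<in> carrier R" for m
      using pset_coeff carrier_coeffE by auto
    show "p \<oplus>\<^bsub>poly_ring R V\<^esub> q = q \<oplus>\<^bsub>poly_ring R V\<^esub> p"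
      by (simp add: indexed_padd_def a_comm)
  qed (auto intro: pset_intros simp: indexed_padd_zero pset_coeff)
  show "Group.comm_monoid (poly_ring R V)"
  proof (rule comm_monoidI)
    fix p q assume "p \<in> carrier (poly_ring R V)" "q \<in> carrier (poly_ring R V)"
    then show "p \<otimes>\<^bsub>poly_ring R V\<^esub> q = q \<otimes>\<^bsub>poly_ring R V\<^esub> p"
      using poly_mult_comm[OF pset_coeff pset_coeff] by simp
  next
    fix p assume "p \<in> carrier (poly_ring R V)"
    then have p: "p \<in> PS" by simp
    have "carrier_coeff (indexed_const \<one> :: 'v multiset \<Rightarrow> 'a)" by (auto simp: carrier_coeff_def indexed_const_def)
    then show "\<one>\<^bsub>poly_ring R V\<^esub> \<otimes>\<^bsub>poly_ring R V\<^esub> p = p"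
      using poly_mult_const[OF pset_coeff[OF p] one_closed] poly_mult_comm[OF pset_coeff[OF p]]
        carrier_coeffE[OF pset_coeff[OF p]] by simp
  next
    fix p q r assume "p \<in> carrier (poly_ring R V)" "q \<in> carrier (poly_ring R V)" "r \<in> carrier (poly_ring R V)"
    then show "p \<otimes>\<^bsub>poly_ring R V\<^esub> q \<otimes>\<^bsub>poly_ring R V\<^esub> r = p \<otimes>\<^bsub>poly_ring R V\<^esub> (q \<otimes>\<^bsub>poly_ring R V\<^esub> r)"
      using pset_mult_assoc by simp
  qed (use pset_mult in \<open>auto intro: pset_intros\<close>)
next
  fix p q r assume "p \<in> carrier (poly_ring R V)" "q \<in> carrier (poly_ring R V)" "r \<in> carrier (poly_ring R V)"
  then have *: "carrier_coeff p" "carrier_coeff q" "carrier_coeff r" using pset_coeff by auto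
  show "(p \<oplus>\<^bsub>poly_ring R V\<^esub> q) \<otimes>\<^bsub>poly_ring R V\<^esub> r =
      p \<otimes>\<^bsub>poly_ring R V\<^esub> r \<oplus>\<^bsub>poly_ring R V\<^esub> q \<otimes>\<^bsub>poly_ring R V\<^esub> r"
    unfolding poly_ring_simps poly_mult_comm[OF indexed_padd_in_carrier[OF *(1,2)] *(3)]
      poly_mult_add[OF *(3,1,2)] poly_mult_comm[OF *(1,3)] poly_mult_comm[OF *(2,3)] ..
qed

lemma indexed_const_ring_hom: "indexed_const \<in> ring_hom R (poly_ring R V)"
proof (rule ring_hom_memI)
  fix a b assume ab: "a \<in> carrier R" "b \<in> carrier R"
  have "carrier_coeff (indexed_const a :: 'v multiset \<Rightarrow> 'a)"
    using ab by (auto simp: carrier_coeff_def indexed_const_def)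
  from poly_mult_const[OF this ab(2)]
  show "(indexed_const (a \<otimes> b) :: 'v multiset \<Rightarrow> 'a) = indexed_const a \<otimes>\<^bsub>poly_ring R V\<^esub> indexed_const b"
    using ab by (auto simp: indexed_const_def)
qed (auto intro: pset_intros simp: indexed_padd_const)

lemma indexed_var_carrier: "i \<in> V \<Longrightarrow> indexed_var i \<in> carrier (poly_ring R V)"
  unfolding indexed_var_def by (auto intro!: pset_intros)

declare poly_ring_simps [simp del]

end

end

section \<open>The universal algebra\<close>

text \<open>
  Index sets \<open>{1..n}\<close> of natural numbers should keep this form under simplification.
\<close>

declare One_nat_def [simp del]

lemma (in ring_hom_cring) hom_finsum_eq:
  assumes "\<And>i. i \<in> A \<Longrightarrow> f i \<in> carrier R" "\<And>i. i \<in> A \<Longrightarrow> h (f i) = g i"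
  shows "h (\<Oplus>i\<in>A. f i) = (\<Oplus>\<^bsub>S\<^esub>i\<in>A. g i)"
proof -
  have "h (\<Oplus>i\<in>A. f i) = (\<Oplus>\<^bsub>S\<^esub>i\<in>A. (h \<circ> f) i)"
    by (rule hom_finsum) (use assms(1) in auto)
  also have "\<dots> = (\<Oplus>\<^bsub>S\<^esub>i\<in>A. g i)"
    by (rule S.finsum_cong') (use assms hom_closed in \<open>auto simp flip: assms(2)\<close>)
  finally show ?thesis .
qed

text \<open>
  Structure constants, subject only to the conditions that make the relation polynomials well
  defined; no identities between them are needed for the facts about the universal algebra \<open>A\<close>,
  its generators \<open>x\<close> and its structure map \<open>h\<close> in this section.
\<close>

locale structure_constants = K: cring K
  for K :: "('k, 'm) ring_scheme" +
  fixes n :: nat and I :: "'i set"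
    and \<tau> :: "nat \<Rightarrow> nat \<Rightarrow> nat \<Rightarrow> 'k" and \<omega> :: "nat \<Rightarrow> nat \<Rightarrow> nat \<Rightarrow> nat \<Rightarrow> 'k"
    and B :: "'i \<Rightarrow> 'i \<Rightarrow> 'i set" and \<alpha> :: "'i \<Rightarrow> 'i \<Rightarrow> 'i \<Rightarrow> 'k"
    and C :: "'i \<Rightarrow> 'i \<Rightarrow> 'i \<Rightarrow> 'i set" and \<beta> :: "'i \<Rightarrow> 'i \<Rightarrow> 'i \<Rightarrow> 'i \<Rightarrow> 'k"
  assumes \<tau>_carrier: "\<And>i j s. i \<in> {1..n} \<Longrightarrow> j \<in> {1..n} \<Longrightarrow> s \<in> {1..n} \<Longrightarrow> \<tau> i j s \<in> carrier K"
    and \<omega>_carrier: "\<And>i j k s. i \<in> {1..n} \<Longrightarrow> j \<in> {1..n} \<Longrightarrow> k \<in> {1..n} \<Longrightarrow> s \<in> {1..n} \<Longrightarrow>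
          \<omega> i j k s \<in> carrier K"
    and B: "\<And>i j. i \<in> I \<Longrightarrow> j \<in> I \<Longrightarrow> finite (B i j) \<and> B i j \<subseteq> I"
    and \<alpha>_carrier: "\<And>i j u. i \<in> I \<Longrightarrow> j \<in> I \<Longrightarrow> u \<in> B i j \<Longrightarrow> \<alpha> i j u \<in> carrier K"
    and C: "\<And>i j k. i \<in> I \<Longrightarrow> j \<in> I \<Longrightarrow> k \<in> I \<Longrightarrow> finite (C i j k) \<and> C i j k \<subseteq> I"
    and \<beta>_carrier: "\<And>i j k u. i \<in> I \<Longrightarrow> j \<in> I \<Longrightarrow> k \<in> I \<Longrightarrow> u \<in> C i j k \<Longrightarrow> \<beta> i j k u \<in> carrier K"
begin

abbreviation "P \<equiv> Defs.poly_ring K ({1..n} \<times> I)"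
abbreviation "const \<equiv> (ring.indexed_const K :: 'k \<Rightarrow> (nat \<times> 'i) multiset \<Rightarrow> 'k)"
abbreviation "\<xi> s i \<equiv> ring.indexed_var K (s, i)"
abbreviation "J \<equiv> universal_ideal K n I \<tau> \<omega> B \<alpha> C \<beta>"
abbreviation "A \<equiv> universal_algebra K n I \<tau> \<omega> B \<alpha> C \<beta>"
abbreviation "x \<equiv> universal_gen K n I \<tau> \<omega> B \<alpha> C \<beta>"
abbreviation "h \<equiv> universal_scalar K n I \<tau> \<omega> B \<alpha> C \<beta>"

text \<open>
  The two sides of the defining relations, before passing to the quotient.
\<close>

definition "bin_lhs a i j = (\<Oplus>\<^bsub>P\<^esub>u \<in> B i j. const (\<alpha> i j u) \<otimes>\<^bsub>P\<^esub> \<xi> a u)"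
definition "bin_rhs a i j = (\<Oplus>\<^bsub>P\<^esub>s \<in> {1..n}. \<Oplus>\<^bsub>P\<^esub>t \<in> {1..n}. const (\<tau> s t a) \<otimes>\<^bsub>P\<^esub> \<xi> s i \<otimes>\<^bsub>P\<^esub> \<xi> t j)"
definition "ter_lhs a i j k = (\<Oplus>\<^bsub>P\<^esub>u \<in> C i j k. const (\<beta> i j k u) \<otimes>\<^bsub>P\<^esub> \<xi> a u)"
definition "ter_rhs a i j k = (\<Oplus>\<^bsub>P\<^esub>r \<in> {1..n}. \<Oplus>\<^bsub>P\<^esub>s \<in> {1..n}. \<Oplus>\<^bsub>P\<^esub>t \<in> {1..n}.
         const (\<omega> r s t a) \<otimes>\<^bsub>P\<^esub> \<xi> r i \<otimes>\<^bsub>P\<^esub> \<xi> s j \<otimes>\<^bsub>P\<^esub> \<xi> t k)"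

lemma relation_polys:
  "binary_relation_poly K n I \<tau> B \<alpha> a i j = bin_lhs a i j \<ominus>\<^bsub>P\<^esub> bin_rhs a i j"
  "ternary_relation_poly K n I \<omega> C \<beta> a i j k = ter_lhs a i j k \<ominus>\<^bsub>P\<^esub> ter_rhs a i j k"
  by (simp_all only: binary_relation_poly_def ternary_relation_poly_def Let_def bin_lhs_def
      bin_rhs_def ter_lhs_def ter_rhs_def)

lemma P_cring: "cring P" by (rule K.poly_ring_cring)

lemma const_closed: "k \<in> carrier K \<Longrightarrow> const k \<in> carrier P"
  by (rule ring_hom_closed[OF K.indexed_const_ring_hom])

lemma \<xi>_closed: "s \<in> {1..n} \<Longrightarrow> i \<in> I \<Longrightarrow> \<xi> s i \<in> carrier P"
  by (rule K.indexed_var_carrier) simp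

context
  fixes a i j
  assumes a: "a \<in> {1..n}" and i: "i \<in> I" and j: "j \<in> I"
begin

lemma bin_terms:
  "u \<in> B i j \<Longrightarrow> const (\<alpha> i j u) \<in> carrier P"
  "u \<in> B i j \<Longrightarrow> \<xi> a u \<in> carrier P"
  "s \<in> {1..n} \<Longrightarrow> t \<in> {1..n} \<Longrightarrow> const (\<tau> s t a) \<in> carrier P"
  "s \<in> {1..n} \<Longrightarrow> \<xi> s i \<in> carrier P" "s \<in> {1..n} \<Longrightarrow> \<xi> s j \<in> carrier P"
  using const_closed[OF \<alpha>_carrier] const_closed[OF \<tau>_carrier] \<xi>_closed B a i j by blast+

lemma ter_terms:
  assumes "k \<in> I"
  shows "u \<in> C i j k \<Longrightarrow> const (\<beta> i j k u) \<in> carrier P"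
  "u \<in> C i j k \<Longrightarrow> \<xi> a u \<in> carrier P"
  "r \<in> {1..n} \<Longrightarrow> s \<in> {1..n} \<Longrightarrow> t \<in> {1..n} \<Longrightarrow> const (\<omega> r s t a) \<in> carrier P"
  "s \<in> {1..n} \<Longrightarrow> \<xi> s k \<in> carrier P"
  using const_closed[OF \<beta>_carrier] const_closed[OF \<omega>_carrier] \<xi>_closed C a i j assms by blast+

lemma bin_closed: "bin_lhs a i j \<in> carrier P" "bin_rhs a i j \<in> carrier P"
proof -
  interpret P: cring P by (rule P_cring)
  show "bin_lhs a i j \<in> carrier P" "bin_rhs a i j \<in> carrier P"
    unfolding bin_lhs_def bin_rhs_def
    by (simp_all add: P.finsum_closed Pi_iff bin_terms)
qed

lemma ter_closed:
  assumes "k \<in> I" shows "ter_lhs a i j k \<in> carrier P" "ter_rhs a i j k \<in> carrier P"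
proof -
  interpret P: cring P by (rule P_cring)
  show "ter_lhs a i j k \<in> carrier P" "ter_rhs a i j k \<in> carrier P"
    unfolding ter_lhs_def ter_rhs_def
    by (simp_all add: P.finsum_closed Pi_iff bin_terms ter_terms[OF assms])
qed

end

abbreviation "relation_set \<equiv>
  {binary_relation_poly K n I \<tau> B \<alpha> a i j | a i j. a \<in> {1..n} \<and> i \<in> I \<and> j \<in> I} \<union>
      {ternary_relation_poly K n I \<omega> C \<beta> a i j k | a i j k.
         a \<in> {1..n} \<and> i \<in> I \<and> j \<in> I \<and> k \<in> I}"

lemma relation_set_carrier: "relation_set \<subseteq> carrier P"
proof -
  interpret P: cring P by (rule P_cring)
  have "binary_relation_poly K n I \<tau> B \<alpha> a i j \<in> carrier P" if "a \<in> {1..n}" "i \<in> I" "j \<in> I" for a i j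
    unfolding relation_polys by (intro P.minus_closed bin_closed that)
  moreover have "ternary_relation_poly K n I \<omega> C \<beta> a i j k \<in> carrier P"
    if "a \<in> {1..n}" "i \<in> I" "j \<in> I" "k \<in> I" for a i j k
    unfolding relation_polys by (intro P.minus_closed ter_closed that)
  ultimately show ?thesis by blast
qed

lemma J_ideal: "ideal J P"
proof -
  interpret P: cring P by (rule P_cring)
  show ?thesis unfolding universal_ideal_def by (rule P.genideal_ideal[OF relation_set_carrier])
qed

lemma relations_in_J: "relation_set \<subseteq> J"
proof -
  interpret P: cring P by (rule P_cring)
  show ?thesis unfolding universal_ideal_def by (rule P.genideal_self[OF relation_set_carrier])
qed

lemma proj: "ring_hom_cring P A (\<lambda>p. J +>\<^bsub>P\<^esub> p)"
  unfolding universal_algebra_def by (rule ideal.rcos_ring_hom_cring[OF J_ideal P_cring])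

lemma coset_eqI:
  assumes "p \<ominus>\<^bsub>P\<^esub> q \<in> J" "p \<in> carrier P" "q \<in> carrier P"
  shows "J +>\<^bsub>P\<^esub> p = J +>\<^bsub>P\<^esub> q"
proof -
  interpret P: cring P by (rule P_cring)
  interpret J: ideal J P by (rule J_ideal)
  show ?thesis
    using J.a_rcos_module_rev[OF assms(3,2)] J.a_repr_independence' assms unfolding P.minus_eq by metis
qed

lemma h_hom: "h \<in> ring_hom K A"
proof -
  interpret \<pi>: ring_hom_cring P A "\<lambda>p. J +>\<^bsub>P\<^esub> p" by (rule proj)
  show ?thesis using ring_hom_trans[OF K.indexed_const_ring_hom \<pi>.homh]
    by (simp add: comp_def universal_scalar_def[abs_def])
qed

lemma x_closed: "s \<in> {1..n} \<Longrightarrow> i \<in> I \<Longrightarrow> x s i \<in> carrier A"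
  unfolding universal_gen_def
  by (rule ring_hom_closed[OF ring_hom_cring.homh[OF proj] \<xi>_closed])

text \<open>
  The defining relations hold between the generators of the universal algebra.
\<close>

lemma binary_relation:
  assumes a: "a \<in> {1..n}" and i: "i \<in> I" and j: "j \<in> I"
  shows "(\<Oplus>\<^bsub>A\<^esub>u \<in> B i j. h (\<alpha> i j u) \<otimes>\<^bsub>A\<^esub> x a u) =
    (\<Oplus>\<^bsub>A\<^esub>s \<in> {1..n}. \<Oplus>\<^bsub>A\<^esub>t \<in> {1..n}. h (\<tau> s t a) \<otimes>\<^bsub>A\<^esub> x s i \<otimes>\<^bsub>A\<^esub> x t j)"
proof -
  interpret \<pi>: ring_hom_cring P A "\<lambda>p. J +>\<^bsub>P\<^esub> p" by (rule proj)
  note [simp] = bin_terms[OF a i j]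
  have "binary_relation_poly K n I \<tau> B \<alpha> a i j \<in> J"
    using relations_in_J assms by blast
  then have eq: "J +>\<^bsub>P\<^esub> bin_lhs a i j = J +>\<^bsub>P\<^esub> bin_rhs a i j"
    unfolding relation_polys by (rule coset_eqI) (rule bin_closed[OF assms])+
  have lhs: "J +>\<^bsub>P\<^esub> bin_lhs a i j = (\<Oplus>\<^bsub>A\<^esub>u \<in> B i j. h (\<alpha> i j u) \<otimes>\<^bsub>A\<^esub> x a u)"
    unfolding bin_lhs_def universal_scalar_def universal_gen_def
    by (intro \<pi>.hom_finsum_eq \<pi>.R.finsum_closed Pi_I) simp_all
  have rhs: "J +>\<^bsub>P\<^esub> bin_rhs a i j =
      (\<Oplus>\<^bsub>A\<^esub>s \<in> {1..n}. \<Oplus>\<^bsub>A\<^esub>t \<in> {1..n}. h (\<tau> s t a) \<otimes>\<^bsub>A\<^esub> x s i \<otimes>\<^bsub>A\<^esub> x t j)"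
    unfolding bin_rhs_def universal_scalar_def universal_gen_def
    by (intro \<pi>.hom_finsum_eq \<pi>.R.finsum_closed Pi_I) simp_all
  show ?thesis using eq unfolding lhs rhs .
qed

lemma ternary_relation:
  assumes a: "a \<in> {1..n}" and i: "i \<in> I" and j: "j \<in> I" and k: "k \<in> I"
  shows "(\<Oplus>\<^bsub>A\<^esub>u \<in> C i j k. h (\<beta> i j k u) \<otimes>\<^bsub>A\<^esub> x a u) =
    (\<Oplus>\<^bsub>A\<^esub>r \<in> {1..n}. \<Oplus>\<^bsub>A\<^esub>s \<in> {1..n}. \<Oplus>\<^bsub>A\<^esub>t \<in> {1..n}.
       h (\<omega> r s t a) \<otimes>\<^bsub>A\<^esub> x r i \<otimes>\<^bsub>A\<^esub> x s j \<otimes>\<^bsub>A\<^esub> x t k)"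
proof -
  interpret \<pi>: ring_hom_cring P A "\<lambda>p. J +>\<^bsub>P\<^esub> p" by (rule proj)
  note [simp] = bin_terms[OF a i j] ter_terms[OF a i j k]
  have "ternary_relation_poly K n I \<omega> C \<beta> a i j k \<in> J"
    using relations_in_J assms by blast
  then have eq: "J +>\<^bsub>P\<^esub> ter_lhs a i j k = J +>\<^bsub>P\<^esub> ter_rhs a i j k"
    unfolding relation_polys by (rule coset_eqI) (rule ter_closed[OF assms])+
  have lhs: "J +>\<^bsub>P\<^esub> ter_lhs a i j k = (\<Oplus>\<^bsub>A\<^esub>u \<in> C i j k. h (\<beta> i j k u) \<otimes>\<^bsub>A\<^esub> x a u)"
    unfolding ter_lhs_def universal_scalar_def universal_gen_def
    by (intro \<pi>.hom_finsum_eq \<pi>.R.finsum_closed Pi_I) simp_all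
  have rhs: "J +>\<^bsub>P\<^esub> ter_rhs a i j k =
      (\<Oplus>\<^bsub>A\<^esub>r \<in> {1..n}. \<Oplus>\<^bsub>A\<^esub>s \<in> {1..n}. \<Oplus>\<^bsub>A\<^esub>t \<in> {1..n}.
       h (\<omega> r s t a) \<otimes>\<^bsub>A\<^esub> x r i \<otimes>\<^bsub>A\<^esub> x s j \<otimes>\<^bsub>A\<^esub> x t k)"
    unfolding ter_rhs_def universal_scalar_def universal_gen_def
    by (intro \<pi>.hom_finsum_eq \<pi>.R.finsum_closed Pi_I) simp_all
  show ?thesis using eq unfolding lhs rhs .
qed

end

section \<open>Operators on a tensor product with a module over an algebra\<close>

text \<open>
  An iterated sum is a sum over a product of index sets.
\<close>

lemma (in abelian_monoid) finsum_Times: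
  assumes A: "finite A" and B: "finite B" 
    and g: "\<And>a b. a \<in> A \<Longrightarrow> b \<in> B \<Longrightarrow> g a b \<in> carrier G"
  shows "(\<Oplus>a\<in>A. \<Oplus>b\<in>B. g a b) = (\<Oplus>z\<in>A \<times> B. case z of (a, b) \<Rightarrow> g a b)"
  using A g
proof (induct A)
  case (insert a A)
  have "(\<Oplus>z\<in>insert a A \<times> B. case z of (a, b) \<Rightarrow> g a b) = (\<Oplus>z\<in>(Pair a ` B) \<union> (A \<times> B). case z of (a, b) \<Rightarrow> g a b)"
    by (rule arg_cong[where f = "finsum G _"]) auto
  also have "\<dots> = (\<Oplus>z\<in>Pair a ` B. case z of (a, b) \<Rightarrow> g a b) \<oplus> (\<Oplus>z\<in>A \<times> B. case z of (a, b) \<Rightarrow> g a b)"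
    by (rule finsum_Un_disjoint) (use insert B in auto)
  also have "(\<Oplus>z\<in>Pair a ` B. case z of (a, b) \<Rightarrow> g a b) = (\<Oplus>b\<in>B. g a b)"
    by (subst finsum_reindex) (use insert in \<open>auto simp: inj_on_def\<close>)
  also have "(\<Oplus>z\<in>A \<times> B. case z of (a, b) \<Rightarrow> g a b) = (\<Oplus>a\<in>A. \<Oplus>b\<in>B. g a b)"
    using insert by simp
  finally show ?case using insert by (simp add: Pi_iff finsum_closed)
qed simp

lemma (in abelian_monoid) finsum_commute:
  assumes A: "finite A" and B: "finite B" 
    and g: "\<And>a b. a \<in> A \<Longrightarrow> b \<in> B \<Longrightarrow> g a b \<in> carrier G"
  shows "(\<Oplus>a\<in>A. \<Oplus>b\<in>B. g a b) = (\<Oplus>b\<in>B. \<Oplus>a\<in>A. g a b)"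
proof -
  have "(\<Oplus>z\<in>A \<times> B. case z of (a, b) \<Rightarrow> g a b) =
      (\<Oplus>z\<in>prod.swap ` (B \<times> A). case z of (a, b) \<Rightarrow> g a b)"
    by (rule arg_cong[where f = "finsum G _"]) auto
  also have "\<dots> = (\<Oplus>z\<in>B \<times> A. case z of (b, a) \<Rightarrow> g a b)"
    by (subst finsum_reindex) (use g in \<open>auto simp: inj_on_def case_prod_unfold\<close>)
  finally show ?thesis using finsum_Times[OF A B, of g] finsum_Times[OF B A, of "\<lambda>b a. g a b"] g by simp
qed

lemma restrict_scalars_simps [simp]:
  "carrier (restrict_scalars h W) = carrier W"
  "\<zero>\<^bsub>restrict_scalars h W\<^esub> = \<zero>\<^bsub>W\<^esub>"
  "v \<oplus>\<^bsub>restrict_scalars h W\<^esub> w = v \<oplus>\<^bsub>W\<^esub> w"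
  "c \<odot>\<^bsub>restrict_scalars h W\<^esub> w = h c \<odot>\<^bsub>W\<^esub> w"
  by (simp_all add: restrict_scalars_def)

lemma finsum_restrict_scalars [simp]: "finsum (restrict_scalars h W) = finsum W"
  by (intro ext) (simp add: finsum_def finprod_def restrict_scalars_def)

lemma restrict_scalars_module:
  assumes "cring K" and W: "Module.module A W" and h: "h \<in> ring_hom K A"
  shows "Module.module K (restrict_scalars h W)"
proof -
  interpret K: cring K by fact
  interpret W: Module.module A W by fact
  show ?thesis
  proof (rule module_criteria, goal_cases)
    case 4 show ?case
    proof
      fix v assume "v \<in> carrier (restrict_scalars h W)"
      then show "\<exists>w\<in>carrier (restrict_scalars h W). v \<oplus>\<^bsub>restrict_scalars h W\<^esub> w = \<zero>\<^bsub>restrict_scalars h W\<^esub>"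
        by (intro bexI[of _ "\<ominus>\<^bsub>W\<^esub> v"]) (auto simp: W.r_neg)
    qed
  qed (auto simp: assms(1) ring_hom_closed[OF h] ring_hom_add[OF h] ring_hom_mult[OF h] ring_hom_one[OF h]
       W.a_ac W.smult_assoc1 W.smult_l_distr W.smult_r_distr)
qed

text \<open>
  A \<open>K\<close>-module \<open>U\<close>, a module \<open>W\<close> over a commutative \<open>K\<close>-algebra \<open>A\<close> with structure map \<open>h\<close>, and the tensor
  product over \<open>K\<close> of \<open>U\<close> with \<open>W\<close>.
\<close>

locale tensor_action = U: Module.module K U + W: Module.module A W
  for K :: "('k, 'm) ring_scheme" and U :: "('k, 'u, 'p) module_scheme"
    and A :: "('a, 'n) ring_scheme" and W :: "('a, 'w, 'q) module_scheme" +
  fixes h :: "'k \<Rightarrow> 'a"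
  assumes h: "h \<in> ring_hom K A"
begin

abbreviation "W\<^sub>K \<equiv> restrict_scalars h W"

sublocale tp: tensor K U W\<^sub>K
  by (intro tensor.intro U.module_axioms restrict_scalars_module[OF U.R.is_cring W.module_axioms h])

abbreviation "T \<equiv> tensor_product K U W\<^sub>K"
abbreviation "t \<equiv> pure_tensor K U W\<^sub>K"

lemma h_closed [simp]: "c \<in> carrier K \<Longrightarrow> h c \<in> carrier A"
  by (rule ring_hom_closed[OF h])

lemma t_closed [simp]: "u \<in> carrier U \<Longrightarrow> w \<in> carrier W \<Longrightarrow> t u w \<in> carrier T"
  by (rule tp.pure_closed) simp_all

lemma t_left: "w \<in> carrier W \<Longrightarrow> (\<lambda>u. t u w) \<in> linear_maps K U T"
  by (rule bilinear_mapD(2)[OF tp.pure_bilinear]) simp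

lemma t_right: "u \<in> carrier U \<Longrightarrow> t u \<in> linear_maps K W\<^sub>K T"
  by (rule bilinear_mapD(1)[OF tp.pure_bilinear])

lemma t_smult_right: "u \<in> carrier U \<Longrightarrow> w \<in> carrier W \<Longrightarrow> c \<in> carrier K \<Longrightarrow>
    t u (h c \<odot>\<^bsub>W\<^esub> w) = c \<odot>\<^bsub>T\<^esub> t u w"
  using LinearCombinations.module_hom_smult[OF t_right, of u c w] by simp

lemma t_finsum_right:
  assumes "u \<in> carrier U" "g \<in> B \<rightarrow> carrier W"
  shows "t u (\<Oplus>\<^bsub>W\<^esub>b\<in>B. g b) = (\<Oplus>\<^bsub>T\<^esub>b\<in>B. t u (g b))"
  using module_hom_finsum_eq[OF tp.W.module_axioms tp.T.module_axioms t_right[OF assms(1)], of g B] assms(2)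
  by simp

text \<open>
  The sum over \<open>q \<in> Q\<close> of the pure tensors of \<open>N q\<close> with \<open>s q \<odot> w\<close>. All operators below send a pure tensor
  to such a sum; the index set is arbitrary, so that composites, whose indices are tuples, have
  the same form.
\<close>

definition tsum :: "'x set \<Rightarrow> ('x \<Rightarrow> 'u) \<Rightarrow> ('x \<Rightarrow> 'a) \<Rightarrow> 'w \<Rightarrow> ('u \<times> 'w \<Rightarrow> 'k) set" where
  "tsum Q N s w = (\<Oplus>\<^bsub>T\<^esub>q\<in>Q. t (N q) (s q \<odot>\<^bsub>W\<^esub> w))"

lemma tsum_closed [simp]:
  assumes "N \<in> Q \<rightarrow> carrier U" "s \<in> Q \<rightarrow> carrier A" "w \<in> carrier W"
  shows "tsum Q N s w \<in> carrier T"
  unfolding tsum_def by (rule tp.T.finsum_closed) (use assms in \<open>auto simp: Pi_iff\<close>)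

lemma tsum_cong:
  assumes "\<And>q. q \<in> Q \<Longrightarrow> N q = N' q" "\<And>q. q \<in> Q \<Longrightarrow> s q = s' q"
    "N' \<in> Q \<rightarrow> carrier U" "s' \<in> Q \<rightarrow> carrier A" "w \<in> carrier W"
  shows "tsum Q N s w = tsum Q N' s' w"
  unfolding tsum_def by (rule tp.T.finsum_cong') (use assms in \<open>auto simp: Pi_iff\<close>)

text \<open>
  Used to bring the indices of composites taken in different orders into one common order. The
  bijection \<open>k\<close> is given together with its inverse \<open>k'\<close>.
\<close>

lemma tsum_reindex:
  assumes k: "\<And>q. q \<in> Q' \<Longrightarrow> k q \<in> Q \<and> k' (k q) = q" "\<And>q. q \<in> Q \<Longrightarrow> k' q \<in> Q' \<and> k (k' q) = q"
    and eq: "\<And>q. q \<in> Q' \<Longrightarrow> N (k q) = N' q" "\<And>q. q \<in> Q' \<Longrightarrow> s (k q) = s' q"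
    and cl: "N \<in> Q \<rightarrow> carrier U" "s \<in> Q \<rightarrow> carrier A" "w \<in> carrier W"
  shows "tsum Q N s w = tsum Q' N' s' w"
proof -
  have Q: "Q = k ` Q'" using k by (force simp: image_iff)
  have inj: "inj_on k Q'" by (rule inj_on_inverseI[of _ k']) (use k in \<open>auto simp: Pi_iff\<close>)
  have "tsum Q N s w = (\<Oplus>\<^bsub>T\<^esub>q\<in>Q'. t (N (k q)) (s (k q) \<odot>\<^bsub>W\<^esub> w))"
    unfolding tsum_def Q by (rule tp.T.finsum_reindex[OF _ inj]) (use cl k in \<open>auto simp: Pi_iff\<close>)
  also have "\<dots> = tsum Q' N' s' w"
    unfolding tsum_def by (rule tp.T.finsum_cong') (use cl k eq in \<open>force+\<close>)
  finally show ?thesis .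
qed

lemma tsum_linear_N:
  assumes N: "\<And>q. q \<in> Q \<Longrightarrow> N q \<in> linear_maps K V U" 
    and s: "s \<in> Q \<rightarrow> carrier A" and w: "w \<in> carrier W"
  shows "(\<lambda>v. tsum Q (\<lambda>q. N q v) s w) \<in> linear_maps K V T"
  unfolding tsum_def
  by (rule module_hom_finsum_fun[OF tp.T.module_axioms module_hom_comp[OF N t_left]]) (use s w in \<open>auto simp: Pi_iff\<close>)

lemma tsum_linear_w:
  assumes N: "N \<in> Q \<rightarrow> carrier U" and s: "s \<in> Q \<rightarrow> carrier A"
  shows "tsum Q N s \<in> linear_maps K W\<^sub>K T"
proof -
  have sm: "(\<lambda>w. a \<odot>\<^bsub>W\<^esub> w) \<in> linear_maps K W\<^sub>K W\<^sub>K" if a: "a \<in> carrier A" for a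
  proof (rule module_homI, goal_cases)
    case (3 c v)
    then show ?case using a by (simp add: W.smult_assoc1[symmetric] W.R.m_comm)
  qed (use a in \<open>auto simp: W.smult_r_distr\<close>)
  show ?thesis unfolding tsum_def[abs_def]
    by (rule module_hom_finsum_fun[OF tp.T.module_axioms module_hom_comp[OF sm t_right]])
      (use N s in \<open>auto simp: Pi_iff\<close>)
qed

text \<open>
  The algebra \<open>A\<close> as a module over \<open>K\<close>; the fields \<open>mult\<close> and \<open>one\<close> of the record play no role.
\<close>

definition alg_module :: "('k, 'a) module" where
  "alg_module = \<lparr>carrier = carrier A, monoid.mult = undefined, monoid.one = undefined,
    ring.zero = \<zero>\<^bsub>A\<^esub>, ring.add = ring.add A, module.smult = (\<lambda>c a. h c \<otimes>\<^bsub>A\<^esub> a)\<rparr>"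

lemma alg_module_simps [simp]:
  "carrier alg_module = carrier A" "\<zero>\<^bsub>alg_module\<^esub> = \<zero>\<^bsub>A\<^esub>"
  "a \<oplus>\<^bsub>alg_module\<^esub> b = a \<oplus>\<^bsub>A\<^esub> b" "c \<odot>\<^bsub>alg_module\<^esub> a = h c \<otimes>\<^bsub>A\<^esub> a"
  by (simp_all add: alg_module_def)

lemma finsum_alg_module [simp]: "finsum alg_module = finsum A"
  by (intro ext) (simp add: finsum_def finprod_def alg_module_def)

lemma alg_module_module: "Module.module K alg_module"
proof (rule module_criteria, goal_cases)
  case 4 show ?case
  proof
    fix v assume "v \<in> carrier alg_module"
    then show "\<exists>w\<in>carrier alg_module. v \<oplus>\<^bsub>alg_module\<^esub> w = \<zero>\<^bsub>alg_module\<^esub>"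
      by (intro bexI[of _ "\<ominus>\<^bsub>A\<^esub> v"]) (auto simp: W.R.r_neg)
  qed
qed (auto simp: U.R.is_cring ring_hom_closed[OF h] ring_hom_add[OF h] ring_hom_mult[OF h] ring_hom_one[OF h]
       W.R.a_ac W.R.m_assoc W.R.l_distr W.R.r_distr)

lemma alg_module_mult_left:
  assumes "f \<in> linear_maps K V alg_module" "a \<in> carrier A"
  shows "(\<lambda>v. a \<otimes>\<^bsub>A\<^esub> f v) \<in> linear_maps K V alg_module"
proof -
  note f = module_hom_in_carrier[OF assms(1), simplified]
  show ?thesis
    by (rule module_homI) (use assms f in \<open>auto simp: LinearCombinations.module_hom_add[OF assms(1)]
      LinearCombinations.module_hom_smult[OF assms(1)] W.R.r_distr W.R.m_lcomm\<close>)
qed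

lemma alg_module_mult_right:
  assumes "f \<in> linear_maps K V alg_module" "a \<in> carrier A"
  shows "(\<lambda>v. f v \<otimes>\<^bsub>A\<^esub> a) \<in> linear_maps K V alg_module"
proof -
  note f = module_hom_in_carrier[OF assms(1), simplified]
  show ?thesis
    by (rule module_homI) (use assms f in \<open>auto simp: LinearCombinations.module_hom_add[OF assms(1)]
      LinearCombinations.module_hom_smult[OF assms(1)] W.R.l_distr W.R.m_assoc\<close>)
qed

lemma tsum_linear_s:
  assumes N: "N \<in> Q \<rightarrow> carrier U" and w: "w \<in> carrier W"
    and s: "\<And>q. q \<in> Q \<Longrightarrow> (\<lambda>v. s v q) \<in> linear_maps K V alg_module"
  shows "(\<lambda>v. tsum Q N (s v) w) \<in> linear_maps K V T"
proof -
  have sm: "(\<lambda>a. a \<odot>\<^bsub>W\<^esub> w) \<in> linear_maps K alg_module W\<^sub>K"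
    by (rule module_homI) (use w in \<open>auto simp: W.smult_l_distr W.smult_assoc1\<close>)
  show ?thesis unfolding tsum_def
    by (rule module_hom_finsum_fun[OF tp.T.module_axioms module_hom_comp[OF module_hom_comp[OF s sm] t_right]])
      (use N in \<open>auto simp: Pi_iff\<close>)
qed

lemma tsum_add:
  assumes "N \<in> Q \<rightarrow> carrier U" "N' \<in> Q \<rightarrow> carrier U" "s \<in> Q \<rightarrow> carrier A" "w \<in> carrier W"
  shows "tsum Q N s w \<oplus>\<^bsub>T\<^esub> tsum Q N' s w = tsum Q (\<lambda>q. N q \<oplus>\<^bsub>U\<^esub> N' q) s w"
proof -
  have "tsum Q (\<lambda>q. N q \<oplus>\<^bsub>U\<^esub> N' q) s w = (\<Oplus>\<^bsub>T\<^esub>q\<in>Q. t (N q) (s q \<odot>\<^bsub>W\<^esub> w) \<oplus>\<^bsub>T\<^esub> t (N' q) (s q \<odot>\<^bsub>W\<^esub> w))"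
    unfolding tsum_def
    by (rule tp.T.finsum_cong') (use assms in \<open>auto simp: Pi_iff LinearCombinations.module_hom_add[OF t_left]\<close>)
  also have "\<dots> = tsum Q N s w \<oplus>\<^bsub>T\<^esub> tsum Q N' s w"
    unfolding tsum_def by (rule tp.T.finsum_addf) (use assms in \<open>auto simp: Pi_iff\<close>)
  finally show ?thesis ..
qed

lemma tsum_diff:
  assumes "N \<in> Q \<rightarrow> carrier U" "N' \<in> Q \<rightarrow> carrier U" "s \<in> Q \<rightarrow> carrier A" "w \<in> carrier W"
  shows "tsum Q N s w \<ominus>\<^bsub>T\<^esub> tsum Q N' s w = tsum Q (\<lambda>q. N q \<ominus>\<^bsub>U\<^esub> N' q) s w"
proof -
  have "tsum Q (\<lambda>q. N q \<ominus>\<^bsub>U\<^esub> N' q) s w \<oplus>\<^bsub>T\<^esub> tsum Q N' s w =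
      tsum Q (\<lambda>q. (N q \<ominus>\<^bsub>U\<^esub> N' q) \<oplus>\<^bsub>U\<^esub> N' q) s w"
    by (rule tsum_add) (use assms in \<open>auto simp: Pi_iff\<close>)
  also have "\<dots> = tsum Q N s w"
    by (rule tsum_cong) (use assms in \<open>auto simp: Pi_iff U.minus_eq U.a_assoc U.l_neg\<close>)
  finally have eq: "tsum Q N s w = tsum Q (\<lambda>q. N q \<ominus>\<^bsub>U\<^esub> N' q) s w \<oplus>\<^bsub>T\<^esub> tsum Q N' s w" ..
  have cl: "tsum Q (\<lambda>q. N q \<ominus>\<^bsub>U\<^esub> N' q) s w \<in> carrier T" "tsum Q N' s w \<in> carrier T"
    using assms by (auto simp: Pi_iff)
  show ?thesis unfolding eq
    using cl by (simp add: tp.T.minus_eq tp.T.a_assoc tp.T.r_neg)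
qed

lemma tsum_zero:
  assumes "s \<in> Q \<rightarrow> carrier A" "w \<in> carrier W" "\<And>q. q \<in> Q \<Longrightarrow> N q = \<zero>\<^bsub>U\<^esub>"
  shows "tsum Q N s w = \<zero>\<^bsub>T\<^esub>"
  unfolding tsum_def
  by (rule tp.T.add.finprod_one_eqI)
    (use assms module_hom_zero_eq[OF U.module_axioms tp.T.module_axioms t_left] in \<open>auto simp: Pi_iff\<close>)

text \<open>
  The operator \<open>f\<close> on the tensor product is the finite sum, over \<open>q \<in> Q\<close>, of the tensor products of the
  endomorphism \<open>F q\<close> of \<open>U\<close> with the action of \<open>s q\<close> on \<open>W\<close>.
\<close>

definition represents :: "(('u \<times> 'w \<Rightarrow> 'k) set \<Rightarrow> ('u \<times> 'w \<Rightarrow> 'k) set) \<Rightarrow> 'x set \<Rightarrow> ('x \<Rightarrow> 'u \<Rightarrow> 'u) \<Rightarrow> ('x \<Rightarrow> 'a) \<Rightarrow> bool" where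
  "represents f Q F s \<longleftrightarrow> finite Q \<and> f \<in> linear_maps K T T \<and> (\<forall>q\<in>Q. F q \<in> linear_maps K U U) \<and> s \<in> Q \<rightarrow> carrier A \<and>
    (\<forall>u\<in>carrier U. \<forall>w\<in>carrier W. f (t u w) = tsum Q (\<lambda>q. F q u) s w)"

lemma tsum_compose:
  assumes f: "represents f Q F s"
    and Q': "finite Q'" and N: "N \<in> Q' \<rightarrow> carrier U" and s': "s' \<in> Q' \<rightarrow> carrier A" and w: "w \<in> carrier W"
  shows "f (tsum Q' N s' w) = tsum (Q \<times> Q') (\<lambda>(q, q'). F q (N q')) (\<lambda>(q, q'). s q \<otimes>\<^bsub>A\<^esub> s' q') w"
proof -
  have lin: "f \<in> linear_maps K T T" and F: "\<And>q. q \<in> Q \<Longrightarrow> F q \<in> linear_maps K U U" and s: "s \<in> Q \<rightarrow> carrier A"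
    and Q: "finite Q"
    and eq: "\<And>u w. u \<in> carrier U \<Longrightarrow> w \<in> carrier W \<Longrightarrow> f (t u w) = tsum Q (\<lambda>q. F q u) s w"
    using f by (auto simp: represents_def)
  note Fc = F[THEN module_hom_in_carrier]
  have "f (tsum Q' N s' w) = (\<Oplus>\<^bsub>T\<^esub>q'\<in>Q'. f (t (N q') (s' q' \<odot>\<^bsub>W\<^esub> w)))"
    unfolding tsum_def by (rule module_hom_finsum_eq[OF tp.T.module_axioms tp.T.module_axioms lin]) (use N s' w in \<open>auto simp: Pi_iff\<close>)
  also have "\<dots> = (\<Oplus>\<^bsub>T\<^esub>q'\<in>Q'. \<Oplus>\<^bsub>T\<^esub>q\<in>Q. t (F q (N q')) (s q \<odot>\<^bsub>W\<^esub> (s' q' \<odot>\<^bsub>W\<^esub> w)))"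
    by (rule tp.T.finsum_cong')
      (use N s s' w Fc in \<open>auto simp: eq tsum_def Pi_iff intro!: tp.T.finsum_closed\<close>)
  also have "\<dots> = (\<Oplus>\<^bsub>T\<^esub>q\<in>Q. \<Oplus>\<^bsub>T\<^esub>q'\<in>Q'. t (F q (N q')) (s q \<odot>\<^bsub>W\<^esub> (s' q' \<odot>\<^bsub>W\<^esub> w)))"
    by (rule tp.T.finsum_commute[OF Q' Q]) (use N s s' w Fc in \<open>auto simp: Pi_iff\<close>)
  also have "\<dots> = (\<Oplus>\<^bsub>T\<^esub>z\<in>Q \<times> Q'. case z of (q, q') \<Rightarrow> t (F q (N q')) (s q \<odot>\<^bsub>W\<^esub> (s' q' \<odot>\<^bsub>W\<^esub> w)))"
    by (rule tp.T.finsum_Times[OF Q Q']) (use N s s' w Fc in \<open>auto simp: Pi_iff\<close>)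
  also have "\<dots> = tsum (Q \<times> Q') (\<lambda>(q, q'). F q (N q')) (\<lambda>(q, q'). s q \<otimes>\<^bsub>A\<^esub> s' q') w"
    unfolding tsum_def
    by (rule tp.T.finsum_cong') (use N s s' w Fc in \<open>auto simp: Pi_iff W.smult_assoc1\<close>)
  finally show ?thesis .
qed

text \<open>
  If the coefficients attached to the index \<open>j\<close> are themselves linear combinations of \<open>s' q\<close> with scalars
  \<open>\<tau> q j\<close>, then these scalars can be moved across the tensor sign to the vectors \<open>N p j\<close>, and \<open>j\<close> is
  summed away. The index \<open>p\<close> is a bystander.
\<close>

lemma tsum_contract:
  assumes fin: "finite P" "finite J" "finite Q"
    and N: "\<And>p j. p \<in> P \<Longrightarrow> j \<in> J \<Longrightarrow> N p j \<in> carrier U"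
    and \<tau>: "\<And>q j. q \<in> Q \<Longrightarrow> j \<in> J \<Longrightarrow> \<tau> q j \<in> carrier K"
    and s: "\<And>p. p \<in> P \<Longrightarrow> s p \<in> carrier A" and s': "\<And>q. q \<in> Q \<Longrightarrow> s' q \<in> carrier A"
    and w: "w \<in> carrier W"
  shows "tsum (P \<times> J) (\<lambda>(p, j). N p j) (\<lambda>(p, j). s p \<otimes>\<^bsub>A\<^esub> (\<Oplus>\<^bsub>A\<^esub>q\<in>Q. h (\<tau> q j) \<otimes>\<^bsub>A\<^esub> s' q)) w =
    tsum (P \<times> Q) (\<lambda>(p, q). \<Oplus>\<^bsub>U\<^esub>j\<in>J. \<tau> q j \<odot>\<^bsub>U\<^esub> N p j) (\<lambda>(p, q). s p \<otimes>\<^bsub>A\<^esub> s' q) w"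
proof -
  note [simp] = N \<tau> s s' w
  have inner: "t (N p j) ((s p \<otimes>\<^bsub>A\<^esub> (\<Oplus>\<^bsub>A\<^esub>q\<in>Q. h (\<tau> q j) \<otimes>\<^bsub>A\<^esub> s' q)) \<odot>\<^bsub>W\<^esub> w) =
      (\<Oplus>\<^bsub>T\<^esub>q\<in>Q. \<tau> q j \<odot>\<^bsub>T\<^esub> t (N p j) ((s p \<otimes>\<^bsub>A\<^esub> s' q) \<odot>\<^bsub>W\<^esub> w))" if "p \<in> P" "j \<in> J" for p j
  proof -
    note [simp] = that
    have "(s p \<otimes>\<^bsub>A\<^esub> (\<Oplus>\<^bsub>A\<^esub>q\<in>Q. h (\<tau> q j) \<otimes>\<^bsub>A\<^esub> s' q)) = (\<Oplus>\<^bsub>A\<^esub>q\<in>Q. h (\<tau> q j) \<otimes>\<^bsub>A\<^esub> (s p \<otimes>\<^bsub>A\<^esub> s' q))"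
      by (subst W.R.finsum_rdistr) (use fin in \<open>auto intro!: W.R.finsum_cong' simp: W.R.m_lcomm\<close>)
    then have "(s p \<otimes>\<^bsub>A\<^esub> (\<Oplus>\<^bsub>A\<^esub>q\<in>Q. h (\<tau> q j) \<otimes>\<^bsub>A\<^esub> s' q)) \<odot>\<^bsub>W\<^esub> w =
        (\<Oplus>\<^bsub>W\<^esub>q\<in>Q. (h (\<tau> q j) \<otimes>\<^bsub>A\<^esub> (s p \<otimes>\<^bsub>A\<^esub> s' q)) \<odot>\<^bsub>W\<^esub> w)"
      by (simp add: W.finsum_smult_r Pi_iff)
    also have "\<dots> = (\<Oplus>\<^bsub>W\<^esub>q\<in>Q. h (\<tau> q j) \<odot>\<^bsub>W\<^esub> ((s p \<otimes>\<^bsub>A\<^esub> s' q) \<odot>\<^bsub>W\<^esub> w))"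
      by (rule W.finsum_cong') (auto simp: W.smult_assoc1)
    finally have "t (N p j) ((s p \<otimes>\<^bsub>A\<^esub> (\<Oplus>\<^bsub>A\<^esub>q\<in>Q. h (\<tau> q j) \<otimes>\<^bsub>A\<^esub> s' q)) \<odot>\<^bsub>W\<^esub> w) =
        (\<Oplus>\<^bsub>T\<^esub>q\<in>Q. t (N p j) (h (\<tau> q j) \<odot>\<^bsub>W\<^esub> ((s p \<otimes>\<^bsub>A\<^esub> s' q) \<odot>\<^bsub>W\<^esub> w)))"
      by (simp add: t_finsum_right Pi_iff)
    also have "\<dots> = (\<Oplus>\<^bsub>T\<^esub>q\<in>Q. \<tau> q j \<odot>\<^bsub>T\<^esub> t (N p j) ((s p \<otimes>\<^bsub>A\<^esub> s' q) \<odot>\<^bsub>W\<^esub> w))"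
      by (rule tp.T.finsum_cong') (auto simp: t_smult_right)
    finally show ?thesis .
  qed
  have outer: "(\<Oplus>\<^bsub>T\<^esub>j\<in>J. \<tau> q j \<odot>\<^bsub>T\<^esub> t (N p j) ((s p \<otimes>\<^bsub>A\<^esub> s' q) \<odot>\<^bsub>W\<^esub> w)) =
      t (\<Oplus>\<^bsub>U\<^esub>j\<in>J. \<tau> q j \<odot>\<^bsub>U\<^esub> N p j) ((s p \<otimes>\<^bsub>A\<^esub> s' q) \<odot>\<^bsub>W\<^esub> w)" if "p \<in> P" "q \<in> Q" for p q
  proof -
    note [simp] = that
    have w': "(s p \<otimes>\<^bsub>A\<^esub> s' q) \<odot>\<^bsub>W\<^esub> w \<in> carrier W" by simp
    have "t (\<Oplus>\<^bsub>U\<^esub>j\<in>J. \<tau> q j \<odot>\<^bsub>U\<^esub> N p j) ((s p \<otimes>\<^bsub>A\<^esub> s' q) \<odot>\<^bsub>W\<^esub> w) =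
       (\<Oplus>\<^bsub>T\<^esub>j\<in>J. t (\<tau> q j \<odot>\<^bsub>U\<^esub> N p j) ((s p \<otimes>\<^bsub>A\<^esub> s' q) \<odot>\<^bsub>W\<^esub> w))"
      by (rule module_hom_finsum_eq[OF U.module_axioms tp.T.module_axioms t_left[OF w']]) auto
    also have "\<dots> = (\<Oplus>\<^bsub>T\<^esub>j\<in>J. \<tau> q j \<odot>\<^bsub>T\<^esub> t (N p j) ((s p \<otimes>\<^bsub>A\<^esub> s' q) \<odot>\<^bsub>W\<^esub> w))"
      by (rule tp.T.finsum_cong') (auto simp: LinearCombinations.module_hom_smult[OF t_left[OF w']])
    finally show ?thesis ..
  qed
  have Uc: "(\<Oplus>\<^bsub>U\<^esub>j\<in>J. \<tau> q j \<odot>\<^bsub>U\<^esub> N p j) \<in> carrier U" if "p \<in> P" "q \<in> Q" for p q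
    using that by (intro U.finsum_closed) auto
  have "tsum (P \<times> J) (\<lambda>(p, j). N p j) (\<lambda>(p, j). s p \<otimes>\<^bsub>A\<^esub> (\<Oplus>\<^bsub>A\<^esub>q\<in>Q. h (\<tau> q j) \<otimes>\<^bsub>A\<^esub> s' q)) w =
      (\<Oplus>\<^bsub>T\<^esub>z\<in>P \<times> J. case z of (p, j) \<Rightarrow> \<Oplus>\<^bsub>T\<^esub>q\<in>Q. \<tau> q j \<odot>\<^bsub>T\<^esub> t (N p j) ((s p \<otimes>\<^bsub>A\<^esub> s' q) \<odot>\<^bsub>W\<^esub> w))"
    unfolding tsum_def by (rule tp.T.finsum_cong') (auto simp: inner intro!: tp.T.finsum_closed)
  also have "\<dots> = (\<Oplus>\<^bsub>T\<^esub>p\<in>P. \<Oplus>\<^bsub>T\<^esub>j\<in>J. \<Oplus>\<^bsub>T\<^esub>q\<in>Q. \<tau> q j \<odot>\<^bsub>T\<^esub> t (N p j) ((s p \<otimes>\<^bsub>A\<^esub> s' q) \<odot>\<^bsub>W\<^esub> w))"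
    by (rule tp.T.finsum_Times[symmetric]) (use fin in \<open>auto intro!: tp.T.finsum_closed\<close>)
  also have "\<dots> = (\<Oplus>\<^bsub>T\<^esub>p\<in>P. \<Oplus>\<^bsub>T\<^esub>q\<in>Q. \<Oplus>\<^bsub>T\<^esub>j\<in>J. \<tau> q j \<odot>\<^bsub>T\<^esub> t (N p j) ((s p \<otimes>\<^bsub>A\<^esub> s' q) \<odot>\<^bsub>W\<^esub> w))"
    by (rule tp.T.finsum_cong'[OF refl _ tp.T.finsum_commute]) (use fin in \<open>auto intro!: tp.T.finsum_closed\<close>)
  also have "\<dots> = (\<Oplus>\<^bsub>T\<^esub>p\<in>P. \<Oplus>\<^bsub>T\<^esub>q\<in>Q. t (\<Oplus>\<^bsub>U\<^esub>j\<in>J. \<tau> q j \<odot>\<^bsub>U\<^esub> N p j) ((s p \<otimes>\<^bsub>A\<^esub> s' q) \<odot>\<^bsub>W\<^esub> w))"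
    by (rule tp.T.finsum_cong'[OF refl _ tp.T.finsum_cong'])
      (auto simp: outer Uc intro!: tp.T.finsum_closed)
  also have "\<dots> = (\<Oplus>\<^bsub>T\<^esub>z\<in>P \<times> Q. case z of (p, q) \<Rightarrow> t (\<Oplus>\<^bsub>U\<^esub>j\<in>J. \<tau> q j \<odot>\<^bsub>U\<^esub> N p j) ((s p \<otimes>\<^bsub>A\<^esub> s' q) \<odot>\<^bsub>W\<^esub> w))"
    by (rule tp.T.finsum_Times) (use fin Uc in \<open>auto simp: Pi_iff\<close>)
  also have "\<dots> = tsum (P \<times> Q) (\<lambda>(p, q). \<Oplus>\<^bsub>U\<^esub>j\<in>J. \<tau> q j \<odot>\<^bsub>U\<^esub> N p j) (\<lambda>(p, q). s p \<otimes>\<^bsub>A\<^esub> s' q) w"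
    unfolding tsum_def by (rule tp.T.finsum_cong') (use Uc in \<open>auto simp: Pi_iff\<close>)
  finally show ?thesis .
qed

text \<open>
  Every finite sum of this kind is represented by an operator on the tensor product.
\<close>

lemma tensor_operator_exists:
  assumes F: "\<And>q. q \<in> Q \<Longrightarrow> F q \<in> linear_maps K U U" and s: "s \<in> Q \<rightarrow> carrier A"
  shows "\<exists>f \<in> linear_maps K T T. \<forall>u\<in>carrier U. \<forall>w\<in>carrier W. f (t u w) = tsum Q (\<lambda>q. F q u) s w"
proof -
  have "bilinear_map K U W\<^sub>K T (\<lambda>u. tsum Q (\<lambda>q. F q u) s)"
    by (rule bilinear_mapI[OF tsum_linear_w tsum_linear_N])
      (use F[THEN module_hom_in_carrier] F s in \<open>auto simp: Pi_iff\<close>)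
  then obtain f where "f \<in> linear_maps K T T"
    "\<And>u w. u \<in> carrier U \<Longrightarrow> w \<in> carrier W\<^sub>K \<Longrightarrow> f (t u w) = tsum Q (\<lambda>q. F q u) s w"
    using tp.tensor_lift[OF tp.T.module_axioms] by blast
  then show ?thesis by auto
qed

end

section \<open>The module identities\<close>

lemma trilinear_mapD:
  assumes "trilinear_map K V1 V2 V3 V f"
  shows "x \<in> carrier V1 \<Longrightarrow> y \<in> carrier V2 \<Longrightarrow> f x y \<in> linear_maps K V3 V"
    "x \<in> carrier V1 \<Longrightarrow> z \<in> carrier V3 \<Longrightarrow> (\<lambda>y. f x y z) \<in> linear_maps K V2 V"
    "y \<in> carrier V2 \<Longrightarrow> z \<in> carrier V3 \<Longrightarrow> (\<lambda>x. f x y z) \<in> linear_maps K V1 V"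
  using assms by (simp_all add: trilinear_map_def)

context tensor_action begin

lemma representsD:
  assumes "represents f Q F s"
  shows "finite Q" "f \<in> linear_maps K T T" "q \<in> Q \<Longrightarrow> F q \<in> linear_maps K U U" "s \<in> Q \<rightarrow> carrier A"
    "u \<in> carrier U \<Longrightarrow> w \<in> carrier W \<Longrightarrow> f (t u w) = tsum Q (\<lambda>q. F q u) s w"
  using assms by (simp_all add: represents_def)

text \<open>
  The composite of two represented operators at a pure tensor, with the indices brought into the
  order of the set \<open>R\<close>.
\<close>

lemma compose_reindex:
  assumes f: "represents f Q F s" and f': "represents f' Q' F' s'"
    and u: "u \<in> carrier U" and w: "w \<in> carrier W"
    and k: "\<And>q. q \<in> R \<Longrightarrow> k q \<in> Q \<times> Q' \<and> k' (k q) = q"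
      "\<And>q. q \<in> Q \<times> Q' \<Longrightarrow> k' q \<in> R \<and> k (k' q) = q"
    and N: "\<And>q. q \<in> R \<Longrightarrow> (case k q of (i, j) \<Rightarrow> F i (F' j u)) = N q"
    and S: "\<And>q. q \<in> R \<Longrightarrow> (case k q of (i, j) \<Rightarrow> s i \<otimes>\<^bsub>A\<^esub> s' j) = S q"
  shows "f (f' (t u w)) = tsum R N S w"
proof -
  note f'_eq = representsD(5)[OF f' u w] and Q' = representsD(1)[OF f'] and s' = representsD(4)[OF f']
  have F': "(\<lambda>q. F' q u) \<in> Q' \<rightarrow> carrier U"
    using module_hom_in_carrier[OF representsD(3)[OF f'] u] by blast
  note F = module_hom_in_carrier[OF representsD(3)[OF f]] and s = representsD(4)[OF f]
  show ?thesis
    unfolding f'_eq tsum_compose[OF f Q' F' s' w]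
    by (rule tsum_reindex[OF k]) (use N S F F' s s' w in \<open>auto simp: Pi_iff\<close>)
qed

end

text \<open>
  An \<open>L\<close>-module \<open>U\<close>, elements \<open>e i\<close> of \<open>L\<close> with structure constants \<open>\<tau>\<close> and \<open>\<omega>\<close>, and linear maps \<open>c i\<close> from \<open>G\<close> to
  the algebra \<open>A\<close>. The conditions \<open>c_bracket\<close> and \<open>c_triple\<close> say that \<open>a \<mapsto> \<Sum>\<^sub>i e i \<otimes> c i a\<close> respects both
  operations, with those of \<open>L\<close> extended \<open>A\<close>-multilinearly. No linear independence of the \<open>e i\<close> is required.
\<close>

locale ly_extension =
  tensor_action K U A W h + LM: ly_module K L U \<rho> D \<theta> + G: lie_yamaguti K G
  for K :: "('k, 'm) ring_scheme" and L :: "('k, 'l, 'r) ly_algebra_scheme"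
    and U :: "('k, 'u, 'p) module_scheme" and \<rho> D \<theta>
    and G :: "('k, 'g, 'z) ly_algebra_scheme"
    and A :: "('a, 'n) ring_scheme" and W :: "('a, 'w, 'q) module_scheme" and h +
  fixes J :: "'j set" and e :: "'j \<Rightarrow> 'l" and \<tau> :: "'j \<Rightarrow> 'j \<Rightarrow> 'j \<Rightarrow> 'k" and \<omega> :: "'j \<Rightarrow> 'j \<Rightarrow> 'j \<Rightarrow> 'j \<Rightarrow> 'k"
    and c :: "'j \<Rightarrow> 'g \<Rightarrow> 'a"
  assumes J: "finite J" and e: "\<And>i. i \<in> J \<Longrightarrow> e i \<in> carrier L"
    and \<tau>_closed: "\<And>i j s. i \<in> J \<Longrightarrow> j \<in> J \<Longrightarrow> s \<in> J \<Longrightarrow> \<tau> i j s \<in> carrier K"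
    and \<tau>: "\<And>i j. i \<in> J \<Longrightarrow> j \<in> J \<Longrightarrow>
          \<langle>e i, e j\<rangle>\<^bsub>L\<^esub> = (\<Oplus>\<^bsub>L\<^esub>s \<in> J. \<tau> i j s \<odot>\<^bsub>L\<^esub> e s)"
    and \<omega>_closed: "\<And>i j k s. i \<in> J \<Longrightarrow> j \<in> J \<Longrightarrow> k \<in> J \<Longrightarrow> s \<in> J \<Longrightarrow> \<omega> i j k s \<in> carrier K"
    and \<omega>: "\<And>i j k. i \<in> J \<Longrightarrow> j \<in> J \<Longrightarrow> k \<in> J \<Longrightarrow>
          \<lbrace>e i, e j, e k\<rbrace>\<^bsub>L\<^esub> = (\<Oplus>\<^bsub>L\<^esub>s \<in> J. \<omega> i j k s \<odot>\<^bsub>L\<^esub> e s)"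
    and c: "\<And>i. i \<in> J \<Longrightarrow> c i \<in> linear_maps K G alg_module"
    and c_bracket: "\<And>s a b. s \<in> J \<Longrightarrow> a \<in> carrier G \<Longrightarrow> b \<in> carrier G \<Longrightarrow>
      c s \<langle>a, b\<rangle>\<^bsub>G\<^esub> = (\<Oplus>\<^bsub>A\<^esub>q\<in>J \<times> J. h (case q of (i, j) \<Rightarrow> \<tau> i j s) \<otimes>\<^bsub>A\<^esub> (case q of (i, j) \<Rightarrow> c i a \<otimes>\<^bsub>A\<^esub> c j b))"
    and c_triple: "\<And>s a b d. s \<in> J \<Longrightarrow> a \<in> carrier G \<Longrightarrow> b \<in> carrier G \<Longrightarrow> d \<in> carrier G \<Longrightarrow>
      c s \<lbrace>a, b, d\<rbrace>\<^bsub>G\<^esub> = (\<Oplus>\<^bsub>A\<^esub>q\<in>J \<times> J \<times> J. h (case q of (i, j, k) \<Rightarrow> \<omega> i j k s) \<otimes>\<^bsub>A\<^esub>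
        (case q of (i, j, k) \<Rightarrow> c i a \<otimes>\<^bsub>A\<^esub> (c j b \<otimes>\<^bsub>A\<^esub> c k d)))"
begin

lemma maps: "bilinear_map K L U U \<rho>" "trilinear_map K L L U U D" "trilinear_map K L L U U \<theta>"
  using LM.maps by (simp_all add: ly_module_maps_def)

lemmas \<rho>_lin = bilinear_mapD[OF maps(1)]
lemmas D_lin = trilinear_mapD[OF maps(2)]
lemmas \<theta>_lin = trilinear_mapD[OF maps(3)]
lemmas bracket_L = bilinear_mapD[OF LM.L.bracket_bilinear]
lemmas triple_L = trilinear_mapD[OF LM.L.triple_trilinear]
lemmas bracket_G = bilinear_mapD[OF G.bracket_bilinear]
lemmas triple_G = trilinear_mapD[OF G.triple_trilinear]

lemma closed [simp]:
  "a \<in> carrier L \<Longrightarrow> u \<in> carrier U \<Longrightarrow> \<rho> a u \<in> carrier U"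
  "a \<in> carrier L \<Longrightarrow> b \<in> carrier L \<Longrightarrow> u \<in> carrier U \<Longrightarrow> D a b u \<in> carrier U"
  "a \<in> carrier L \<Longrightarrow> b \<in> carrier L \<Longrightarrow> u \<in> carrier U \<Longrightarrow> \<theta> a b u \<in> carrier U"
  "a \<in> carrier L \<Longrightarrow> b \<in> carrier L \<Longrightarrow> \<langle>a, b\<rangle>\<^bsub>L\<^esub> \<in> carrier L"
  "a \<in> carrier L \<Longrightarrow> b \<in> carrier L \<Longrightarrow> d \<in> carrier L \<Longrightarrow> \<lbrace>a, b, d\<rbrace>\<^bsub>L\<^esub> \<in> carrier L"
  "a' \<in> carrier G \<Longrightarrow> b' \<in> carrier G \<Longrightarrow> \<langle>a', b'\<rangle>\<^bsub>G\<^esub> \<in> carrier G"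
  "a' \<in> carrier G \<Longrightarrow> b' \<in> carrier G \<Longrightarrow> d' \<in> carrier G \<Longrightarrow> \<lbrace>a', b', d'\<rbrace>\<^bsub>G\<^esub> \<in> carrier G"
  "i \<in> J \<Longrightarrow> e i \<in> carrier L"
  "i \<in> J \<Longrightarrow> a' \<in> carrier G \<Longrightarrow> c i a' \<in> carrier A"
  using module_hom_in_carrier[OF \<rho>_lin(1)] module_hom_in_carrier[OF D_lin(1)] module_hom_in_carrier[OF \<theta>_lin(1)]
    module_hom_in_carrier[OF bracket_L(1)] module_hom_in_carrier[OF triple_L(1)]
    module_hom_in_carrier[OF bracket_G(1)] module_hom_in_carrier[OF triple_G(1)] e
    module_hom_in_carrier[OF c] by simp_all

lemma linear_expand:
  assumes \<phi>: "\<phi> \<in> linear_maps K L U" and k: "k \<in> J \<rightarrow> carrier K"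
  shows "(\<Oplus>\<^bsub>U\<^esub>j\<in>J. k j \<odot>\<^bsub>U\<^esub> \<phi> (e j)) = \<phi> (\<Oplus>\<^bsub>L\<^esub>j\<in>J. k j \<odot>\<^bsub>L\<^esub> e j)"
proof -
  have "\<phi> (\<Oplus>\<^bsub>L\<^esub>j\<in>J. k j \<odot>\<^bsub>L\<^esub> e j) = (\<Oplus>\<^bsub>U\<^esub>j\<in>J. \<phi> (k j \<odot>\<^bsub>L\<^esub> e j))"
    by (rule module_hom_finsum_eq[OF LM.L.module_axioms U.module_axioms \<phi>]) (use k in auto)
  also have "\<dots> = (\<Oplus>\<^bsub>U\<^esub>j\<in>J. k j \<odot>\<^bsub>U\<^esub> \<phi> (e j))"
    by (rule U.finsum_cong') (use k module_hom_in_carrier[OF \<phi>] in \<open>auto simp: Pi_iff LinearCombinations.module_hom_smult[OF \<phi>]\<close>)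
  finally show ?thesis ..
qed

text \<open>
  A linear function of the \<open>L\<close>-argument, summed against the coefficients of a bracket of \<open>G\<close>, becomes its
  value at the brackets of the \<open>e i\<close>. This is the point where the relations of the algebra are used.
\<close>

lemma contract_bracket:
  assumes P: "finite P" and \<phi>: "\<And>p. p \<in> P \<Longrightarrow> \<phi> p \<in> linear_maps K L U"
    and s: "\<And>p. p \<in> P \<Longrightarrow> s p \<in> carrier A" and ab: "a \<in> carrier G" "b \<in> carrier G" and w: "w \<in> carrier W"
  shows "tsum (P \<times> J) (\<lambda>(p, j). \<phi> p (e j)) (\<lambda>(p, j). s p \<otimes>\<^bsub>A\<^esub> c j \<langle>a, b\<rangle>\<^bsub>G\<^esub>) w =
    tsum (P \<times> (J \<times> J)) (\<lambda>(p, i, j). \<phi> p \<langle>e i, e j\<rangle>\<^bsub>L\<^esub>) (\<lambda>(p, i, j). s p \<otimes>\<^bsub>A\<^esub> (c i a \<otimes>\<^bsub>A\<^esub> c j b)) w"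
proof -
  note [simp] = module_hom_in_carrier[OF \<phi>]
  let ?s' = "\<lambda>q. case q of (i, j) \<Rightarrow> c i a \<otimes>\<^bsub>A\<^esub> c j b"
  let ?\<tau> = "\<lambda>q s. case q of (i, j) \<Rightarrow> \<tau> i j s"
  have "tsum (P \<times> J) (\<lambda>(p, j). \<phi> p (e j)) (\<lambda>(p, j). s p \<otimes>\<^bsub>A\<^esub> c j \<langle>a, b\<rangle>\<^bsub>G\<^esub>) w =
    tsum (P \<times> J) (\<lambda>(p, j). \<phi> p (e j)) (\<lambda>(p, j). s p \<otimes>\<^bsub>A\<^esub> (\<Oplus>\<^bsub>A\<^esub>q\<in>J \<times> J. h (?\<tau> q j) \<otimes>\<^bsub>A\<^esub> ?s' q)) w"
    by (rule tsum_cong) (use s ab w in \<open>auto simp: c_bracket \<tau>_closed intro!: W.R.finsum_closed\<close>)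
  also have "\<dots> = tsum (P \<times> (J \<times> J)) (\<lambda>(p, q). \<Oplus>\<^bsub>U\<^esub>j\<in>J. ?\<tau> q j \<odot>\<^bsub>U\<^esub> \<phi> p (e j)) (\<lambda>(p, q). s p \<otimes>\<^bsub>A\<^esub> ?s' q) w"
    by (rule tsum_contract) (use P J s ab w in \<open>auto simp: \<tau>_closed\<close>)
  also have "\<dots> = tsum (P \<times> (J \<times> J)) (\<lambda>(p, i, j). \<phi> p \<langle>e i, e j\<rangle>\<^bsub>L\<^esub>) (\<lambda>(p, i, j). s p \<otimes>\<^bsub>A\<^esub> (c i a \<otimes>\<^bsub>A\<^esub> c j b)) w"
    by (rule tsum_cong) (use s ab w in \<open>auto simp: linear_expand[OF \<phi>] \<tau>_closed \<tau>[symmetric]\<close>)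
  finally show ?thesis .
qed

text \<open>
  The same for the ternary operation.
\<close>

lemma contract_triple:
  assumes P: "finite P" and \<phi>: "\<And>p. p \<in> P \<Longrightarrow> \<phi> p \<in> linear_maps K L U"
    and s: "\<And>p. p \<in> P \<Longrightarrow> s p \<in> carrier A" and ab: "a \<in> carrier G" "b \<in> carrier G" "d \<in> carrier G" and w: "w \<in> carrier W"
  shows "tsum (P \<times> J) (\<lambda>(p, j). \<phi> p (e j)) (\<lambda>(p, j). s p \<otimes>\<^bsub>A\<^esub> c j \<lbrace>a, b, d\<rbrace>\<^bsub>G\<^esub>) w =
    tsum (P \<times> (J \<times> J \<times> J)) (\<lambda>(p, i, j, k). \<phi> p \<lbrace>e i, e j, e k\<rbrace>\<^bsub>L\<^esub>)
      (\<lambda>(p, i, j, k). s p \<otimes>\<^bsub>A\<^esub> (c i a \<otimes>\<^bsub>A\<^esub> (c j b \<otimes>\<^bsub>A\<^esub> c k d))) w"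
proof -
  note [simp] = module_hom_in_carrier[OF \<phi>]
  let ?s' = "\<lambda>q. case q of (i, j, k) \<Rightarrow> c i a \<otimes>\<^bsub>A\<^esub> (c j b \<otimes>\<^bsub>A\<^esub> c k d)"
  let ?\<tau> = "\<lambda>q s. case q of (i, j, k) \<Rightarrow> \<omega> i j k s"
  have "tsum (P \<times> J) (\<lambda>(p, j). \<phi> p (e j)) (\<lambda>(p, j). s p \<otimes>\<^bsub>A\<^esub> c j \<lbrace>a, b, d\<rbrace>\<^bsub>G\<^esub>) w =
    tsum (P \<times> J) (\<lambda>(p, j). \<phi> p (e j)) (\<lambda>(p, j). s p \<otimes>\<^bsub>A\<^esub> (\<Oplus>\<^bsub>A\<^esub>q\<in>J \<times> J \<times> J. h (?\<tau> q j) \<otimes>\<^bsub>A\<^esub> ?s' q)) w"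
    by (rule tsum_cong) (use s ab w in \<open>auto simp: c_triple \<omega>_closed intro!: W.R.finsum_closed\<close>)
  also have "\<dots> = tsum (P \<times> (J \<times> J \<times> J)) (\<lambda>(p, q). \<Oplus>\<^bsub>U\<^esub>j\<in>J. ?\<tau> q j \<odot>\<^bsub>U\<^esub> \<phi> p (e j)) (\<lambda>(p, q). s p \<otimes>\<^bsub>A\<^esub> ?s' q) w"
    by (rule tsum_contract) (use P J s ab w in \<open>auto simp: \<omega>_closed\<close>)
  also have "\<dots> = tsum (P \<times> (J \<times> J \<times> J)) (\<lambda>(p, i, j, k). \<phi> p \<lbrace>e i, e j, e k\<rbrace>\<^bsub>L\<^esub>)
      (\<lambda>(p, i, j, k). s p \<otimes>\<^bsub>A\<^esub> (c i a \<otimes>\<^bsub>A\<^esub> (c j b \<otimes>\<^bsub>A\<^esub> c k d))) w"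
    by (rule tsum_cong) (use s ab w in \<open>auto simp: linear_expand[OF \<phi>] \<omega>_closed \<omega>[symmetric]\<close>)
  finally show ?thesis .
qed

lemma contract_bracket1:
  assumes \<phi>: "\<phi> \<in> linear_maps K L U"
    and ab: "a \<in> carrier G" "b \<in> carrier G" and w: "w \<in> carrier W"
  shows "tsum J (\<lambda>j. \<phi> (e j)) (\<lambda>j. c j \<langle>a, b\<rangle>\<^bsub>G\<^esub>) w =
    tsum (J \<times> J) (\<lambda>(i, j). \<phi> \<langle>e i, e j\<rangle>\<^bsub>L\<^esub>) (\<lambda>(i, j). c i a \<otimes>\<^bsub>A\<^esub> c j b) w"
proof -
  note [simp] = module_hom_in_carrier[OF \<phi>] ab w
  \<comment> \<open>The bystander index of \<open>contract_bracket\<close> is taken from a one-element set.\<close>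
  have "tsum J (\<lambda>j. \<phi> (e j)) (\<lambda>j. c j \<langle>a, b\<rangle>\<^bsub>G\<^esub>) w =
    tsum ({()} \<times> J) (\<lambda>(p, j). \<phi> (e j)) (\<lambda>(p, j). \<one>\<^bsub>A\<^esub> \<otimes>\<^bsub>A\<^esub> c j \<langle>a, b\<rangle>\<^bsub>G\<^esub>) w"
    by (rule tsum_reindex[where k = snd and k' = "Pair ()"]) auto
  also have "\<dots> = tsum ({()} \<times> (J \<times> J)) (\<lambda>(p, i, j). \<phi> \<langle>e i, e j\<rangle>\<^bsub>L\<^esub>) (\<lambda>(p, i, j). \<one>\<^bsub>A\<^esub> \<otimes>\<^bsub>A\<^esub> (c i a \<otimes>\<^bsub>A\<^esub> c j b)) w"
    by (rule contract_bracket[where \<phi> = "\<lambda>p. \<phi>" and s = "\<lambda>p. \<one>\<^bsub>A\<^esub>"]) (auto simp: \<phi>)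
  also have "\<dots> = tsum (J \<times> J) (\<lambda>(i, j). \<phi> \<langle>e i, e j\<rangle>\<^bsub>L\<^esub>) (\<lambda>(i, j). c i a \<otimes>\<^bsub>A\<^esub> c j b) w"
    by (rule tsum_reindex[where k' = snd and k = "Pair ()"]) auto
  finally show ?thesis .
qed

lemma contract_triple1:
  assumes \<phi>: "\<phi> \<in> linear_maps K L U"
    and ab: "a \<in> carrier G" "b \<in> carrier G" "d \<in> carrier G" and w: "w \<in> carrier W"
  shows "tsum J (\<lambda>j. \<phi> (e j)) (\<lambda>j. c j \<lbrace>a, b, d\<rbrace>\<^bsub>G\<^esub>) w =
    tsum (J \<times> J \<times> J) (\<lambda>(i, j, k). \<phi> \<lbrace>e i, e j, e k\<rbrace>\<^bsub>L\<^esub>) (\<lambda>(i, j, k). c i a \<otimes>\<^bsub>A\<^esub> (c j b \<otimes>\<^bsub>A\<^esub> c k d)) w"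
proof -
  note [simp] = module_hom_in_carrier[OF \<phi>] ab w
  \<comment> \<open>The bystander index of \<open>contract_triple\<close> is taken from a one-element set.\<close>
  have "tsum J (\<lambda>j. \<phi> (e j)) (\<lambda>j. c j \<lbrace>a, b, d\<rbrace>\<^bsub>G\<^esub>) w =
    tsum ({()} \<times> J) (\<lambda>(p, j). \<phi> (e j)) (\<lambda>(p, j). \<one>\<^bsub>A\<^esub> \<otimes>\<^bsub>A\<^esub> c j \<lbrace>a, b, d\<rbrace>\<^bsub>G\<^esub>) w"
    by (rule tsum_reindex[where k = snd and k' = "Pair ()"]) auto
  also have "\<dots> = tsum ({()} \<times> (J \<times> J \<times> J)) (\<lambda>(p, i, j, k). \<phi> \<lbrace>e i, e j, e k\<rbrace>\<^bsub>L\<^esub>)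
      (\<lambda>(p, i, j, k). \<one>\<^bsub>A\<^esub> \<otimes>\<^bsub>A\<^esub> (c i a \<otimes>\<^bsub>A\<^esub> (c j b \<otimes>\<^bsub>A\<^esub> c k d))) w"
    by (rule contract_triple[where \<phi> = "\<lambda>p. \<phi>" and s = "\<lambda>p. \<one>\<^bsub>A\<^esub>"]) (auto simp: \<phi>)
  also have "\<dots> = tsum (J \<times> J \<times> J) (\<lambda>(i, j, k). \<phi> \<lbrace>e i, e j, e k\<rbrace>\<^bsub>L\<^esub>) (\<lambda>(i, j, k). c i a \<otimes>\<^bsub>A\<^esub> (c j b \<otimes>\<^bsub>A\<^esub> c k d)) w"
    by (rule tsum_reindex[where k' = snd and k = "Pair ()"]) auto
  finally show ?thesis .
qed

lemma J2: "finite (J \<times> J)" using J by simp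

context
  fixes \<rho>\<^sub>T :: "'g \<Rightarrow> ('u \<times> 'w \<Rightarrow> 'k) set \<Rightarrow> ('u \<times> 'w \<Rightarrow> 'k) set" and D\<^sub>T \<theta>\<^sub>T
  assumes rep_\<rho>: "\<And>a. a \<in> carrier G \<Longrightarrow> represents (\<rho>\<^sub>T a) J (\<lambda>i. \<rho> (e i)) (\<lambda>i. c i a)"
    and rep_D: "\<And>a b. a \<in> carrier G \<Longrightarrow> b \<in> carrier G \<Longrightarrow>
      represents (D\<^sub>T a b) (J \<times> J) (\<lambda>(i, j). D (e i) (e j)) (\<lambda>(i, j). c i a \<otimes>\<^bsub>A\<^esub> c j b)"
    and rep_\<theta>: "\<And>a b. a \<in> carrier G \<Longrightarrow> b \<in> carrier G \<Longrightarrow>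
      represents (\<theta>\<^sub>T a b) (J \<times> J) (\<lambda>(i, j). \<theta> (e i) (e j)) (\<lambda>(i, j). c i a \<otimes>\<^bsub>A\<^esub> c j b)"
begin

lemma lin_T:
  "a \<in> carrier G \<Longrightarrow> \<rho>\<^sub>T a \<in> linear_maps K T T"
  "a \<in> carrier G \<Longrightarrow> b \<in> carrier G \<Longrightarrow> D\<^sub>T a b \<in> linear_maps K T T"
  "a \<in> carrier G \<Longrightarrow> b \<in> carrier G \<Longrightarrow> \<theta>\<^sub>T a b \<in> linear_maps K T T"
  using rep_\<rho> rep_D rep_\<theta> by (simp_all add: represents_def)

lemmas lin_intros = module_hom_plus[OF tp.T.module_axioms] module_hom_diff[OF tp.T.module_axioms]
  module_hom_zero[OF tp.T.module_axioms] lin_T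
  module_hom_comp[OF lin_T(1) lin_T(1)] module_hom_comp[OF lin_T(1) lin_T(2)] module_hom_comp[OF lin_T(1) lin_T(3)]
  module_hom_comp[OF lin_T(2) lin_T(1)] module_hom_comp[OF lin_T(2) lin_T(2)] module_hom_comp[OF lin_T(2) lin_T(3)]
  module_hom_comp[OF lin_T(3) lin_T(1)] module_hom_comp[OF lin_T(3) lin_T(2)] module_hom_comp[OF lin_T(3) lin_T(3)]

lemma eval_T:
  assumes "u \<in> carrier U" "w \<in> carrier W"
  shows "a \<in> carrier G \<Longrightarrow> \<rho>\<^sub>T a (t u w) = tsum J (\<lambda>i. \<rho> (e i) u) (\<lambda>i. c i a) w"
    "a \<in> carrier G \<Longrightarrow> b \<in> carrier G \<Longrightarrow>
      D\<^sub>T a b (t u w) = tsum (J \<times> J) (\<lambda>(i, j). D (e i) (e j) u) (\<lambda>(i, j). c i a \<otimes>\<^bsub>A\<^esub> c j b) w"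
    "a \<in> carrier G \<Longrightarrow> b \<in> carrier G \<Longrightarrow>
      \<theta>\<^sub>T a b (t u w) = tsum (J \<times> J) (\<lambda>(i, j). \<theta> (e i) (e j) u) (\<lambda>(i, j). c i a \<otimes>\<^bsub>A\<^esub> c j b) w"
  using rep_\<rho>[of a] rep_D[of a b] rep_\<theta>[of a b] assms by (simp_all add: represents_def case_prod_unfold)


context
  fixes u w
  assumes u [simp]: "u \<in> carrier U" and w [simp]: "w \<in> carrier W"
begin

lemma bracket_T:
  assumes [simp]: "a \<in> carrier G" "b \<in> carrier G" "d \<in> carrier G"
  shows "\<rho>\<^sub>T \<langle>a, b\<rangle>\<^bsub>G\<^esub> (t u w) =
      tsum (J \<times> J) (\<lambda>(i, j). \<rho> \<langle>e i, e j\<rangle>\<^bsub>L\<^esub> u) (\<lambda>(i, j). c i a \<otimes>\<^bsub>A\<^esub> c j b) w" (is ?rho)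
    and "\<theta>\<^sub>T a \<langle>b, d\<rangle>\<^bsub>G\<^esub> (t u w) =
      tsum (J \<times> J \<times> J) (\<lambda>(i, j, k). \<theta> (e i) \<langle>e j, e k\<rangle>\<^bsub>L\<^esub> u) (\<lambda>(i, j, k). c i a \<otimes>\<^bsub>A\<^esub> (c j b \<otimes>\<^bsub>A\<^esub> c k d)) w" (is ?right)
    and "\<theta>\<^sub>T \<langle>a, b\<rangle>\<^bsub>G\<^esub> d (t u w) =
      tsum (J \<times> J \<times> J) (\<lambda>(i, j, k). \<theta> \<langle>e i, e j\<rangle>\<^bsub>L\<^esub> (e k) u) (\<lambda>(i, j, k). c i a \<otimes>\<^bsub>A\<^esub> (c j b \<otimes>\<^bsub>A\<^esub> c k d)) w" (is ?left)
proof -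
  show ?rho unfolding eval_T(1)[OF u w closed(6)[OF assms(1,2)]]
    by (rule contract_bracket1[where \<phi> = "\<lambda>l. \<rho> l u"]) (auto intro: \<rho>_lin(2))
  show ?right unfolding eval_T(3)[OF u w assms(1) closed(6)[OF assms(2,3)]]
    by (rule contract_bracket[where \<phi> = "\<lambda>i l. \<theta> (e i) l u" and s = "\<lambda>i. c i a", OF J])
      (auto intro: \<theta>_lin(2))
  have "\<theta>\<^sub>T \<langle>a, b\<rangle>\<^bsub>G\<^esub> d (t u w) =
      tsum (J \<times> J) (\<lambda>(k, s). \<theta> (e s) (e k) u) (\<lambda>(k, s). c k d \<otimes>\<^bsub>A\<^esub> c s \<langle>a, b\<rangle>\<^bsub>G\<^esub>) w"
    unfolding eval_T(3)[OF u w closed(6)[OF assms(1,2)] assms(3)]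
    by (rule tsum_reindex[where k = prod.swap and k' = prod.swap]) (auto simp: W.R.m_comm)
  also have "\<dots> = tsum (J \<times> (J \<times> J)) (\<lambda>(k, i, j). \<theta> \<langle>e i, e j\<rangle>\<^bsub>L\<^esub> (e k) u)
      (\<lambda>(k, i, j). c k d \<otimes>\<^bsub>A\<^esub> (c i a \<otimes>\<^bsub>A\<^esub> c j b)) w"
    by (rule contract_bracket[where \<phi> = "\<lambda>k l. \<theta> l (e k) u" and s = "\<lambda>k. c k d", OF J])
      (auto intro: \<theta>_lin(3))
  also have "\<dots> = tsum (J \<times> J \<times> J) (\<lambda>(i, j, k). \<theta> \<langle>e i, e j\<rangle>\<^bsub>L\<^esub> (e k) u) (\<lambda>(i, j, k). c i a \<otimes>\<^bsub>A\<^esub> (c j b \<otimes>\<^bsub>A\<^esub> c k d)) w"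
    by (rule tsum_reindex[where k = "\<lambda>(i, j, k). (k, i, j)" and k' = "\<lambda>(k, i, j). (i, j, k)"])
      (auto simp: W.R.m_ac)
  finally show ?left .
qed

lemma triple_T:
  assumes [simp]: "a \<in> carrier G" "b \<in> carrier G" "d \<in> carrier G" "g \<in> carrier G"
  shows "\<rho>\<^sub>T \<lbrace>a, b, d\<rbrace>\<^bsub>G\<^esub> (t u w) =
      tsum (J \<times> J \<times> J) (\<lambda>(i, j, k). \<rho> \<lbrace>e i, e j, e k\<rbrace>\<^bsub>L\<^esub> u) (\<lambda>(i, j, k). c i a \<otimes>\<^bsub>A\<^esub> (c j b \<otimes>\<^bsub>A\<^esub> c k d)) w" (is ?rho)
    and "\<theta>\<^sub>T a \<lbrace>b, d, g\<rbrace>\<^bsub>G\<^esub> (t u w) =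
      tsum (J \<times> J \<times> J \<times> J) (\<lambda>(i, j, k, l). \<theta> (e i) \<lbrace>e j, e k, e l\<rbrace>\<^bsub>L\<^esub> u)
        (\<lambda>(i, j, k, l). c i a \<otimes>\<^bsub>A\<^esub> (c j b \<otimes>\<^bsub>A\<^esub> (c k d \<otimes>\<^bsub>A\<^esub> c l g))) w" (is ?right)
    and "\<theta>\<^sub>T \<lbrace>a, b, d\<rbrace>\<^bsub>G\<^esub> g (t u w) =
      tsum (J \<times> J \<times> J \<times> J) (\<lambda>(i, j, k, l). \<theta> \<lbrace>e i, e j, e k\<rbrace>\<^bsub>L\<^esub> (e l) u)
        (\<lambda>(i, j, k, l). c i a \<otimes>\<^bsub>A\<^esub> (c j b \<otimes>\<^bsub>A\<^esub> (c k d \<otimes>\<^bsub>A\<^esub> c l g))) w" (is ?left)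
proof -
  show ?rho unfolding eval_T(1)[OF u w closed(7)[OF assms(1-3)]]
    by (rule contract_triple1[where \<phi> = "\<lambda>l. \<rho> l u"]) (auto intro: \<rho>_lin(2))
  show ?right unfolding eval_T(3)[OF u w assms(1) closed(7)[OF assms(2-4)]]
    by (rule contract_triple[where \<phi> = "\<lambda>i l. \<theta> (e i) l u" and s = "\<lambda>i. c i a", OF J])
      (auto intro: \<theta>_lin(2))
  have "\<theta>\<^sub>T \<lbrace>a, b, d\<rbrace>\<^bsub>G\<^esub> g (t u w) =
      tsum (J \<times> J) (\<lambda>(l, s). \<theta> (e s) (e l) u) (\<lambda>(l, s). c l g \<otimes>\<^bsub>A\<^esub> c s \<lbrace>a, b, d\<rbrace>\<^bsub>G\<^esub>) w"
    unfolding eval_T(3)[OF u w closed(7)[OF assms(1-3)] assms(4)]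
    by (rule tsum_reindex[where k = prod.swap and k' = prod.swap]) (auto simp: W.R.m_comm)
  also have "\<dots> = tsum (J \<times> (J \<times> J \<times> J)) (\<lambda>(l, i, j, k). \<theta> \<lbrace>e i, e j, e k\<rbrace>\<^bsub>L\<^esub> (e l) u)
      (\<lambda>(l, i, j, k). c l g \<otimes>\<^bsub>A\<^esub> (c i a \<otimes>\<^bsub>A\<^esub> (c j b \<otimes>\<^bsub>A\<^esub> c k d))) w"
    by (rule contract_triple[where \<phi> = "\<lambda>k l. \<theta> l (e k) u" and s = "\<lambda>k. c k g", OF J])
      (auto intro: \<theta>_lin(3))
  also have "\<dots> = tsum (J \<times> J \<times> J \<times> J) (\<lambda>(i, j, k, l). \<theta> \<lbrace>e i, e j, e k\<rbrace>\<^bsub>L\<^esub> (e l) u)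
        (\<lambda>(i, j, k, l). c i a \<otimes>\<^bsub>A\<^esub> (c j b \<otimes>\<^bsub>A\<^esub> (c k d \<otimes>\<^bsub>A\<^esub> c l g))) w"
    by (rule tsum_reindex[where k = "\<lambda>(i, j, k, l). (l, i, j, k)" and k' = "\<lambda>(l, i, j, k). (i, j, k, l)"])
      (auto simp: W.R.m_ac)
  finally show ?left .
qed

text \<open>
  The identities at a pure tensor. In each of them all terms become sums over the same tuples of
  indices with the same coefficients, and the identity in \<open>U\<close> at the corresponding \<open>e i\<close> applies to
  every summand.
\<close>

lemma pure_R1:
  assumes ab [simp]: "a \<in> carrier G" "b \<in> carrier G"
  shows "D\<^sub>T a b (t u w) \<oplus>\<^bsub>T\<^esub> \<theta>\<^sub>T a b (t u w) \<ominus>\<^bsub>T\<^esub> \<theta>\<^sub>T b a (t u w)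
        = (\<rho>\<^sub>T a (\<rho>\<^sub>T b (t u w)) \<ominus>\<^bsub>T\<^esub> \<rho>\<^sub>T b (\<rho>\<^sub>T a (t u w))) \<ominus>\<^bsub>T\<^esub> \<rho>\<^sub>T \<langle>a, b\<rangle>\<^bsub>G\<^esub> (t u w)"
proof -
  let ?Q = "J \<times> J" and ?s = "\<lambda>(i, j). c i a \<otimes>\<^bsub>A\<^esub> c j b"
  have 1: "\<theta>\<^sub>T b a (t u w) = tsum ?Q (\<lambda>(i, j). \<theta> (e j) (e i) u) ?s w"
    unfolding eval_T(3)[OF u w ab(2,1)]
    by (rule tsum_reindex[where k = prod.swap and k' = prod.swap]) (auto simp: W.R.m_comm)
  have 2: "\<rho>\<^sub>T a (\<rho>\<^sub>T b (t u w)) = tsum ?Q (\<lambda>(i, j). \<rho> (e i) (\<rho> (e j) u)) ?s w"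
    by (rule compose_reindex[OF rep_\<rho> rep_\<rho>, where k = id and k' = id]) auto
  have 3: "\<rho>\<^sub>T b (\<rho>\<^sub>T a (t u w)) = tsum ?Q (\<lambda>(i, j). \<rho> (e j) (\<rho> (e i) u)) ?s w"
    by (rule compose_reindex[OF rep_\<rho> rep_\<rho>, where k = prod.swap and k' = prod.swap])
      (auto simp: W.R.m_comm)
  show ?thesis
    unfolding 1 2 3 bracket_T(1)[OF ab ab(1)] eval_T(2,3)[OF u w ab]
    by (simp add: tsum_add tsum_diff Pi_iff) (rule tsum_cong, auto simp: LM.R1)
qed

lemma pure_R2:
  assumes G [simp]: "a \<in> carrier G" "b \<in> carrier G" "d \<in> carrier G"
  shows "\<theta>\<^sub>T a \<langle>b, d\<rangle>\<^bsub>G\<^esub> (t u w) \<ominus>\<^bsub>T\<^esub> \<rho>\<^sub>T b (\<theta>\<^sub>T a d (t u w)) \<oplus>\<^bsub>T\<^esub> \<rho>\<^sub>T d (\<theta>\<^sub>T a b (t u w)) = \<zero>\<^bsub>T\<^esub>"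
proof -
  let ?Q = "J \<times> J \<times> J" and ?s = "\<lambda>(i, j, k). c i a \<otimes>\<^bsub>A\<^esub> (c j b \<otimes>\<^bsub>A\<^esub> c k d)"
  have 1: "\<rho>\<^sub>T b (\<theta>\<^sub>T a d (t u w)) = tsum ?Q (\<lambda>(i, j, k). \<rho> (e j) (\<theta> (e i) (e k) u)) ?s w"
    by (rule compose_reindex[OF rep_\<rho> rep_\<theta>, where k = "\<lambda>(i, j, k). (j, i, k)" and k' = "\<lambda>(j, i, k). (i, j, k)"])
      (auto simp: W.R.m_ac)
  have 2: "\<rho>\<^sub>T d (\<theta>\<^sub>T a b (t u w)) = tsum ?Q (\<lambda>(i, j, k). \<rho> (e k) (\<theta> (e i) (e j) u)) ?s w"
    by (rule compose_reindex[OF rep_\<rho> rep_\<theta>, where k = "\<lambda>(i, j, k). (k, i, j)" and k' = "\<lambda>(k, i, j). (i, j, k)"])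
      (auto simp: W.R.m_ac)
  show ?thesis
    unfolding 1 2 bracket_T(2)[OF G]
    by (simp add: tsum_add tsum_diff Pi_iff) (rule tsum_zero, auto simp: LM.R2)
qed

lemma pure_R3:
  assumes G [simp]: "a \<in> carrier G" "b \<in> carrier G" "d \<in> carrier G"
  shows "\<theta>\<^sub>T \<langle>a, b\<rangle>\<^bsub>G\<^esub> d (t u w) \<ominus>\<^bsub>T\<^esub> \<theta>\<^sub>T a d (\<rho>\<^sub>T b (t u w)) \<oplus>\<^bsub>T\<^esub> \<theta>\<^sub>T b d (\<rho>\<^sub>T a (t u w)) = \<zero>\<^bsub>T\<^esub>"
proof -
  let ?Q = "J \<times> J \<times> J" and ?s = "\<lambda>(i, j, k). c i a \<otimes>\<^bsub>A\<^esub> (c j b \<otimes>\<^bsub>A\<^esub> c k d)"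
  have 1: "\<theta>\<^sub>T a d (\<rho>\<^sub>T b (t u w)) = tsum ?Q (\<lambda>(i, j, k). \<theta> (e i) (e k) (\<rho> (e j) u)) ?s w"
    by (rule compose_reindex[OF rep_\<theta> rep_\<rho>, where k = "\<lambda>(i, j, k). ((i, k), j)" and k' = "\<lambda>((i, k), j). (i, j, k)"])
      (auto simp: W.R.m_ac)
  have 2: "\<theta>\<^sub>T b d (\<rho>\<^sub>T a (t u w)) = tsum ?Q (\<lambda>(i, j, k). \<theta> (e j) (e k) (\<rho> (e i) u)) ?s w"
    by (rule compose_reindex[OF rep_\<theta> rep_\<rho>, where k = "\<lambda>(i, j, k). ((j, k), i)" and k' = "\<lambda>((j, k), i). (i, j, k)"])
      (auto simp: W.R.m_ac)
  show ?thesis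
    unfolding 1 2 bracket_T(3)[OF G]
    by (simp add: tsum_add tsum_diff Pi_iff) (rule tsum_zero, auto simp: LM.R3)
qed

lemma pure_R4:
  assumes G [simp]: "a \<in> carrier G" "b \<in> carrier G" "d \<in> carrier G" "g \<in> carrier G"
  shows "\<theta>\<^sub>T d g (\<theta>\<^sub>T a b (t u w)) \<ominus>\<^bsub>T\<^esub> \<theta>\<^sub>T b g (\<theta>\<^sub>T a d (t u w)) \<ominus>\<^bsub>T\<^esub> \<theta>\<^sub>T a \<lbrace>b, d, g\<rbrace>\<^bsub>G\<^esub> (t u w)
    \<oplus>\<^bsub>T\<^esub> D\<^sub>T b d (\<theta>\<^sub>T a g (t u w)) = \<zero>\<^bsub>T\<^esub>"
proof -
  let ?Q = "J \<times> J \<times> J \<times> J"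
    and ?s = "\<lambda>(i, j, k, l). c i a \<otimes>\<^bsub>A\<^esub> (c j b \<otimes>\<^bsub>A\<^esub> (c k d \<otimes>\<^bsub>A\<^esub> c l g))"
  have 1: "\<theta>\<^sub>T d g (\<theta>\<^sub>T a b (t u w)) = tsum ?Q (\<lambda>(i, j, k, l). \<theta> (e k) (e l) (\<theta> (e i) (e j) u)) ?s w"
    by (rule compose_reindex[OF rep_\<theta> rep_\<theta>, where k = "\<lambda>(i, j, k, l). ((k, l), (i, j))" and k' = "\<lambda>((k, l), (i, j)). (i, j, k, l)"])
      (auto simp: W.R.m_ac)
  have 2: "\<theta>\<^sub>T b g (\<theta>\<^sub>T a d (t u w)) = tsum ?Q (\<lambda>(i, j, k, l). \<theta> (e j) (e l) (\<theta> (e i) (e k) u)) ?s w"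
    by (rule compose_reindex[OF rep_\<theta> rep_\<theta>, where k = "\<lambda>(i, j, k, l). ((j, l), (i, k))" and k' = "\<lambda>((j, l), (i, k)). (i, j, k, l)"])
      (auto simp: W.R.m_ac)
  have 3: "D\<^sub>T b d (\<theta>\<^sub>T a g (t u w)) = tsum ?Q (\<lambda>(i, j, k, l). D (e j) (e k) (\<theta> (e i) (e l) u)) ?s w"
    by (rule compose_reindex[OF rep_D rep_\<theta>, where k = "\<lambda>(i, j, k, l). ((j, k), (i, l))" and k' = "\<lambda>((j, k), (i, l)). (i, j, k, l)"])
      (auto simp: W.R.m_ac)
  show ?thesis
    unfolding 1 2 3 triple_T(2)[OF G]
    by (simp add: tsum_add tsum_diff Pi_iff) (rule tsum_zero, auto simp: LM.R4)
qed

lemma pure_R5: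
  assumes G [simp]: "a \<in> carrier G" "b \<in> carrier G" "d \<in> carrier G"
  shows "D\<^sub>T a b (\<rho>\<^sub>T d (t u w)) \<ominus>\<^bsub>T\<^esub> \<rho>\<^sub>T d (D\<^sub>T a b (t u w)) = \<rho>\<^sub>T \<lbrace>a, b, d\<rbrace>\<^bsub>G\<^esub> (t u w)"
proof -
  let ?Q = "J \<times> J \<times> J" and ?s = "\<lambda>(i, j, k). c i a \<otimes>\<^bsub>A\<^esub> (c j b \<otimes>\<^bsub>A\<^esub> c k d)"
  have 1: "D\<^sub>T a b (\<rho>\<^sub>T d (t u w)) = tsum ?Q (\<lambda>(i, j, k). D (e i) (e j) (\<rho> (e k) u)) ?s w"
    by (rule compose_reindex[OF rep_D rep_\<rho>, where k = "\<lambda>(i, j, k). ((i, j), k)" and k' = "\<lambda>((i, j), k). (i, j, k)"])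
      (auto simp: W.R.m_ac)
  have 2: "\<rho>\<^sub>T d (D\<^sub>T a b (t u w)) = tsum ?Q (\<lambda>(i, j, k). \<rho> (e k) (D (e i) (e j) u)) ?s w"
    by (rule compose_reindex[OF rep_\<rho> rep_D, where k = "\<lambda>(i, j, k). (k, i, j)" and k' = "\<lambda>(k, i, j). (i, j, k)"])
      (auto simp: W.R.m_ac)
  show ?thesis
    unfolding 1 2 triple_T(1)[OF G G(1)]
    by (simp add: tsum_add tsum_diff Pi_iff) (rule tsum_cong, auto simp: LM.R5)
qed

lemma pure_R6:
  assumes G [simp]: "a \<in> carrier G" "b \<in> carrier G" "d \<in> carrier G" "g \<in> carrier G"
  shows "D\<^sub>T a b (\<theta>\<^sub>T d g (t u w)) \<ominus>\<^bsub>T\<^esub> \<theta>\<^sub>T d g (D\<^sub>T a b (t u w)) =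
    \<theta>\<^sub>T \<lbrace>a, b, d\<rbrace>\<^bsub>G\<^esub> g (t u w) \<oplus>\<^bsub>T\<^esub> \<theta>\<^sub>T d \<lbrace>a, b, g\<rbrace>\<^bsub>G\<^esub> (t u w)"
proof -
  let ?Q = "J \<times> J \<times> J \<times> J"
    and ?s = "\<lambda>(i, j, k, l). c i a \<otimes>\<^bsub>A\<^esub> (c j b \<otimes>\<^bsub>A\<^esub> (c k d \<otimes>\<^bsub>A\<^esub> c l g))"
  have 1: "D\<^sub>T a b (\<theta>\<^sub>T d g (t u w)) = tsum ?Q (\<lambda>(i, j, k, l). D (e i) (e j) (\<theta> (e k) (e l) u)) ?s w"
    by (rule compose_reindex[OF rep_D rep_\<theta>, where k = "\<lambda>(i, j, k, l). ((i, j), (k, l))" and k' = "\<lambda>((i, j), (k, l)). (i, j, k, l)"])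
      (auto simp: W.R.m_ac)
  have 2: "\<theta>\<^sub>T d g (D\<^sub>T a b (t u w)) = tsum ?Q (\<lambda>(i, j, k, l). \<theta> (e k) (e l) (D (e i) (e j) u)) ?s w"
    by (rule compose_reindex[OF rep_\<theta> rep_D, where k = "\<lambda>(i, j, k, l). ((k, l), (i, j))" and k' = "\<lambda>((k, l), (i, j)). (i, j, k, l)"])
      (auto simp: W.R.m_ac)
  have 3: "\<theta>\<^sub>T d \<lbrace>a, b, g\<rbrace>\<^bsub>G\<^esub> (t u w) = tsum ?Q (\<lambda>(i, j, k, l). \<theta> (e k) \<lbrace>e i, e j, e l\<rbrace>\<^bsub>L\<^esub> u) ?s w"
    unfolding triple_T(2)[OF G(3,1,2,4)]
    by (rule tsum_reindex[where k = "\<lambda>(i, j, k, l). (k, i, j, l)" and k' = "\<lambda>(k, i, j, l). (i, j, k, l)"])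
      (auto simp: W.R.m_ac)
  show ?thesis
    unfolding 1 2 3 triple_T(3)[OF G]
    by (simp add: tsum_add tsum_diff Pi_iff) (rule tsum_cong, auto simp: LM.R6)
qed

end

text \<open>
  Both sides of each identity are linear in the vector, so the identities extend from the pure
  tensors to the whole tensor product.
\<close>

lemma ly_module_of_representing:
  assumes maps_T: "ly_module_maps K G T \<rho>\<^sub>T D\<^sub>T \<theta>\<^sub>T"
  shows "ly_module K G T \<rho>\<^sub>T D\<^sub>T \<theta>\<^sub>T"
proof (intro ly_module.intro ly_module_axioms.intro)
  show "lie_yamaguti K G" by (rule G.lie_yamaguti_axioms)
  show "vectorspace K T"
    by (intro vectorspace.intro tp.T.module_axioms LM.L.field_axioms)
  show "ly_module_maps K G T \<rho>\<^sub>T D\<^sub>T \<theta>\<^sub>T" by (rule maps_T)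
  note eqI = tp.tensor_hom_eqI[OF tp.T.module_axioms, unfolded restrict_scalars_simps]
  fix a b v assume ab: "a \<in> carrier G" "b \<in> carrier G" and v: "v \<in> carrier T"
  show "D\<^sub>T a b v \<oplus>\<^bsub>T\<^esub> \<theta>\<^sub>T a b v \<ominus>\<^bsub>T\<^esub> \<theta>\<^sub>T b a v
        = (\<rho>\<^sub>T a (\<rho>\<^sub>T b v) \<ominus>\<^bsub>T\<^esub> \<rho>\<^sub>T b (\<rho>\<^sub>T a v)) \<ominus>\<^bsub>T\<^esub> \<rho>\<^sub>T \<langle>a, b\<rangle>\<^bsub>G\<^esub> v"
    by (rule eqI[OF _ _ _ v]) (rule pure_R1[OF _ _ ab]; assumption | intro lin_intros closed ab)+
  fix d assume d: "d \<in> carrier G"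
  show "\<theta>\<^sub>T a \<langle>b, d\<rangle>\<^bsub>G\<^esub> v \<ominus>\<^bsub>T\<^esub> \<rho>\<^sub>T b (\<theta>\<^sub>T a d v) \<oplus>\<^bsub>T\<^esub> \<rho>\<^sub>T d (\<theta>\<^sub>T a b v) = \<zero>\<^bsub>T\<^esub>"
    by (rule eqI[OF _ _ _ v]) (rule pure_R2[OF _ _ ab d]; assumption | intro lin_intros closed ab d)+
  show "\<theta>\<^sub>T \<langle>a, b\<rangle>\<^bsub>G\<^esub> d v \<ominus>\<^bsub>T\<^esub> \<theta>\<^sub>T a d (\<rho>\<^sub>T b v) \<oplus>\<^bsub>T\<^esub> \<theta>\<^sub>T b d (\<rho>\<^sub>T a v) = \<zero>\<^bsub>T\<^esub>"
    by (rule eqI[OF _ _ _ v]) (rule pure_R3[OF _ _ ab d]; assumption | intro lin_intros closed ab d)+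
  show "D\<^sub>T a b (\<rho>\<^sub>T d v) \<ominus>\<^bsub>T\<^esub> \<rho>\<^sub>T d (D\<^sub>T a b v) = \<rho>\<^sub>T \<lbrace>a, b, d\<rbrace>\<^bsub>G\<^esub> v"
    by (rule eqI[OF _ _ _ v]) (rule pure_R5[OF _ _ ab d]; assumption | intro lin_intros closed ab d)+
  fix g assume g: "g \<in> carrier G"
  show "\<theta>\<^sub>T d g (\<theta>\<^sub>T a b v) \<ominus>\<^bsub>T\<^esub> \<theta>\<^sub>T b g (\<theta>\<^sub>T a d v) \<ominus>\<^bsub>T\<^esub> \<theta>\<^sub>T a \<lbrace>b, d, g\<rbrace>\<^bsub>G\<^esub> v
    \<oplus>\<^bsub>T\<^esub> D\<^sub>T b d (\<theta>\<^sub>T a g v) = \<zero>\<^bsub>T\<^esub>"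
    by (rule eqI[OF _ _ _ v]) (rule pure_R4[OF _ _ ab d g]; assumption | intro lin_intros closed ab d g)+
  show "D\<^sub>T a b (\<theta>\<^sub>T d g v) \<ominus>\<^bsub>T\<^esub> \<theta>\<^sub>T d g (D\<^sub>T a b v) =
    \<theta>\<^sub>T \<lbrace>a, b, d\<rbrace>\<^bsub>G\<^esub> g v \<oplus>\<^bsub>T\<^esub> \<theta>\<^sub>T d \<lbrace>a, b, g\<rbrace>\<^bsub>G\<^esub> v"
    by (rule eqI[OF _ _ _ v]) (rule pure_R6[OF _ _ ab d g]; assumption | intro lin_intros closed ab d g)+
qed

end

end

section \<open>Existence and uniqueness of the module maps\<close>

lemma trilinear_mapI:
  assumes "\<And>x y. x \<in> carrier V1 \<Longrightarrow> y \<in> carrier V2 \<Longrightarrow> f x y \<in> linear_maps K V3 V"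
    "\<And>x z. x \<in> carrier V1 \<Longrightarrow> z \<in> carrier V3 \<Longrightarrow> (\<lambda>y. f x y z) \<in> linear_maps K V2 V"
    "\<And>y z. y \<in> carrier V2 \<Longrightarrow> z \<in> carrier V3 \<Longrightarrow> (\<lambda>x. f x y z) \<in> linear_maps K V1 V"
  shows "trilinear_map K V1 V2 V3 V f"
  using assms by (simp add: trilinear_map_def)

lemma basis_bilinear_eqI:
  assumes V: "vectorspace K V" and b: "indexed_basis K V I b" and Z: "Module.module K Z"
    and f: "bilinear_map K V V Z f" and g: "bilinear_map K V V Z g"
    and eq: "\<And>i j. i \<in> I \<Longrightarrow> j \<in> I \<Longrightarrow> f (b i) (b j) = g (b i) (b j)"
    and v: "v \<in> carrier V" and w: "w \<in> carrier V"
  shows "f v w = g v w"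
proof (rule basis_hom_eqI[OF V b Z bilinear_mapD(1)[OF f v] bilinear_mapD(1)[OF g v] _ w])
  have bc: "b i \<in> carrier V" if "i \<in> I" for i using indexed_basisE(2)[OF V b] that by auto
  fix j assume j: "j \<in> I"
  show "f v (b j) = g v (b j)"
    by (rule basis_hom_eqI[OF V b Z bilinear_mapD(2)[OF f bc[OF j]] bilinear_mapD(2)[OF g bc[OF j]] _ v])
      (rule eq[OF _ j])
qed

lemma basis_trilinear_eqI:
  assumes V: "vectorspace K V" and b: "indexed_basis K V I b" and Z: "Module.module K Z"
    and f: "trilinear_map K V V V Z f" and g: "trilinear_map K V V V Z g"
    and eq: "\<And>i j k. i \<in> I \<Longrightarrow> j \<in> I \<Longrightarrow> k \<in> I \<Longrightarrow> f (b i) (b j) (b k) = g (b i) (b j) (b k)"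
    and v: "v \<in> carrier V" and w: "w \<in> carrier V" and x: "x \<in> carrier V"
  shows "f v w x = g v w x"
proof (rule basis_bilinear_eqI[OF V b Z _ _ _ w x])
  have bc: "b i \<in> carrier V" if "i \<in> I" for i using indexed_basisE(2)[OF V b] that by auto
  show "bilinear_map K V V Z (f v)" "bilinear_map K V V Z (g v)"
    using trilinear_mapD(1,2)[OF f] trilinear_mapD(1,2)[OF g] v by (simp_all add: bilinear_map_def)
  fix j k assume jk: "j \<in> I" "k \<in> I"
  show "f v (b j) (b k) = g v (b j) (b k)"
    by (rule basis_hom_eqI[OF V b Z trilinear_mapD(3)[OF f bc[OF jk(1)] bc[OF jk(2)]]
        trilinear_mapD(3)[OF g bc[OF jk(1)] bc[OF jk(2)]] _ v])
      (rule eq[OF _ jk])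
qed

context tensor_action
begin

lemma representing_family_linear:
  assumes rep: "\<And>g. g \<in> carrier V \<Longrightarrow> represents (f g) Q F (s g)"
    and s: "\<And>q. q \<in> Q \<Longrightarrow> (\<lambda>g. s g q) \<in> linear_maps K V alg_module"
    and V: "Module.module K V" and v: "v \<in> carrier T"
  shows "(\<lambda>g. f g v) \<in> linear_maps K V T"
proof -
  interpret V: Module.module K V by fact
  note eqI = tp.tensor_hom_eqI[OF tp.T.module_axioms _ _ _ v, unfolded restrict_scalars_simps]
  note lin = representsD(2)[OF rep]
  have ts: "(\<lambda>g. tsum Q (\<lambda>q. F q u) (s g) w) \<in> linear_maps K V T"
    if "u \<in> carrier U" "w \<in> carrier W" for u w
    using module_hom_in_carrier[OF representsD(3)[OF rep[OF V.zero_closed]] that(1)] that(2) s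
    by (intro tsum_linear_s) auto
  show ?thesis
  proof (rule module_homI)
    fix a b assume ab: "a \<in> carrier V" "b \<in> carrier V"
    show "f (a \<oplus>\<^bsub>V\<^esub> b) v = f a v \<oplus>\<^bsub>T\<^esub> f b v"
    proof (rule eqI)
      fix u w assume uw: "u \<in> carrier U" "w \<in> carrier W"
      show "f (a \<oplus>\<^bsub>V\<^esub> b) (t u w) = f a (t u w) \<oplus>\<^bsub>T\<^esub> f b (t u w)"
        using LinearCombinations.module_hom_add[OF ts[OF uw] ab]
        unfolding representsD(5)[OF rep[OF ab(1)] uw] representsD(5)[OF rep[OF ab(2)] uw]
          representsD(5)[OF rep[OF V.a_closed[OF ab]] uw] .
    qed (intro module_hom_plus[OF tp.T.module_axioms] lin ab V.a_closed)+
  next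
    fix k a assume ka: "k \<in> carrier K" "a \<in> carrier V"
    show "f (k \<odot>\<^bsub>V\<^esub> a) v = k \<odot>\<^bsub>T\<^esub> f a v"
    proof (rule eqI)
      fix u w assume uw: "u \<in> carrier U" "w \<in> carrier W"
      show "f (k \<odot>\<^bsub>V\<^esub> a) (t u w) = k \<odot>\<^bsub>T\<^esub> f a (t u w)"
        using LinearCombinations.module_hom_smult[OF ts[OF uw] ka]
        unfolding representsD(5)[OF rep[OF ka(2)] uw] representsD(5)[OF rep[OF V.smult_closed[OF ka]] uw] .
    qed (intro module_hom_smult_const[OF tp.T.module_axioms] lin ka V.smult_closed)+
  qed (rule module_hom_in_carrier[OF lin v])
qed

end

context ly_extension
begin

lemma G_module: "Module.module K G" and G_vs: "vectorspace K G"
  by (rule G.module_axioms, rule G.vectorspace_axioms)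

lemma family_lin:
  "i \<in> J \<Longrightarrow> (\<lambda>a. c i a) \<in> linear_maps K G alg_module"
  "q \<in> J \<times> J \<Longrightarrow> a \<in> carrier G \<Longrightarrow> (\<lambda>b. case q of (i, j) \<Rightarrow> c i a \<otimes>\<^bsub>A\<^esub> c j b) \<in> linear_maps K G alg_module"
  "q \<in> J \<times> J \<Longrightarrow> b \<in> carrier G \<Longrightarrow> (\<lambda>a. case q of (i, j) \<Rightarrow> c i a \<otimes>\<^bsub>A\<^esub> c j b) \<in> linear_maps K G alg_module"
  using c alg_module_mult_left[OF c] alg_module_mult_right[OF c] by (auto simp: split_beta)

lemma F_lin:
  "i \<in> J \<Longrightarrow> \<rho> (e i) \<in> linear_maps K U U"
  "q \<in> J \<times> J \<Longrightarrow> (case q of (i, j) \<Rightarrow> D (e i) (e j)) \<in> linear_maps K U U"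
  "q \<in> J \<times> J \<Longrightarrow> (case q of (i, j) \<Rightarrow> \<theta> (e i) (e j)) \<in> linear_maps K U U"
  using \<rho>_lin(1) D_lin(1) \<theta>_lin(1) by auto

text \<open>
  Each operator exists separately; the multilinear dependence on the arguments from \<open>G\<close> comes from the
  linearity of the coefficients.
\<close>

lemma representing_maps_exist:
  obtains \<rho>\<^sub>T D\<^sub>T \<theta>\<^sub>T where "ly_module_maps K G T \<rho>\<^sub>T D\<^sub>T \<theta>\<^sub>T"
    "\<And>a. a \<in> carrier G \<Longrightarrow> represents (\<rho>\<^sub>T a) J (\<lambda>i. \<rho> (e i)) (\<lambda>i. c i a)"
    "\<And>a b. a \<in> carrier G \<Longrightarrow> b \<in> carrier G \<Longrightarrow>
      represents (D\<^sub>T a b) (J \<times> J) (\<lambda>(i, j). D (e i) (e j)) (\<lambda>(i, j). c i a \<otimes>\<^bsub>A\<^esub> c j b)"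
    "\<And>a b. a \<in> carrier G \<Longrightarrow> b \<in> carrier G \<Longrightarrow>
      represents (\<theta>\<^sub>T a b) (J \<times> J) (\<lambda>(i, j). \<theta> (e i) (e j)) (\<lambda>(i, j). c i a \<otimes>\<^bsub>A\<^esub> c j b)"
proof -
  have ex: "\<exists>f. represents f Q F s" if "finite Q" "\<And>q. q \<in> Q \<Longrightarrow> F q \<in> linear_maps K U U" "s \<in> Q \<rightarrow> carrier A"
    for Q :: "'y set" and F s
    using tensor_operator_exists[of Q F s] that unfolding represents_def by blast
  have "\<forall>a\<in>carrier G. \<exists>f. represents f J (\<lambda>i. \<rho> (e i)) (\<lambda>i. c i a)"
    by (intro ballI ex J F_lin) auto
  then obtain \<rho>\<^sub>T where r: "\<And>a. a \<in> carrier G \<Longrightarrow> represents (\<rho>\<^sub>T a) J (\<lambda>i. \<rho> (e i)) (\<lambda>i. c i a)"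
    by metis
  have "\<forall>a\<in>carrier G. \<forall>b\<in>carrier G. \<exists>f. represents f (J \<times> J) (\<lambda>(i, j). D (e i) (e j)) (\<lambda>(i, j). c i a \<otimes>\<^bsub>A\<^esub> c j b)"
    by (intro ballI ex J2 F_lin) auto
  then obtain D\<^sub>T where d: "\<And>a b. a \<in> carrier G \<Longrightarrow> b \<in> carrier G \<Longrightarrow>
      represents (D\<^sub>T a b) (J \<times> J) (\<lambda>(i, j). D (e i) (e j)) (\<lambda>(i, j). c i a \<otimes>\<^bsub>A\<^esub> c j b)"
    by metis
  have "\<forall>a\<in>carrier G. \<forall>b\<in>carrier G. \<exists>f. represents f (J \<times> J) (\<lambda>(i, j). \<theta> (e i) (e j)) (\<lambda>(i, j). c i a \<otimes>\<^bsub>A\<^esub> c j b)"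
    by (intro ballI ex J2 F_lin) auto
  then obtain \<theta>\<^sub>T where th: "\<And>a b. a \<in> carrier G \<Longrightarrow> b \<in> carrier G \<Longrightarrow>
      represents (\<theta>\<^sub>T a b) (J \<times> J) (\<lambda>(i, j). \<theta> (e i) (e j)) (\<lambda>(i, j). c i a \<otimes>\<^bsub>A\<^esub> c j b)"
    by metis
  have "bilinear_map K G T T \<rho>\<^sub>T"
    by (rule bilinear_mapI[OF representsD(2)[OF r] representing_family_linear[OF r family_lin(1) G_module]])
  moreover have "trilinear_map K G G T T D\<^sub>T"
    by (rule trilinear_mapI[OF representsD(2)[OF d] 
        representing_family_linear[OF d family_lin(2) G_module]
        representing_family_linear[OF d family_lin(3) G_module]])
  moreover have "trilinear_map K G G T T \<theta>\<^sub>T"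
    by (rule trilinear_mapI[OF representsD(2)[OF th] 
        representing_family_linear[OF th family_lin(2) G_module]
        representing_family_linear[OF th family_lin(3) G_module]])
  ultimately have "ly_module_maps K G T \<rho>\<^sub>T D\<^sub>T \<theta>\<^sub>T" by (simp add: ly_module_maps_def)
  then show thesis using r d th by (rule that)
qed

text \<open>
  A map given by the prescribed formula at the basis vectors of \<open>G\<close> is represented at every element
  of \<open>G\<close>. Hence the maps are determined by these formulas.
\<close>

lemma linear_represents_of_basis:
  assumes f: "indexed_basis K G I f" and R: "bilinear_map K G T T R"
    and eq: "\<And>u w p. u \<in> carrier U \<Longrightarrow> w \<in> carrier W \<Longrightarrow> p \<in> I \<Longrightarrow>
      R (f p) (t u w) = tsum J (\<lambda>i. \<rho> (e i) u) (\<lambda>i. c i (f p)) w"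
    and a: "a \<in> carrier G"
  shows "represents (R a) J (\<lambda>i. \<rho> (e i)) (\<lambda>i. c i a)"
proof -
  have "R a (t u w) = tsum J (\<lambda>i. \<rho> (e i) u) (\<lambda>i. c i a) w" if "u \<in> carrier U" "w \<in> carrier W" for u w
    by (rule basis_hom_eqI[OF G_vs f tp.T.module_axioms bilinear_mapD(2)[OF R] tsum_linear_s _ a])
      (use that eq family_lin in auto)
  then show ?thesis
    using J F_lin a bilinear_mapD(1)[OF R a] by (auto simp: represents_def)
qed

lemma bilinear_represents_of_basis:
  assumes f: "indexed_basis K G I f" and R: "trilinear_map K G G T T R"
    and N: "\<And>q. q \<in> J \<times> J \<Longrightarrow> N q \<in> linear_maps K U U"
    and eq: "\<And>u w p q. u \<in> carrier U \<Longrightarrow> w \<in> carrier W \<Longrightarrow> p \<in> I \<Longrightarrow> q \<in> I \<Longrightarrow>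
      R (f p) (f q) (t u w) = tsum (J \<times> J) (\<lambda>q. N q u) (\<lambda>(i, j). c i (f p) \<otimes>\<^bsub>A\<^esub> c j (f q)) w"
    and ab: "a \<in> carrier G" "b \<in> carrier G"
  shows "represents (R a b) (J \<times> J) N (\<lambda>(i, j). c i a \<otimes>\<^bsub>A\<^esub> c j b)"
proof -
  have "R a b (t u w) = tsum (J \<times> J) (\<lambda>q. N q u) (\<lambda>(i, j). c i a \<otimes>\<^bsub>A\<^esub> c j b) w"
    if uw: "u \<in> carrier U" "w \<in> carrier W" for u w
  proof -
    have Nc: "(\<lambda>q. N q u) \<in> J \<times> J \<rightarrow> carrier U"
      using module_hom_in_carrier[OF N uw(1)] by blast
    show ?thesis
    proof (rule basis_bilinear_eqI[OF G_vs f tp.T.module_axioms _ _ _ ab])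
      show "bilinear_map K G G T (\<lambda>a b. R a b (t u w))"
        using trilinear_mapD(2,3)[OF R] uw by (intro bilinear_mapI) auto
      show "bilinear_map K G G T (\<lambda>a b. tsum (J \<times> J) (\<lambda>q. N q u) (\<lambda>(i, j). c i a \<otimes>\<^bsub>A\<^esub> c j b) w)"
        by (intro bilinear_mapI tsum_linear_s[OF Nc uw(2)] family_lin)
    qed (rule eq[OF uw])
  qed
  then show ?thesis
    using J2 N ab trilinear_mapD(1)[OF R ab] by (auto simp: represents_def)
qed

end

section \<open>The coefficient maps\<close>

text \<open>
  Elements \<open>x s i\<close> of \<open>A\<close> subject to the defining relations of the universal algebra yield the linear
  maps \<open>c s\<close> with \<open>c s (f i) = x s i\<close>. The relations are the compatibility with the operations at basis
  vectors, which extends to all of \<open>G\<close> by multilinearity.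
\<close>

lemma (in tensor_action) coefficient_maps_exist:
  fixes G :: "('k, 'g, 'z) ly_algebra_scheme" and J :: "'j set" and I :: "'i set"
  assumes G: "lie_yamaguti K G" and f: "indexed_basis K G I f"
    and x: "\<And>s i. s \<in> J \<Longrightarrow> i \<in> I \<Longrightarrow> x s i \<in> carrier A"
    and \<tau>: "\<And>q s. q \<in> J \<times> J \<Longrightarrow> s \<in> J \<Longrightarrow> \<tau> q s \<in> carrier K"
    and \<omega>: "\<And>q s. q \<in> J \<times> J \<times> J \<Longrightarrow> s \<in> J \<Longrightarrow> \<omega> q s \<in> carrier K"
    and B: "\<And>i j. i \<in> I \<Longrightarrow> j \<in> I \<Longrightarrow> B i j \<subseteq> I"
    and \<alpha>: "\<And>i j u. i \<in> I \<Longrightarrow> j \<in> I \<Longrightarrow> u \<in> B i j \<Longrightarrow> \<alpha> i j u \<in> carrier K"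
    and br: "\<And>i j. i \<in> I \<Longrightarrow> j \<in> I \<Longrightarrow> \<langle>f i, f j\<rangle>\<^bsub>G\<^esub> = (\<Oplus>\<^bsub>G\<^esub>u \<in> B i j. \<alpha> i j u \<odot>\<^bsub>G\<^esub> f u)"
    and C: "\<And>i j k. i \<in> I \<Longrightarrow> j \<in> I \<Longrightarrow> k \<in> I \<Longrightarrow> C i j k \<subseteq> I"
    and \<beta>: "\<And>i j k u. i \<in> I \<Longrightarrow> j \<in> I \<Longrightarrow> k \<in> I \<Longrightarrow> u \<in> C i j k \<Longrightarrow> \<beta> i j k u \<in> carrier K"
    and tr: "\<And>i j k. i \<in> I \<Longrightarrow> j \<in> I \<Longrightarrow> k \<in> I \<Longrightarrow>
      \<lbrace>f i, f j, f k\<rbrace>\<^bsub>G\<^esub> = (\<Oplus>\<^bsub>G\<^esub>u \<in> C i j k. \<beta> i j k u \<odot>\<^bsub>G\<^esub> f u)"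
    and bin: "\<And>s i j. s \<in> J \<Longrightarrow> i \<in> I \<Longrightarrow> j \<in> I \<Longrightarrow> (\<Oplus>\<^bsub>A\<^esub>u \<in> B i j. h (\<alpha> i j u) \<otimes>\<^bsub>A\<^esub> x s u) =
      (\<Oplus>\<^bsub>A\<^esub>q\<in>J \<times> J. h (\<tau> q s) \<otimes>\<^bsub>A\<^esub> (case q of (k, l) \<Rightarrow> x k i \<otimes>\<^bsub>A\<^esub> x l j))"
    and ter: "\<And>s i j k. s \<in> J \<Longrightarrow> i \<in> I \<Longrightarrow> j \<in> I \<Longrightarrow> k \<in> I \<Longrightarrow>
      (\<Oplus>\<^bsub>A\<^esub>u \<in> C i j k. h (\<beta> i j k u) \<otimes>\<^bsub>A\<^esub> x s u) =
      (\<Oplus>\<^bsub>A\<^esub>q\<in>J \<times> J \<times> J. h (\<omega> q s) \<otimes>\<^bsub>A\<^esub> (case q of (l, m, r) \<Rightarrow> x l i \<otimes>\<^bsub>A\<^esub> (x m j \<otimes>\<^bsub>A\<^esub> x r k)))"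
  obtains c where "\<And>s. s \<in> J \<Longrightarrow> c s \<in> linear_maps K G alg_module"
    "\<And>s i. s \<in> J \<Longrightarrow> i \<in> I \<Longrightarrow> c s (f i) = x s i"
    "\<And>s a b. s \<in> J \<Longrightarrow> a \<in> carrier G \<Longrightarrow> b \<in> carrier G \<Longrightarrow>
      c s \<langle>a, b\<rangle>\<^bsub>G\<^esub> = (\<Oplus>\<^bsub>A\<^esub>q\<in>J \<times> J. h (\<tau> q s) \<otimes>\<^bsub>A\<^esub> (case q of (i, j) \<Rightarrow> c i a \<otimes>\<^bsub>A\<^esub> c j b))"
    "\<And>s a b d. s \<in> J \<Longrightarrow> a \<in> carrier G \<Longrightarrow> b \<in> carrier G \<Longrightarrow> d \<in> carrier G \<Longrightarrow>
      c s \<lbrace>a, b, d\<rbrace>\<^bsub>G\<^esub> = (\<Oplus>\<^bsub>A\<^esub>q\<in>J \<times> J \<times> J. h (\<omega> q s) \<otimes>\<^bsub>A\<^esub>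
        (case q of (i, j, k) \<Rightarrow> c i a \<otimes>\<^bsub>A\<^esub> (c j b \<otimes>\<^bsub>A\<^esub> c k d)))"
proof -
  interpret G: lie_yamaguti K G by fact
  note G_vs = G.vectorspace_axioms
  have "\<forall>s\<in>J. \<exists>g. g \<in> linear_maps K G alg_module \<and> (\<forall>i\<in>I. g (f i) = x s i)"
  proof
    fix s assume "s \<in> J"
    then have "x s \<in> I \<rightarrow> carrier alg_module" using x by auto
    from basis_hom_exists[OF G_vs f alg_module_module this]
    show "\<exists>g. g \<in> linear_maps K G alg_module \<and> (\<forall>i\<in>I. g (f i) = x s i)" by metis
  qed
  then obtain c where c: "\<And>s. s \<in> J \<Longrightarrow> c s \<in> linear_maps K G alg_module"
    and cf: "\<And>s i. s \<in> J \<Longrightarrow> i \<in> I \<Longrightarrow> c s (f i) = x s i"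
    by metis
  have fc: "f i \<in> carrier G" if "i \<in> I" for i using indexed_basisE(2)[OF G_vs f] that by auto
  have cc: "c s a \<in> carrier A" if "s \<in> J" "a \<in> carrier G" for s a
    using module_hom_in_carrier[OF c] that by simp
  have expand: "c s (\<Oplus>\<^bsub>G\<^esub>u\<in>S. k u \<odot>\<^bsub>G\<^esub> f u) = (\<Oplus>\<^bsub>A\<^esub>u\<in>S. h (k u) \<otimes>\<^bsub>A\<^esub> x s u)"
    if s: "s \<in> J" and S: "S \<subseteq> I" and k: "\<And>u. u \<in> S \<Longrightarrow> k u \<in> carrier K" for s S k
  proof -
    have "c s (\<Oplus>\<^bsub>G\<^esub>u\<in>S. k u \<odot>\<^bsub>G\<^esub> f u) = (\<Oplus>\<^bsub>alg_module\<^esub>u\<in>S. c s (k u \<odot>\<^bsub>G\<^esub> f u))"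
      by (rule module_hom_finsum_eq[OF G.module_axioms alg_module_module c[OF s]]) (use S k fc in auto)
    also have "\<dots> = (\<Oplus>\<^bsub>A\<^esub>u\<in>S. c s (k u \<odot>\<^bsub>G\<^esub> f u))" by simp
    also have "\<dots> = (\<Oplus>\<^bsub>A\<^esub>u\<in>S. h (k u) \<otimes>\<^bsub>A\<^esub> x s u)"
    proof (rule W.R.finsum_cong')
      fix u assume "u \<in> S"
      then show "c s (k u \<odot>\<^bsub>G\<^esub> f u) = h (k u) \<otimes>\<^bsub>A\<^esub> x s u"
        using LinearCombinations.module_hom_smult[OF c[OF s] k fc, of u u] S s cf by auto
    qed (use S k s x in auto)
    finally show ?thesis .
  qed
  note br_lin = bilinear_mapD[OF G.bracket_bilinear] and tr_lin = trilinear_mapD[OF G.triple_trilinear]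
  note sum_lin = module_hom_finsum_fun[OF alg_module_module, unfolded finsum_alg_module]
  have cb: "c s \<langle>a, b\<rangle>\<^bsub>G\<^esub> = (\<Oplus>\<^bsub>A\<^esub>q\<in>J \<times> J. h (\<tau> q s) \<otimes>\<^bsub>A\<^esub> (case q of (i, j) \<Rightarrow> c i a \<otimes>\<^bsub>A\<^esub> c j b))"
    if s: "s \<in> J" and ab: "a \<in> carrier G" "b \<in> carrier G" for s a b
  proof (rule basis_bilinear_eqI[OF G_vs f alg_module_module _ _ _ ab])
    show "bilinear_map K G G alg_module (\<lambda>a b. c s \<langle>a, b\<rangle>\<^bsub>G\<^esub>)"
      by (intro bilinear_mapI module_hom_comp[OF br_lin(1) c] module_hom_comp[OF br_lin(2) c] s)
    show "bilinear_map K G G alg_module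
      (\<lambda>a b. \<Oplus>\<^bsub>A\<^esub>q\<in>J \<times> J. h (\<tau> q s) \<otimes>\<^bsub>A\<^esub> (case q of (i, j) \<Rightarrow> c i a \<otimes>\<^bsub>A\<^esub> c j b))"
    proof (intro bilinear_mapI sum_lin alg_module_mult_left h_closed \<tau> s; (assumption)?)
      fix a q assume "a \<in> carrier G" "q \<in> J \<times> J"
      then show "(\<lambda>b. case q of (i, j) \<Rightarrow> c i a \<otimes>\<^bsub>A\<^esub> c j b) \<in> linear_maps K G alg_module"
        using alg_module_mult_left[OF c cc] by (auto simp: split_beta)
    next
      fix b q assume "b \<in> carrier G" "q \<in> J \<times> J"
      then show "(\<lambda>a. case q of (i, j) \<Rightarrow> c i a \<otimes>\<^bsub>A\<^esub> c j b) \<in> linear_maps K G alg_module"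
        using alg_module_mult_right[OF c cc] by (auto simp: split_beta)
    qed
    fix i j assume ij: "i \<in> I" "j \<in> I"
    have "c s \<langle>f i, f j\<rangle>\<^bsub>G\<^esub> = (\<Oplus>\<^bsub>A\<^esub>u\<in>B i j. h (\<alpha> i j u) \<otimes>\<^bsub>A\<^esub> x s u)"
      unfolding br[OF ij] by (rule expand[OF s B[OF ij] \<alpha>[OF ij]])
    also have "\<dots> = (\<Oplus>\<^bsub>A\<^esub>q\<in>J \<times> J. h (\<tau> q s) \<otimes>\<^bsub>A\<^esub> (case q of (k, l) \<Rightarrow> x k i \<otimes>\<^bsub>A\<^esub> x l j))"
      by (rule bin[OF s ij])
    also have "\<dots> = (\<Oplus>\<^bsub>A\<^esub>q\<in>J \<times> J. h (\<tau> q s) \<otimes>\<^bsub>A\<^esub> (case q of (k, l) \<Rightarrow> c k (f i) \<otimes>\<^bsub>A\<^esub> c l (f j)))"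
      by (rule W.R.finsum_cong') (use ij s x cc fc \<tau> in \<open>auto simp: cf\<close>)
    finally show "c s \<langle>f i, f j\<rangle>\<^bsub>G\<^esub> = (\<Oplus>\<^bsub>A\<^esub>q\<in>J \<times> J. h (\<tau> q s) \<otimes>\<^bsub>A\<^esub> (case q of (k, l) \<Rightarrow> c k (f i) \<otimes>\<^bsub>A\<^esub> c l (f j)))" .
  qed
  have ct: "c s \<lbrace>a, b, d\<rbrace>\<^bsub>G\<^esub> = (\<Oplus>\<^bsub>A\<^esub>q\<in>J \<times> J \<times> J. h (\<omega> q s) \<otimes>\<^bsub>A\<^esub>
        (case q of (i, j, k) \<Rightarrow> c i a \<otimes>\<^bsub>A\<^esub> (c j b \<otimes>\<^bsub>A\<^esub> c k d)))"
    if s: "s \<in> J" and abd: "a \<in> carrier G" "b \<in> carrier G" "d \<in> carrier G" for s a b d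
  proof (rule basis_trilinear_eqI[OF G_vs f alg_module_module _ _ _ abd])
    show "trilinear_map K G G G alg_module (\<lambda>a b d. c s \<lbrace>a, b, d\<rbrace>\<^bsub>G\<^esub>)"
      by (intro trilinear_mapI module_hom_comp[OF tr_lin(1) c] module_hom_comp[OF tr_lin(2) c]
          module_hom_comp[OF tr_lin(3) c] s)
    show "trilinear_map K G G G alg_module
      (\<lambda>a b d. \<Oplus>\<^bsub>A\<^esub>q\<in>J \<times> J \<times> J. h (\<omega> q s) \<otimes>\<^bsub>A\<^esub> (case q of (i, j, k) \<Rightarrow> c i a \<otimes>\<^bsub>A\<^esub> (c j b \<otimes>\<^bsub>A\<^esub> c k d)))"
    proof (intro trilinear_mapI sum_lin alg_module_mult_left h_closed \<omega> s; (assumption)?)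
      fix a b q assume *: "a \<in> carrier G" "b \<in> carrier G" "q \<in> J \<times> J \<times> J"
      obtain i j k where q: "q = (i, j, k)" "i \<in> J" "j \<in> J" "k \<in> J" using *(3) by auto
      show "(\<lambda>d. case q of (i, j, k) \<Rightarrow> c i a \<otimes>\<^bsub>A\<^esub> (c j b \<otimes>\<^bsub>A\<^esub> c k d)) \<in> linear_maps K G alg_module"
        unfolding q by (simp, intro alg_module_mult_left c cc q *(1,2))
    next
      fix a d q assume *: "a \<in> carrier G" "d \<in> carrier G" "q \<in> J \<times> J \<times> J"
      obtain i j k where q: "q = (i, j, k)" "i \<in> J" "j \<in> J" "k \<in> J" using *(3) by auto
      show "(\<lambda>b. case q of (i, j, k) \<Rightarrow> c i a \<otimes>\<^bsub>A\<^esub> (c j b \<otimes>\<^bsub>A\<^esub> c k d)) \<in> linear_maps K G alg_module"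
        unfolding q by (simp, intro alg_module_mult_left alg_module_mult_right c cc q *(1,2))
    next
      fix b d q assume *: "b \<in> carrier G" "d \<in> carrier G" "q \<in> J \<times> J \<times> J"
      obtain i j k where q: "q = (i, j, k)" "i \<in> J" "j \<in> J" "k \<in> J" using *(3) by auto
      show "(\<lambda>a. case q of (i, j, k) \<Rightarrow> c i a \<otimes>\<^bsub>A\<^esub> (c j b \<otimes>\<^bsub>A\<^esub> c k d)) \<in> linear_maps K G alg_module"
        unfolding q by (simp, intro alg_module_mult_right c W.R.m_closed cc q *(1,2))
    qed
    fix i j k assume ijk: "i \<in> I" "j \<in> I" "k \<in> I"
    have "c s \<lbrace>f i, f j, f k\<rbrace>\<^bsub>G\<^esub> = (\<Oplus>\<^bsub>A\<^esub>u\<in>C i j k. h (\<beta> i j k u) \<otimes>\<^bsub>A\<^esub> x s u)"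
      unfolding tr[OF ijk] by (rule expand[OF s C[OF ijk] \<beta>[OF ijk]])
    also have "\<dots> = (\<Oplus>\<^bsub>A\<^esub>q\<in>J \<times> J \<times> J. h (\<omega> q s) \<otimes>\<^bsub>A\<^esub> (case q of (l, m, r) \<Rightarrow> x l i \<otimes>\<^bsub>A\<^esub> (x m j \<otimes>\<^bsub>A\<^esub> x r k)))"
      by (rule ter[OF s ijk])
    also have "\<dots> = (\<Oplus>\<^bsub>A\<^esub>q\<in>J \<times> J \<times> J. h (\<omega> q s) \<otimes>\<^bsub>A\<^esub>
        (case q of (l, m, r) \<Rightarrow> c l (f i) \<otimes>\<^bsub>A\<^esub> (c m (f j) \<otimes>\<^bsub>A\<^esub> c r (f k))))"
      by (rule W.R.finsum_cong') (use ijk s x cc fc \<omega> in \<open>auto simp: cf\<close>)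
    finally show "c s \<lbrace>f i, f j, f k\<rbrace>\<^bsub>G\<^esub> = (\<Oplus>\<^bsub>A\<^esub>q\<in>J \<times> J \<times> J. h (\<omega> q s) \<otimes>\<^bsub>A\<^esub>
        (case q of (l, m, r) \<Rightarrow> c l (f i) \<otimes>\<^bsub>A\<^esub> (c m (f j) \<otimes>\<^bsub>A\<^esub> c r (f k))))" .
  qed
  show thesis using c cf cb ct by (rule that)
qed

section \<open>The tensor product module\<close>

theorem theorem4p1:
  fixes K :: "('k, 'm) ring_scheme"
    and L :: "('k, 'l) ly_algebra" and G :: "('k, 'g) ly_algebra"
    and n :: nat and e :: "nat \<Rightarrow> 'l"
    and I :: "'i set" and f :: "'i \<Rightarrow> 'g"
    and \<tau> :: "nat \<Rightarrow> nat \<Rightarrow> nat \<Rightarrow> 'k" and \<omega> :: "nat \<Rightarrow> nat \<Rightarrow> nat \<Rightarrow> nat \<Rightarrow> 'k"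
    and B :: "'i \<Rightarrow> 'i \<Rightarrow> 'i set" and \<alpha> :: "'i \<Rightarrow> 'i \<Rightarrow> 'i \<Rightarrow> 'k"
    and C :: "'i \<Rightarrow> 'i \<Rightarrow> 'i \<Rightarrow> 'i set" and \<beta> :: "'i \<Rightarrow> 'i \<Rightarrow> 'i \<Rightarrow> 'i \<Rightarrow> 'k"
    and A :: "((nat \<times> 'i) multiset \<Rightarrow> 'k) set ring"
    and x :: "nat \<Rightarrow> 'i \<Rightarrow> ((nat \<times> 'i) multiset \<Rightarrow> 'k) set"
    and U :: "('k, 'u) module"
    and \<rho> :: "'l \<Rightarrow> 'u \<Rightarrow> 'u" and D \<theta> :: "'l \<Rightarrow> 'l \<Rightarrow> 'u \<Rightarrow> 'u"
    and W :: "(((nat \<times> 'i) multiset \<Rightarrow> 'k) set, 'w) module"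
    and W\<^sub>K :: "('k, 'w) module"
    and T :: "('k, ('u \<times> 'w \<Rightarrow> 'k) set) module"
    and tens :: "'u \<Rightarrow> 'w \<Rightarrow> ('u \<times> 'w \<Rightarrow> 'k) set"  (infixl \<open>\<otimes>\<^sub>T\<close> 70)
  assumes K: "field_of_char_0 K"
    and L: "lie_yamaguti K L" and G: "lie_yamaguti K G"
    and e: "indexed_basis K L {1..n} e"
    and f: "indexed_basis K G I f"
    and \<tau>_carrier: "\<And>i j s. i \<in> {1..n} \<Longrightarrow> j \<in> {1..n} \<Longrightarrow> s \<in> {1..n} \<Longrightarrow> \<tau> i j s \<in> carrier K"
    and \<tau>: "\<And>i j. i \<in> {1..n} \<Longrightarrow> j \<in> {1..n} \<Longrightarrow>
          \<langle>e i, e j\<rangle>\<^bsub>L\<^esub> = (\<Oplus>\<^bsub>L\<^esub>s \<in> {1..n}. \<tau> i j s \<odot>\<^bsub>L\<^esub> e s)"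
    and \<omega>_carrier: "\<And>i j k s. i \<in> {1..n} \<Longrightarrow> j \<in> {1..n} \<Longrightarrow> k \<in> {1..n} \<Longrightarrow> s \<in> {1..n} \<Longrightarrow>
          \<omega> i j k s \<in> carrier K"
    and \<omega>: "\<And>i j k. i \<in> {1..n} \<Longrightarrow> j \<in> {1..n} \<Longrightarrow> k \<in> {1..n} \<Longrightarrow>
          \<lbrace>e i, e j, e k\<rbrace>\<^bsub>L\<^esub> = (\<Oplus>\<^bsub>L\<^esub>s \<in> {1..n}. \<omega> i j k s \<odot>\<^bsub>L\<^esub> e s)"
    and B: "\<And>i j. i \<in> I \<Longrightarrow> j \<in> I \<Longrightarrow> finite (B i j) \<and> B i j \<subseteq> I"
    and \<alpha>_carrier: "\<And>i j u. i \<in> I \<Longrightarrow> j \<in> I \<Longrightarrow> u \<in> B i j \<Longrightarrow> \<alpha> i j u \<in> carrier K"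
    and \<alpha>: "\<And>i j. i \<in> I \<Longrightarrow> j \<in> I \<Longrightarrow>
          \<langle>f i, f j\<rangle>\<^bsub>G\<^esub> = (\<Oplus>\<^bsub>G\<^esub>u \<in> B i j. \<alpha> i j u \<odot>\<^bsub>G\<^esub> f u)"
    and C: "\<And>i j k. i \<in> I \<Longrightarrow> j \<in> I \<Longrightarrow> k \<in> I \<Longrightarrow> finite (C i j k) \<and> C i j k \<subseteq> I"
    and \<beta>_carrier: "\<And>i j k u. i \<in> I \<Longrightarrow> j \<in> I \<Longrightarrow> k \<in> I \<Longrightarrow> u \<in> C i j k \<Longrightarrow> \<beta> i j k u \<in> carrier K"
    and \<beta>: "\<And>i j k. i \<in> I \<Longrightarrow> j \<in> I \<Longrightarrow> k \<in> I \<Longrightarrow>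
          \<lbrace>f i, f j, f k\<rbrace>\<^bsub>G\<^esub> = (\<Oplus>\<^bsub>G\<^esub>u \<in> C i j k. \<beta> i j k u \<odot>\<^bsub>G\<^esub> f u)"
    and A: "A = universal_algebra K n I \<tau> \<omega> B \<alpha> C \<beta>"
    and x: "x = universal_gen K n I \<tau> \<omega> B \<alpha> C \<beta>"
    and U: "ly_module K L U \<rho> D \<theta>"
    and W: "Module.module A W"
    and W\<^sub>K: "W\<^sub>K = restrict_scalars (universal_scalar K n I \<tau> \<omega> B \<alpha> C \<beta>) W"
    and T: "T = tensor_product K U W\<^sub>K"
    and tens: "tens = pure_tensor K U W\<^sub>K"
  defines "extends_formulas \<equiv> \<lambda>\<rho>\<^sub>T D\<^sub>T \<theta>\<^sub>T.
      ly_module_maps K G T \<rho>\<^sub>T D\<^sub>T \<theta>\<^sub>T \<and>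
      (\<forall>u \<in> carrier U. \<forall>w \<in> carrier W. \<forall>p \<in> I.
        \<rho>\<^sub>T (f p) (u \<otimes>\<^sub>T w) = (\<Oplus>\<^bsub>T\<^esub>i \<in> {1..n}. \<rho> (e i) u \<otimes>\<^sub>T (x i p \<odot>\<^bsub>W\<^esub> w))) \<and>
      (\<forall>u \<in> carrier U. \<forall>w \<in> carrier W. \<forall>p \<in> I. \<forall>q \<in> I.
        D\<^sub>T (f p) (f q) (u \<otimes>\<^sub>T w) =
          (\<Oplus>\<^bsub>T\<^esub>i \<in> {1..n}. \<Oplus>\<^bsub>T\<^esub>j \<in> {1..n}. D (e i) (e j) u \<otimes>\<^sub>T ((x i p \<otimes>\<^bsub>A\<^esub> x j q) \<odot>\<^bsub>W\<^esub> w))) \<and>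
      (\<forall>u \<in> carrier U. \<forall>w \<in> carrier W. \<forall>p \<in> I. \<forall>q \<in> I.
        \<theta>\<^sub>T (f p) (f q) (u \<otimes>\<^sub>T w) =
          (\<Oplus>\<^bsub>T\<^esub>i \<in> {1..n}. \<Oplus>\<^bsub>T\<^esub>j \<in> {1..n}. \<theta> (e i) (e j) u \<otimes>\<^sub>T ((x i p \<otimes>\<^bsub>A\<^esub> x j q) \<odot>\<^bsub>W\<^esub> w)))"
  shows "(\<exists>\<rho>\<^sub>T D\<^sub>T \<theta>\<^sub>T. extends_formulas \<rho>\<^sub>T D\<^sub>T \<theta>\<^sub>T) \<and>
         (\<forall>\<rho>\<^sub>T D\<^sub>T \<theta>\<^sub>T. extends_formulas \<rho>\<^sub>T D\<^sub>T \<theta>\<^sub>T \<longrightarrow> ly_module K G T \<rho>\<^sub>T D\<^sub>T \<theta>\<^sub>T)"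
proof -
  let ?J = "{1..n}"
  let ?h = "universal_scalar K n I \<tau> \<omega> B \<alpha> C \<beta>"
  interpret U: ly_module K L U \<rho> D \<theta> by (rule U)
  interpret S: structure_constants K n I \<tau> \<omega> B \<alpha> C \<beta>
    by (intro structure_constants.intro structure_constants_axioms.intro U.L.R.is_cring)
      (fact \<tau>_carrier \<omega>_carrier B \<alpha>_carrier C \<beta>_carrier)+
  have h: "?h \<in> ring_hom K A" unfolding A by (rule S.h_hom)
  interpret W: Module.module A W by (rule W)
  interpret TA: tensor_action K U A W ?h
    by (intro tensor_action.intro tensor_action_axioms.intro U.V.module_axioms W h)
  have T': "T = TA.T" and tens': "tens = TA.t" by (simp_all add: T tens W\<^sub>K)
  have ec: "e i \<in> carrier L" if "i \<in> ?J" for i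
    using indexed_basisE(2)[OF U.L.vectorspace_axioms e] that by auto
  have xc: "x s i \<in> carrier A" if "s \<in> ?J" "i \<in> I" for s i
    unfolding x A by (rule S.x_closed[OF that])
  have bin: "(\<Oplus>\<^bsub>A\<^esub>u \<in> B i j. ?h (\<alpha> i j u) \<otimes>\<^bsub>A\<^esub> x s u) =
      (\<Oplus>\<^bsub>A\<^esub>q\<in>?J \<times> ?J. ?h (case q of (k, l) \<Rightarrow> \<tau> k l s) \<otimes>\<^bsub>A\<^esub> (case q of (k, l) \<Rightarrow> x k i \<otimes>\<^bsub>A\<^esub> x l j))"
    if "s \<in> ?J" "i \<in> I" "j \<in> I" for s i j
  proof -
    have hc: "?h (\<tau> k l s) \<in> carrier A" if "k \<in> ?J" "l \<in> ?J" for k l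
      by (rule TA.h_closed) (rule \<tau>_carrier[OF that \<open>s \<in> ?J\<close>])
    have "(\<Oplus>\<^bsub>A\<^esub>u \<in> B i j. ?h (\<alpha> i j u) \<otimes>\<^bsub>A\<^esub> x s u) =
        (\<Oplus>\<^bsub>A\<^esub>k \<in> ?J. \<Oplus>\<^bsub>A\<^esub>l \<in> ?J. ?h (\<tau> k l s) \<otimes>\<^bsub>A\<^esub> x k i \<otimes>\<^bsub>A\<^esub> x l j)"
      unfolding x A by (rule S.binary_relation[OF that])
    also have "\<dots> = (\<Oplus>\<^bsub>A\<^esub>q\<in>?J \<times> ?J. case q of (k, l) \<Rightarrow> ?h (\<tau> k l s) \<otimes>\<^bsub>A\<^esub> x k i \<otimes>\<^bsub>A\<^esub> x l j)"
      by (rule W.R.finsum_Times) (use hc xc that in auto)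
    also have "\<dots> = (\<Oplus>\<^bsub>A\<^esub>q\<in>?J \<times> ?J. ?h (case q of (k, l) \<Rightarrow> \<tau> k l s) \<otimes>\<^bsub>A\<^esub> (case q of (k, l) \<Rightarrow> x k i \<otimes>\<^bsub>A\<^esub> x l j))"
      by (rule W.R.finsum_cong') (use hc xc that in \<open>auto simp: W.R.m_assoc\<close>)
    finally show ?thesis .
  qed
  have ter: "(\<Oplus>\<^bsub>A\<^esub>u \<in> C i j k. ?h (\<beta> i j k u) \<otimes>\<^bsub>A\<^esub> x s u) =
      (\<Oplus>\<^bsub>A\<^esub>q\<in>?J \<times> ?J \<times> ?J. ?h (case q of (l, m, r) \<Rightarrow> \<omega> l m r s) \<otimes>\<^bsub>A\<^esub>
        (case q of (l, m, r) \<Rightarrow> x l i \<otimes>\<^bsub>A\<^esub> (x m j \<otimes>\<^bsub>A\<^esub> x r k)))"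
    if "s \<in> ?J" "i \<in> I" "j \<in> I" "k \<in> I" for s i j k
  proof -
    have hc: "?h (\<omega> l m r s) \<in> carrier A" if "l \<in> ?J" "m \<in> ?J" "r \<in> ?J" for l m r
      by (rule TA.h_closed) (rule \<omega>_carrier[OF that \<open>s \<in> ?J\<close>])
    let ?g = "\<lambda>l m r. ?h (\<omega> l m r s) \<otimes>\<^bsub>A\<^esub> x l i \<otimes>\<^bsub>A\<^esub> x m j \<otimes>\<^bsub>A\<^esub> x r k"
    have gc: "?g l m r \<in> carrier A" if "l \<in> ?J" "m \<in> ?J" "r \<in> ?J" for l m r
      using hc xc that \<open>i \<in> I\<close> \<open>j \<in> I\<close> \<open>k \<in> I\<close> by simp
    have "(\<Oplus>\<^bsub>A\<^esub>u \<in> C i j k. ?h (\<beta> i j k u) \<otimes>\<^bsub>A\<^esub> x s u) =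
        (\<Oplus>\<^bsub>A\<^esub>l \<in> ?J. \<Oplus>\<^bsub>A\<^esub>m \<in> ?J. \<Oplus>\<^bsub>A\<^esub>r \<in> ?J. ?g l m r)"
      unfolding x A by (rule S.ternary_relation[OF that])
    also have "\<dots> = (\<Oplus>\<^bsub>A\<^esub>l \<in> ?J. \<Oplus>\<^bsub>A\<^esub>z \<in> ?J \<times> ?J. case z of (m, r) \<Rightarrow> ?g l m r)"
      by (rule W.R.finsum_cong'[OF refl _ W.R.finsum_Times]) (use gc in \<open>auto intro!: W.R.finsum_closed\<close>)
    also have "\<dots> = (\<Oplus>\<^bsub>A\<^esub>q\<in>?J \<times> ?J \<times> ?J. case q of (l, z) \<Rightarrow> case z of (m, r) \<Rightarrow> ?g l m r)"
      by (rule W.R.finsum_Times) (use gc in auto)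
    also have "\<dots> = (\<Oplus>\<^bsub>A\<^esub>q\<in>?J \<times> ?J \<times> ?J. ?h (case q of (l, m, r) \<Rightarrow> \<omega> l m r s) \<otimes>\<^bsub>A\<^esub>
        (case q of (l, m, r) \<Rightarrow> x l i \<otimes>\<^bsub>A\<^esub> (x m j \<otimes>\<^bsub>A\<^esub> x r k)))"
      by (rule W.R.finsum_cong') (use hc xc that in \<open>auto simp: W.R.m_assoc\<close>)
    finally show ?thesis .
  qed
  have \<tau>q: "(case q of (k, l) \<Rightarrow> \<tau> k l s) \<in> carrier K" if "q \<in> ?J \<times> ?J" "s \<in> ?J" for q s
    using that \<tau>_carrier by auto
  have \<omega>q: "(case q of (k, l, m) \<Rightarrow> \<omega> k l m s) \<in> carrier K" if "q \<in> ?J \<times> ?J \<times> ?J" "s \<in> ?J" for q s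
    using that \<omega>_carrier by auto
  obtain c where c: "\<And>s. s \<in> ?J \<Longrightarrow> c s \<in> linear_maps K G TA.alg_module"
    and cf: "\<And>s i. s \<in> ?J \<Longrightarrow> i \<in> I \<Longrightarrow> c s (f i) = x s i"
    and c_bracket: "\<And>s a b. s \<in> ?J \<Longrightarrow> a \<in> carrier G \<Longrightarrow> b \<in> carrier G \<Longrightarrow>
      c s \<langle>a, b\<rangle>\<^bsub>G\<^esub> = (\<Oplus>\<^bsub>A\<^esub>q\<in>?J \<times> ?J. ?h (case q of (i, j) \<Rightarrow> \<tau> i j s) \<otimes>\<^bsub>A\<^esub>
        (case q of (i, j) \<Rightarrow> c i a \<otimes>\<^bsub>A\<^esub> c j b))"
    and c_triple: "\<And>s a b d. s \<in> ?J \<Longrightarrow> a \<in> carrier G \<Longrightarrow> b \<in> carrier G \<Longrightarrow> d \<in> carrier G \<Longrightarrow>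
      c s \<lbrace>a, b, d\<rbrace>\<^bsub>G\<^esub> = (\<Oplus>\<^bsub>A\<^esub>q\<in>?J \<times> ?J \<times> ?J. ?h (case q of (i, j, k) \<Rightarrow> \<omega> i j k s) \<otimes>\<^bsub>A\<^esub>
        (case q of (i, j, k) \<Rightarrow> c i a \<otimes>\<^bsub>A\<^esub> (c j b \<otimes>\<^bsub>A\<^esub> c k d)))"
    by (rule TA.coefficient_maps_exist[where J = "?J" and x = x and \<tau> = "\<lambda>q s. case q of (i, j) \<Rightarrow> \<tau> i j s"
        and \<omega> = "\<lambda>q s. case q of (i, j, k) \<Rightarrow> \<omega> i j k s" and B = B and \<alpha> = \<alpha> and C = C and \<beta> = \<beta>,
        OF G f xc \<tau>q \<omega>q conjunct2[OF B] \<alpha>_carrier \<alpha> conjunct2[OF C] \<beta>_carrier \<beta> bin ter]; (rule that; assumption | assumption)?)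
  interpret E: ly_extension K L U \<rho> D \<theta> G A W ?h ?J e \<tau> \<omega> c
    by (intro ly_extension.intro ly_extension_axioms.intro TA.tensor_action_axioms U G)
      (simp, (fact ec \<tau>_carrier \<tau> \<omega>_carrier \<omega> c c_bracket c_triple)+)
  have fc: "f p \<in> carrier G" if "p \<in> I" for p using indexed_basisE(2)[OF E.G_vs f] that by auto
  have sum1: "(\<Oplus>\<^bsub>T\<^esub>i \<in> ?J. tens (\<rho> (e i) u) (x i p \<odot>\<^bsub>W\<^esub> w)) =
      TA.tsum ?J (\<lambda>i. \<rho> (e i) u) (\<lambda>i. c i (f p)) w" if "u \<in> carrier U" "w \<in> carrier W" "p \<in> I" for u w p
    unfolding T' tens' TA.tsum_def
    by (rule TA.tp.T.finsum_cong') (use that fc in \<open>auto simp flip: cf\<close>)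
  have sum2: "(\<Oplus>\<^bsub>T\<^esub>i \<in> ?J. \<Oplus>\<^bsub>T\<^esub>j \<in> ?J. tens (M (e i) (e j) u) ((x i p \<otimes>\<^bsub>A\<^esub> x j q) \<odot>\<^bsub>W\<^esub> w)) =
      TA.tsum (?J \<times> ?J) (\<lambda>q. (case q of (i, j) \<Rightarrow> M (e i) (e j)) u) (\<lambda>(i, j). c i (f p) \<otimes>\<^bsub>A\<^esub> c j (f q)) w"
    if "u \<in> carrier U" "w \<in> carrier W" "p \<in> I" "q \<in> I"
      and M: "\<And>a b. a \<in> carrier L \<Longrightarrow> b \<in> carrier L \<Longrightarrow> M a b u \<in> carrier U" for M u w p q
  proof -
    have "(\<Oplus>\<^bsub>T\<^esub>i \<in> ?J. \<Oplus>\<^bsub>T\<^esub>j \<in> ?J. tens (M (e i) (e j) u) ((x i p \<otimes>\<^bsub>A\<^esub> x j q) \<odot>\<^bsub>W\<^esub> w)) =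
        (\<Oplus>\<^bsub>T\<^esub>z \<in> ?J \<times> ?J. case z of (i, j) \<Rightarrow> tens (M (e i) (e j) u) ((x i p \<otimes>\<^bsub>A\<^esub> x j q) \<odot>\<^bsub>W\<^esub> w))"
      unfolding T' tens' by (rule TA.tp.T.finsum_Times) (use that ec xc in auto)
    also have "\<dots> = TA.tsum (?J \<times> ?J) (\<lambda>q. (case q of (i, j) \<Rightarrow> M (e i) (e j)) u) (\<lambda>(i, j). c i (f p) \<otimes>\<^bsub>A\<^esub> c j (f q)) w"
      unfolding T' tens' TA.tsum_def
      by (rule TA.tp.T.finsum_cong') (use that ec fc in \<open>auto simp flip: cf\<close>)
    finally show ?thesis .
  qed
  \<comment> \<open>The prescribed formulas, rewritten in terms of the maps \<open>c i\<close>.\<close>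
  have formulas: "extends_formulas \<rho>\<^sub>T D\<^sub>T \<theta>\<^sub>T \<longleftrightarrow> ly_module_maps K G TA.T \<rho>\<^sub>T D\<^sub>T \<theta>\<^sub>T \<and>
      (\<forall>u\<in>carrier U. \<forall>w\<in>carrier W. \<forall>p\<in>I. \<rho>\<^sub>T (f p) (TA.t u w) = TA.tsum ?J (\<lambda>i. \<rho> (e i) u) (\<lambda>i. c i (f p)) w) \<and>
      (\<forall>u\<in>carrier U. \<forall>w\<in>carrier W. \<forall>p\<in>I. \<forall>q\<in>I. D\<^sub>T (f p) (f q) (TA.t u w) =
        TA.tsum (?J \<times> ?J) (\<lambda>q. (case q of (i, j) \<Rightarrow> D (e i) (e j)) u) (\<lambda>(i, j). c i (f p) \<otimes>\<^bsub>A\<^esub> c j (f q)) w) \<and>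
      (\<forall>u\<in>carrier U. \<forall>w\<in>carrier W. \<forall>p\<in>I. \<forall>q\<in>I. \<theta>\<^sub>T (f p) (f q) (TA.t u w) =
        TA.tsum (?J \<times> ?J) (\<lambda>q. (case q of (i, j) \<Rightarrow> \<theta> (e i) (e j)) u) (\<lambda>(i, j). c i (f p) \<otimes>\<^bsub>A\<^esub> c j (f q)) w)"
    for \<rho>\<^sub>T D\<^sub>T \<theta>\<^sub>T
    unfolding extends_formulas_def T'[symmetric] tens'[symmetric]
    using sum1 sum2[of _ _ _ _ D] sum2[of _ _ _ _ \<theta>] E.closed(2,3) by simp
  show ?thesis
  proof (intro conjI allI impI)
    obtain \<rho>\<^sub>T D\<^sub>T \<theta>\<^sub>T where maps: "ly_module_maps K G TA.T \<rho>\<^sub>T D\<^sub>T \<theta>\<^sub>T"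
      and r: "\<And>a. a \<in> carrier G \<Longrightarrow> TA.represents (\<rho>\<^sub>T a) ?J (\<lambda>i. \<rho> (e i)) (\<lambda>i. c i a)"
      and d: "\<And>a b. a \<in> carrier G \<Longrightarrow> b \<in> carrier G \<Longrightarrow>
        TA.represents (D\<^sub>T a b) (?J \<times> ?J) (\<lambda>(i, j). D (e i) (e j)) (\<lambda>(i, j). c i a \<otimes>\<^bsub>A\<^esub> c j b)"
      and th: "\<And>a b. a \<in> carrier G \<Longrightarrow> b \<in> carrier G \<Longrightarrow>
        TA.represents (\<theta>\<^sub>T a b) (?J \<times> ?J) (\<lambda>(i, j). \<theta> (e i) (e j)) (\<lambda>(i, j). c i a \<otimes>\<^bsub>A\<^esub> c j b)"
      using E.representing_maps_exist by metis
    have "extends_formulas \<rho>\<^sub>T D\<^sub>T \<theta>\<^sub>T"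
      unfolding formulas
      by (intro conjI ballI maps TA.representsD(5)[OF r] TA.representsD(5)[OF d] TA.representsD(5)[OF th] fc)
    then show "\<exists>\<rho>\<^sub>T D\<^sub>T \<theta>\<^sub>T. extends_formulas \<rho>\<^sub>T D\<^sub>T \<theta>\<^sub>T" by blast
  next
    fix \<rho>\<^sub>T D\<^sub>T \<theta>\<^sub>T
    assume "extends_formulas \<rho>\<^sub>T D\<^sub>T \<theta>\<^sub>T"
    note F = this[unfolded formulas]
    have maps: "ly_module_maps K G TA.T \<rho>\<^sub>T D\<^sub>T \<theta>\<^sub>T" using F by (rule conjunct1)
    then have lin: "bilinear_map K G TA.T TA.T \<rho>\<^sub>T" "trilinear_map K G G TA.T TA.T D\<^sub>T"
      "trilinear_map K G G TA.T TA.T \<theta>\<^sub>T"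
      by (simp_all add: ly_module_maps_def)
    show "ly_module K G T \<rho>\<^sub>T D\<^sub>T \<theta>\<^sub>T"
      unfolding T'
    proof (rule E.ly_module_of_representing[OF _ _ _ maps])
      fix a b assume a: "a \<in> carrier G" and b: "b \<in> carrier G"
      show "TA.represents (\<rho>\<^sub>T a) ?J (\<lambda>i. \<rho> (e i)) (\<lambda>i. c i a)"
        by (rule E.linear_represents_of_basis[OF f lin(1) _ a]) (use F in blast)
      show "TA.represents (D\<^sub>T a b) (?J \<times> ?J) (\<lambda>(i, j). D (e i) (e j)) (\<lambda>(i, j). c i a \<otimes>\<^bsub>A\<^esub> c j b)"
        by (rule E.bilinear_represents_of_basis[OF f lin(2) E.F_lin(2) _ a b]) (use F in blast)+
      show "TA.represents (\<theta>\<^sub>T a b) (?J \<times> ?J) (\<lambda>(i, j). \<theta> (e i) (e j)) (\<lambda>(i, j). c i a \<otimes>\<^bsub>A\<^esub> c j b)"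
        by (rule E.bilinear_represents_of_basis[OF f lin(3) E.F_lin(3) _ a b]) (use F in blast)+
    qed
  qed
qed

end
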